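(* There exist constants $C,c>0$ such that for every integer $N\ge4$ the set $\mathcal P_N\subset\mathbb S^2$ of $N$ deterministic Diamond points satisfies $$c\,N^{-3/4}\le D_{L^2}^C(\mathcal P_N)\le C\,N^{-3/4},$$ where $D_{L^2}^C$ denotes the $L^2$ spherical cap discrepancy.
   Context: $\mathbb S^2$ is the unit sphere in $\mathbb R^3$ and $\sigma$ is the surface area measure on $\mathbb S^2$ normalized to be a probability measure. For $x\in\mathbb S^2$ and $t\in[-1,1]$, $C(x,t)=\{y\in\mathbb S^2: x\cdot y\ge t\}$ is the spherical cap. For a finite set $X\subset\mathbb S^2$, the $L^2$ spherical cap discrepancy is $$D_{L^2}^C(X)=\sqrt{\int_{-1}^{1}\int_{\mathbb S^2}\left|\frac{\#(X\cap C(x,t))}{\#X}-\sigma(C(x,t))\right|^2d\sigma(x)\,dt}.$$ Deterministic Diamond points $\mathcal P_N$, for an integer $N\ge4$: put $M=\lfloor\sqrt{N/4}\rfloor$, $r_j=4j$ for $1\le j<M$, $r_M=N-2\sum_{j=1}^{M-1}r_j$, and $r_{M+j}=r_{M-j}$ for $1\le j<M$ (so $r_1,\dots,r_{2M-1}$ are positive integers with sum $N$). For $1\le j\le 2M-1$ let $$h_j=1-\frac2N\sum_{k=1}^{j-1}r_k-\frac{r_j}{N},\qquad \rho_j=\sqrt{1-h_j^2}.$$ Then $$\mathcal P_N=\Big\{\big(\rho_j\cos\tfrac{2\pi\ell}{r_j},\ \rho_j\sin\tfrac{2\pi\ell}{r_j},\ h_j\big):\ 1\le j\le 2M-1,\ 0\le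 \ell\le r_j-1\Big\},$$ i.e. on the parallel at height $h_j$ one places $r_j$ equally spaced points, one of which has positive first coordinate and zero second coordinate. *)

theory Defs
  imports "HOL-Analysis.Analysis"
begin

definition sph_coord :: "real \<times> real \<Rightarrow> real^3" where
  "sph_coord = (\<lambda>(\<theta>, \<phi>). vector [sin \<theta> * cos \<phi>, sin \<theta> * sin \<phi>, cos \<theta>])"

text \<open>
  The area element of the parametrization by polar angle \<open>\<theta>\<close> and azimuth \<open>\<phi>\<close> is
  \<open>sin \<theta>\<close>; see \<open>area_element_sph_coord\<close> below.
\<close>
definition surface_area :: "(real^3) measure" where
  "surface_area =
     distr (density (restrict_space lborel ({0..pi} \<times> {0..2*pi})) (\<lambda>(\<theta>, \<phi>). ennreal (sin \<theta>)))
       (restrict_space borel (sphere 0 1)) sph_coord"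

definition sphere_prob :: "(real^3) measure" where
  "sphere_prob = uniform_measure surface_area (sphere 0 1)"

definition cap :: "real^3 \<Rightarrow> real \<Rightarrow> (real^3) set" where
  "cap x t = {y \<in> sphere 0 1. x \<bullet> y \<ge> t}"

definition L2_cap_discrepancy :: "(real^3) set \<Rightarrow> real" where
  "L2_cap_discrepancy X =
     sqrt (LINT t:{-1..1}|lborel. LINT x|sphere_prob.
       \<bar>real (card (X \<inter> cap x t)) / real (card X) - measure sphere_prob (cap x t)\<bar>\<^sup>2)"

definition diamond_M :: "nat \<Rightarrow> nat" where
  "diamond_M N = nat \<lfloor>sqrt (real N / 4)\<rfloor>"

text \<open>
  The last case is the reflection \<open>r\<^sub>M\<^sub>+\<^sub>i = r\<^sub>M\<^sub>-\<^sub>i\<close>. The subtraction in the middle case does not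
  truncate, as \<open>sum_diamond_r\<close> shows.
\<close>
definition diamond_r :: "nat \<Rightarrow> nat \<Rightarrow> nat" where
  "diamond_r N j =
     (let M = diamond_M N in
      if j < M then 4 * j
      else if j = M then N - 2 * (\<Sum>k=1..<M. 4 * k)
      else 4 * (2 * M - j))"

definition diamond_h :: "nat \<Rightarrow> nat \<Rightarrow> real" where
  "diamond_h N j =
     1 - 2 / real N * (\<Sum>k=1..<j. real (diamond_r N k)) - real (diamond_r N j) / real N"

definition diamond_\<rho> :: "nat \<Rightarrow> nat \<Rightarrow> real" where
  "diamond_\<rho> N j = sqrt (1 - (diamond_h N j)\<^sup>2)"

definition diamond_point :: "nat \<Rightarrow> nat \<Rightarrow> nat \<Rightarrow> real^3" where
  "diamond_point N j l =
     vector [diamond_\<rho> N j * cos (2 * pi * real l / real (diamond_r N j)),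
             diamond_\<rho> N j * sin (2 * pi * real l / real (diamond_r N j)),
             diamond_h N j]"

definition diamond_points :: "nat \<Rightarrow> (real^3) set" where
  "diamond_points N =
     {diamond_point N j l | j l. 1 \<le> j \<and> j \<le> 2 * diamond_M N - 1 \<and> l < diamond_r N j}"

lemma vector_3_eq: "(vector [a, b, c] :: real^3) = a *\<^sub>R axis 1 1 + b *\<^sub>R axis 2 1 + c *\<^sub>R axis 3 1"
  by (simp add: vec_eq_iff forall_3 axis_def)

lemma area_element_sph_coord:
  fixes \<theta> \<phi> :: real
  assumes "\<theta> \<in> {0..pi}"
  defines "v \<equiv> vector [cos \<theta> * cos \<phi>, cos \<theta> * sin \<phi>, - sin \<theta>] :: real^3"
    and "w \<equiv> vector [- sin \<theta> * sin \<phi>, sin \<theta> * cos \<phi>, 0] :: real^3"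
  shows "((\<lambda>s. sph_coord (s, \<phi>)) has_vector_derivative v) (at \<theta>)"
    and "((\<lambda>s. sph_coord (\<theta>, s)) has_vector_derivative w) (at \<phi>)"
    and "norm (cross3 v w) = sin \<theta>"
proof -
  show "((\<lambda>s. sph_coord (s, \<phi>)) has_vector_derivative v) (at \<theta>)"
    unfolding sph_coord_def v_def vector_3_eq prod.case
    by (rule derivative_eq_intros refl | simp)+
  show "((\<lambda>s. sph_coord (\<theta>, s)) has_vector_derivative w) (at \<phi>)"
    unfolding sph_coord_def w_def vector_3_eq prod.case
    by (rule derivative_eq_intros refl | simp add: mult.commute)+
  have "norm (cross3 v w) ^ 2 = (sin \<theta>)\<^sup>2 * ((sin \<theta>)\<^sup>2 * ((sin \<phi>)\<^sup>2 + (cos \<phi>)\<^sup>2) + (cos \<theta>)\<^sup>2 * ((sin \<phi>)\<^sup>2 + (cos \<phi>)\<^sup>2)\<^sup>2)"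
    unfolding v_def w_def cross3_def power2_norm_eq_inner inner_vec_def sum_3
    by (simp add: algebra_simps power2_eq_square
        del: sin_cos_squared_add sin_cos_squared_add2 sin_cos_squared_add3)
  then have "norm (cross3 v w) ^ 2 = (sin \<theta>) ^ 2"
    by simp
  moreover have "sin \<theta> \<ge> 0"
    using assms by (auto intro: sin_ge_zero)
  ultimately show "norm (cross3 v w) = sin \<theta>"
    by (metis norm_ge_zero power2_eq_imp_eq)
qed

lemma sph_coord_in_sphere: "sph_coord p \<in> sphere 0 1"
proof -
  obtain \<theta> \<phi> where p: "p = (\<theta>, \<phi>)" by (cases p)
  have "norm (sph_coord p) ^ 2 = (sin \<theta>)\<^sup>2 * ((sin \<phi>)\<^sup>2 + (cos \<phi>)\<^sup>2) + (cos \<theta>)\<^sup>2"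
    unfolding p sph_coord_def power2_norm_eq_inner inner_vec_def sum_3
    by (simp add: algebra_simps power2_eq_square del: sin_cos_squared_add3)
  then have "norm (sph_coord p) ^ 2 = 1 ^ 2" by simp
  then have "norm (sph_coord p) = 1" by (rule power2_eq_imp_eq) auto
  then show ?thesis by simp
qed

lemma measurable_sph_coord: "sph_coord \<in> borel \<rightarrow>\<^sub>M restrict_space borel (sphere 0 1)"
proof (rule measurable_restrict_space2)
  show "sph_coord \<in> borel \<rightarrow>\<^sub>M borel"
    unfolding sph_coord_def vector_3_eq case_prod_beta
    by (intro borel_measurable_continuous_onI continuous_intros)
qed (use sph_coord_in_sphere in auto)

lemma emeasure_surface_area: "emeasure surface_area (sphere 0 1) = ennreal (4 * pi)"
proof -
  let ?B = "{0..pi} \<times> {0..2*pi} :: (real \<times> real) set"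
  let ?R = "restrict_space lborel ?B"
  have m: "sph_coord \<in> ?R \<rightarrow>\<^sub>M restrict_space borel (sphere 0 1)"
    using measurable_sph_coord by (intro measurable_restrict_space1) simp
  have ms: "(\<lambda>p::real\<times>real. ennreal (sin (fst p))) \<in> borel_measurable borel"
    unfolding borel_prod[symmetric] by measurable
  have B: "?B \<in> sets borel"
    by (intro borel_closed closed_Times closed_atLeastAtMost)
  have "emeasure surface_area (sphere 0 1)
      = emeasure (density ?R (\<lambda>p. ennreal (sin (fst p)))) (sph_coord -` sphere 0 1 \<inter> ?B)"
    unfolding surface_area_def case_prod_beta
    using m by (subst emeasure_distr) (auto simp: sets_restrict_space space_restrict_space)
  also have "sph_coord -` sphere 0 1 \<inter> ?B = ?B"
    using sph_coord_in_sphere by auto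
  also have "emeasure (density ?R (\<lambda>p. ennreal (sin (fst p)))) ?B = (\<integral>\<^sup>+p. ennreal (sin (fst p)) * indicator ?B p \<partial>?R)"
    using ms B by (subst emeasure_density) (auto simp: sets_restrict_space intro!: measurable_restrict_space1)
  also have "\<dots> = (\<integral>\<^sup>+p. ennreal (sin (fst p)) * indicator ?B p \<partial>lborel)"
    using B by (subst nn_integral_restrict_space) (auto simp: mult.assoc indicator_def intro!: nn_integral_cong)
  also have "\<dots> = (\<integral>\<^sup>+p. ennreal (sin (fst p)) * indicator ?B p \<partial>(lborel \<Otimes>\<^sub>M lborel))"
    by (simp add: lborel_prod)
  also have "\<dots> = (\<integral>\<^sup>+\<theta>. \<integral>\<^sup>+\<phi>. (ennreal (sin \<theta>) * indicator {0..pi} \<theta>) * indicator {0..2*pi} \<phi> \<partial>lborel \<partial>lborel)"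
    by (subst lborel.nn_integral_fst[symmetric])
      (measurable, auto simp: indicator_def intro!: nn_integral_cong)
  also have "\<dots> = (\<integral>\<^sup>+\<theta>. ennreal (2 * pi) * (ennreal (sin \<theta>) * indicator {0..pi} \<theta>) \<partial>lborel)"
    by (simp add: nn_integral_cmult mult.commute)
  also have "\<dots> = ennreal (2 * pi) * (\<integral>\<^sup>+\<theta>. ennreal (sin \<theta>) * indicator {0..pi} \<theta> \<partial>lborel)"
    by (rule nn_integral_cmult) measurable
  also have "(\<integral>\<^sup>+\<theta>. ennreal (sin \<theta>) * indicator {0..pi} \<theta> \<partial>lborel) = ennreal (- cos pi - (- cos 0))"
    by (rule nn_integral_FTC_Icc) (auto intro!: derivative_eq_intros sin_ge_zero)
  also have "ennreal (2 * pi) * ennreal (- cos pi - (- cos 0)) = ennreal (4 * pi)"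
    by (subst ennreal_mult'[symmetric]) simp_all
  finally show ?thesis .
qed

lemma emeasure_sphere_prob: "emeasure sphere_prob (sphere 0 1) = 1"
  unfolding sphere_prob_def
  by (rule emeasure_uniform_measure_1) (simp_all add: emeasure_surface_area)

lemma diamond_M_square: "4 * diamond_M N ^ 2 \<le> N"
proof -
  have "real (diamond_M N) \<le> sqrt (real N / 4)"
    unfolding diamond_M_def by simp
  then have "real (diamond_M N) ^ 2 \<le> real N / 4"
    using power_mono[of _ _ 2] by fastforce
  then have "real (4 * diamond_M N ^ 2) \<le> real N" by simp
  then show ?thesis by (simp only: of_nat_le_iff)
qed

lemma sum_4k: "2 * (\<Sum>k=1..<M. 4 * k) + 4 * M = (4 * M\<^sup>2 :: nat)"
proof (induction M)
  case (Suc M)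
  then show ?case by (cases M) (auto simp: power2_eq_square)
qed simp

lemma sum_diamond_r:
  assumes "N \<ge> 4"
  shows "2 * (\<Sum>k=1..<diamond_M N. 4 * k) < N"
    and "(\<Sum>j=1..2 * diamond_M N - 1. diamond_r N j) = N"
proof -
  define M where "M = diamond_M N"
  have "1 \<le> sqrt (real N / 4)" using assms by simp
  then have "1 \<le> \<lfloor>sqrt (real N / 4)\<rfloor>" by (simp add: le_floor_iff)
  then have M: "M \<ge> 1" unfolding M_def diamond_M_def by linarith
  have le: "2 * (\<Sum>k=1..<M. 4 * k) < N"
    using sum_4k[of M] diamond_M_square[of N] M unfolding M_def by linarith
  then show "2 * (\<Sum>k=1..<diamond_M N. 4 * k) < N"
    by (simp only: M_def)
  have "{1..2*M-1} = {1..<M} \<union> {M} \<union> {M+1..<2*M}" using M by auto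
  then have "(\<Sum>j=1..2*M-1. diamond_r N j)
      = (\<Sum>j=1..<M. diamond_r N j) + diamond_r N M + (\<Sum>j=M+1..<2*M. diamond_r N j)"
    by (simp add: sum.union_disjoint)
  also have "(\<Sum>j=1..<M. diamond_r N j) = (\<Sum>j=1..<M. 4 * j)"
    by (intro sum.cong) (auto simp: diamond_r_def M_def)
  also have "(\<Sum>j=M+1..<2*M. diamond_r N j) = (\<Sum>j=1..<M. 4 * j)"
    by (rule sum.reindex_bij_witness[where i="\<lambda>j. 2*M-j" and j="\<lambda>j. 2*M-j"])
       (auto simp: diamond_r_def M_def Let_def)
  also have "diamond_r N M = N - 2 * (\<Sum>k=1..<M. 4 * k)"
    by (simp add: diamond_r_def M_def)
  finally show "(\<Sum>j=1..2 * diamond_M N - 1. diamond_r N j) = N"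
    using le unfolding M_def by linarith
qed

lemma diamond_r_pos:
  assumes "N \<ge> 4" "1 \<le> j" "j \<le> 2 * diamond_M N - 1"
  shows "diamond_r N j > 0"
  using assms sum_diamond_r(1)[OF assms(1)] by (auto simp: diamond_r_def Let_def)

lemma diamond_h_bounds:
  assumes N: "N \<ge> 4" and i: "1 \<le> i" and j: "j \<le> 2 * diamond_M N - 1"
  shows "i < j \<Longrightarrow> diamond_h N j < diamond_h N i"
    and "i = j \<Longrightarrow> -1 < diamond_h N j \<and> diamond_h N j < 1"
proof -
  define S where "S n = (\<Sum>k=1..<Suc n. real (diamond_r N k))" for n
  have h: "diamond_h N k = 1 - (S (k - 1) + S k) / real N" if "1 \<le> k" for k
    using that N by (cases k) (auto simp: diamond_h_def S_def field_simps)
  have mono: "S m \<le> S n" if "m \<le> n" for m n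
    unfolding S_def using that by (intro sum_mono2) auto
  have step: "S (k - 1) < S k" if "1 \<le> k" "k \<le> j" for k
    using that diamond_r_pos[of N k] N j by (cases k) (auto simp: S_def)
  have "S (2 * diamond_M N - 1) = real N"
    using sum_diamond_r(2)[OF N] unfolding S_def atLeastLessThanSuc_atLeastAtMost of_nat_sum[symmetric]
    by simp
  then have le: "S j \<le> real N"
    using mono[OF j] by simp
  have ge: "0 \<le> S k" for k
    unfolding S_def by (intro sum_nonneg) auto
  show "diamond_h N j < diamond_h N i" if "i < j"
  proof -
    have "S (i - 1) + S i < S (j - 1) + S j"
      using mono[of "i - 1" i] mono[of i "j - 1"] step[of j] that i by linarith
    then show ?thesis
      using that i N by (simp add: h divide_strict_right_mono)
  qed
  show "-1 < diamond_h N j \<and> diamond_h N j < 1" if "i = j"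
  proof -
    have "0 < (S (j - 1) + S j) / real N" "(S (j - 1) + S j) / real N < 2"
      using that i N ge[of "j - 1"] le step[of j] by (auto simp: divide_less_eq)
    then show ?thesis
      using that i h[of j] by simp
  qed
qed

lemma diamond_points_sphere:
  assumes "N \<ge> 4"
  shows "diamond_points N \<subseteq> sphere 0 1"
proof
  fix x assume "x \<in> diamond_points N"
  then obtain j l where x: "x = diamond_point N j l" and j: "1 \<le> j" "j \<le> 2 * diamond_M N - 1"
    unfolding diamond_points_def by blast
  define a where "a = 2 * pi * real l / real (diamond_r N j)"
  have "(diamond_h N j)\<^sup>2 < 1"
    using diamond_h_bounds(2)[OF assms j refl] by (simp add: abs_square_less_1 abs_less_iff)
  then have \<rho>: "(diamond_\<rho> N j)\<^sup>2 = 1 - (diamond_h N j)\<^sup>2"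
    unfolding diamond_\<rho>_def by simp
  have "norm x ^ 2 = (diamond_\<rho> N j)\<^sup>2 * ((sin a)\<^sup>2 + (cos a)\<^sup>2) + (diamond_h N j)\<^sup>2"
    unfolding x diamond_point_def a_def[symmetric] power2_norm_eq_inner inner_vec_def sum_3
    by (simp add: algebra_simps power2_eq_square
        del: sin_cos_squared_add sin_cos_squared_add2 sin_cos_squared_add3)
  then have "norm x ^ 2 = 1 ^ 2" by (simp add: \<rho>)
  then have "norm x = 1" by (rule power2_eq_imp_eq) auto
  then show "x \<in> sphere 0 1" by simp
qed

lemma card_diamond_points:
  assumes "N \<ge> 4"
  shows "card (diamond_points N) = N"
proof -
  let ?I = "SIGMA j:{1..2 * diamond_M N - 1}. {..<diamond_r N j}"
  have eq: "diamond_points N = (\<lambda>(j, l). diamond_point N j l) ` ?I"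
    unfolding diamond_points_def by force
  have "j = j' \<and> l = l'"
    if j: "1 \<le> j" "j \<le> 2 * diamond_M N - 1" and j': "1 \<le> j'" "j' \<le> 2 * diamond_M N - 1"
      and l: "l < diamond_r N j" "l' < diamond_r N j'"
      and e: "diamond_point N j l = diamond_point N j' l'" for j l j' l'
  proof -
    have h: "diamond_h N j = diamond_h N j'"
      using e unfolding diamond_point_def by (simp add: vec_eq_iff forall_3)
    have jj: "j = j'"
      using h diamond_h_bounds(1)[OF assms j(1) j'(2)] diamond_h_bounds(1)[OF assms j'(1) j(2)]
      by (cases j j' rule: linorder_cases) auto
    have "(diamond_h N j)\<^sup>2 < 1"
      using diamond_h_bounds(2)[OF assms j refl] by (simp add: abs_square_less_1 abs_less_iff)
    then have \<rho>: "diamond_\<rho> N j \<noteq> 0"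
      unfolding diamond_\<rho>_def by simp
    define r where "r = real (diamond_r N j)"
    have r: "r > 0" "real l < r" "real l' < r"
      using l jj unfolding r_def by auto
    have "cos (2 * pi * real l / r) = cos (2 * pi * real l' / r)"
         "sin (2 * pi * real l / r) = sin (2 * pi * real l' / r)"
      using e \<rho> unfolding diamond_point_def jj[symmetric] r_def
      by (auto simp: vec_eq_iff forall_3)
    then obtain n :: int where n: "2 * pi * real l / r = 2 * pi * real l' / r + 2 * pi * n"
      using sin_cos_eq_iff by metis
    then have "2 * pi * real l = 2 * pi * (real l' + n * r)"
      using r(1) by (simp add: field_simps)
    then have n': "real l = real l' + n * r"
      by simp
    then have "\<bar>real_of_int n * r\<bar> < 1 * r"
      using r by linarith
    then have "\<bar>real_of_int n\<bar> < 1"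
      using r(1) by (simp add: abs_mult)
    then have "n = 0" by linarith
    then show ?thesis using jj n' by simp
  qed
  then have "inj_on (\<lambda>(j, l). diamond_point N j l) ?I"
    unfolding inj_on_def by (auto 4 3)
  then have "card (diamond_points N) = card ?I"
    unfolding eq by (rule card_image)
  also have "\<dots> = N"
    using sum_diamond_r(2)[OF assms] by simp
  finally show ?thesis .
qed

end

theory Submission
  imports Defs "HOL-Probability.Probability_Measure"
begin

text \<open>
  By Stolarsky's invariance principle, \<open>4 D\<^sup>2\<close> is the mean distance \<open>4/3\<close> of two random points of the
  sphere minus the mean of \<open>dist a b\<close> over \<open>a, b\<close> in the point set \<open>X\<close>.

  Lower bound, for every \<open>X\<close> with \<open>N\<close> points: with \<open>s = (dist a b)\<^sup>2\<close> and \<open>e = 1/N\<close> write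
  \<open>- \<surd>s = G + H\<close>, where \<open>H = \<surd>(s + 2 e) - 2 \<surd>(s + e)\<close>. Then \<open>H\<close> is conditionally positive
  definite, as a power series in \<open>a \<bullet> b\<close> with nonnegative coefficients, so that its mean over \<open>X\<close> is
  at least the one over the sphere, whereas \<open>G \<ge> 0\<close> by concavity, \<open>G\<close> is of order \<open>\<surd>e\<close> on the
  diagonal, and its mean over the sphere is of order \<open>e \<surd>e\<close> only.

  Upper bound: the sphere is partitioned into \<open>N\<close> cells of equal area and of diameter \<open>O(1/\<surd>N)\<close>,
  each around one Diamond point, which is the centroid of its cell up to \<open>O(1/(N \<rho>))\<close>, \<open>\<rho>\<close> the
  radius of its parallel. Hence the interaction of two of the signed measures (point mass minus cell
  average) at distance \<open>d\<close> is of order \<open>N\<^sup>-\<^sup>4 / d\<^sup>3\<close>, apart from the effect of the centroid error, and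
  these interactions sum up to \<open>O(N powr (-3/2))\<close>.
\<close>

subsection \<open>Integration over the sphere\<close>

text \<open>With a general shift \<open>e\<close> the diagonal yields about
  \<open>sqrt e / N\<close> and the sphere mean of \<open>G\<close> costs about
  \<open>e * sqrt e\<close>; \<open>e = 1/N\<close> balances the two, and the explicit constants
  leave a positive rest. On the upper side, pairs of points are never counted by distance. Smoothing
  the distance \<open>d\<close> to \<open>sqrt (d^2 + eta^2)\<close> gives one estimate for far,
  near and equal pairs, and since the cells tile the sphere, sums of inverse powers over the points
  are bounded by explicit integrals over the sphere. The obstacle is the poles: there
  \<open>rho\<close> is itself of order \<open>1 / sqrt N\<close>, and the bound on the centroid
  error is no better than the cell diameter. Only the mean of the squared error enters, however. The
  square is at most of order \<open>1 / (N * sqrt N * rho)\<close>, a ring of radius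
  \<open>rho\<close> has \<open>O(sqrt N * rho)\<close> points, so each ring contributes
  \<open>O(1/N)\<close>, and there are \<open>O(sqrt N)\<close> rings.\<close>

lemma space_sphere_prob [simp]: "space sphere_prob = sphere 0 1"
  by (simp add: sphere_prob_def surface_area_def space_restrict_space)

lemma sets_sphere_prob [measurable_cong]:
  "sets sphere_prob = sets (restrict_space borel (sphere 0 1))"
  by (simp add: sphere_prob_def surface_area_def)

interpretation sphere_prob: prob_space sphere_prob
  by standard (simp add: emeasure_sphere_prob)

lemma continuous_on_sphere_measurable:
  fixes F :: "real^3 \<Rightarrow> 'a::topological_space"
  shows "continuous_on (sphere 0 1) F \<Longrightarrow> F \<in> borel_measurable sphere_prob"
  by (simp add: measurable_cong_sets[OF sets_sphere_prob] borel_measurable_continuous_on_restrict)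

lemma continuous_on_sphere_integrable:
  fixes F :: "real^3 \<Rightarrow> real"
  assumes "continuous_on (sphere 0 1) F"
  shows "integrable sphere_prob F"
proof -
  have "bounded (F ` sphere 0 1)"
    by (intro compact_imp_bounded compact_continuous_image assms) auto
  then obtain B where "\<forall>x\<in>sphere 0 1. norm (F x) \<le> B"
    by (auto simp: bounded_iff)
  then show ?thesis
    by (intro sphere_prob.integrable_const_bound[where B=B] continuous_on_sphere_measurable assms)
      (auto intro!: AE_I2)
qed

lemma continuous_on_sph_coord: "continuous_on A sph_coord"
  unfolding sph_coord_def vector_3_eq case_prod_beta
  by (intro continuous_intros)

text \<open>Sphere integrals of continuous functions become gauge integrals over a rectangle, where
  iterated integration, differentiation under the integral and the fundamental theorem
  apply.\<close>

lemma integral_sphere_prob_coord: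
  fixes F :: "real^3 \<Rightarrow> real"
  assumes F: "continuous_on (sphere 0 1) F"
  shows "(\<integral>x. F x \<partial>sphere_prob)
    = integral (cbox (0, 0) (pi, 2 * pi)) (\<lambda>p. F (sph_coord p) * sin (fst p)) / (4 * pi)"
proof -
  let ?B = "{0..pi} \<times> {0..2*pi} :: (real \<times> real) set"
  let ?R = "restrict_space lborel ?B"
  let ?D = "density ?R (\<lambda>p. ennreal (sin (fst p)))"
  have B: "?B = cbox (0, 0) (pi, 2 * pi)"
    by (auto simp: cbox_Pair_eq)
  have Bs: "?B \<in> sets borel"
    by (intro borel_closed closed_Times closed_atLeastAtMost)
  have m: "sph_coord \<in> ?D \<rightarrow>\<^sub>M restrict_space borel (sphere 0 1)"
    using measurable_sph_coord by (auto intro: measurable_restrict_space1)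
  have Fm: "F \<in> borel_measurable (restrict_space borel (sphere 0 1))"
    using F by (rule borel_measurable_continuous_on_restrict)
  have cont: "continuous_on A (\<lambda>p. F (sph_coord p))" for A
    by (rule continuous_on_compose2[OF F continuous_on_sph_coord]) (use sph_coord_in_sphere in auto)
  have FB: "(\<lambda>p. F (sph_coord p)) \<in> borel_measurable ?R"
    using borel_measurable_continuous_onI[OF cont] by (intro measurable_restrict_space1) simp
  have sB: "(\<lambda>p. sin (fst p)) \<in> borel_measurable ?R"
    by (intro measurable_restrict_space1) (auto intro!: borel_measurable_continuous_onI continuous_intros)
  have "sphere_prob = density surface_area (\<lambda>x. ennreal (indicator (sphere 0 1) x / (4 * pi)))"
    unfolding sphere_prob_def uniform_measure_def emeasure_surface_area
    by (intro arg_cong2[where f=density] refl ext) (auto simp: indicator_def divide_ennreal[of 1, simplified])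
  then have "(\<integral>x. F x \<partial>sphere_prob)
      = (\<integral>x. F x \<partial>density surface_area (\<lambda>x. ennreal (indicator (sphere 0 1) x / (4 * pi))))"
    by simp
  also have "\<dots> = (\<integral>x. (indicator (sphere 0 1) x / (4 * pi)) *\<^sub>R F x \<partial>surface_area)"
    using Fm by (intro integral_density borel_measurable_divide borel_measurable_indicator borel_measurable_const)
      (auto simp: surface_area_def sets_restrict_space)
  also have "\<dots> = (\<integral>p. (indicator (sphere 0 1) (sph_coord p) / (4 * pi)) *\<^sub>R F (sph_coord p) \<partial>?D)"
    unfolding surface_area_def case_prod_beta
    by (intro integral_distr m borel_measurable_scaleR borel_measurable_divide borel_measurable_indicator
      borel_measurable_const Fm) (auto simp: sets_restrict_space)
  also have "\<dots> = (\<integral>p. F (sph_coord p) / (4 * pi) \<partial>?D)"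
    using sph_coord_in_sphere by (auto intro!: Bochner_Integration.integral_cong)
  also have "\<dots> = (\<integral>p. sin (fst p) *\<^sub>R (F (sph_coord p) / (4 * pi)) \<partial>?R)"
    using FB sB Bs by (subst integral_density) (auto intro!: AE_I2 sin_ge_zero simp: space_restrict_space)
  also have "\<dots> = (LINT p:?B|lborel. sin (fst p) *\<^sub>R (F (sph_coord p) / (4 * pi)))"
    using Bs by (subst integral_restrict_space) (auto simp: set_lebesgue_integral_def)
  also have "\<dots> = integral ?B (\<lambda>p. sin (fst p) *\<^sub>R (F (sph_coord p) / (4 * pi)))"
    unfolding B
    by (intro set_borel_integral_eq_integral(2), unfold set_integrable_def,
      intro borel_integrable_compact compact_cbox continuous_intros cont) auto
  also have "\<dots> = integral ?B (\<lambda>p. F (sph_coord p) * sin (fst p)) / (4 * pi)"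
    by (subst integral_divide[symmetric]) (simp add: mult.commute)
  finally show ?thesis unfolding B .
qed

text \<open>
  The integrand is the divergence \<open>D1 + D2\<close> of \<open>\<phi>(u)\<close> times the divergence-free vector field
  \<open>(- sin \<theta> cos (q - \<psi>), cos \<theta> sin (q - \<psi>))\<close>, a rotation field weighted by the area element.
\<close>
lemma integral_rotated_zonal_derivative:
  fixes \<phi> \<phi>' :: "real \<Rightarrow> real" and \<alpha> \<psi> :: real
  assumes d: "\<And>u. (\<phi> has_real_derivative \<phi>' u) (at u)" and c: "continuous_on UNIV \<phi>'"
  defines "u \<equiv> \<lambda>\<theta> q. sin \<alpha> * sin \<theta> * cos (q - \<psi>) + cos \<alpha> * cos \<theta>"
  shows "integral (cbox (0, 0) (pi, 2 * pi)) (\<lambda>(\<theta>, q).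
    \<phi>' (u \<theta> q) * (cos \<alpha> * sin \<theta> * cos (q - \<psi>) - sin \<alpha> * cos \<theta>) * sin \<theta>) = 0"
proof -
  have c0: "continuous_on UNIV \<phi>"
    using d by (meson DERIV_isCont continuous_at_imp_continuous_on)
  note ci = continuous_on_compose2[OF c0] continuous_on_compose2[OF c]
  define D1 where "D1 \<theta> q = - cos \<theta> * cos (q - \<psi>) * \<phi> (u \<theta> q)
    - sin \<theta> * cos (q - \<psi>) * (\<phi>' (u \<theta> q) * (sin \<alpha> * cos \<theta> * cos (q - \<psi>) - cos \<alpha> * sin \<theta>))" for \<theta> q
  define D2 where "D2 \<theta> q = cos \<theta> * cos (q - \<psi>) * \<phi> (u \<theta> q)
    - cos \<theta> * sin (q - \<psi>) * (\<phi>' (u \<theta> q) * (sin \<alpha> * sin \<theta> * sin (q - \<psi>)))" for \<theta> q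
  have c1: "continuous_on A (\<lambda>p. D1 (fst p) (snd p))" for A
    unfolding D1_def u_def by (intro continuous_intros ci) auto
  have c2: "continuous_on A (\<lambda>p. D2 (fst p) (snd p))" for A
    unfolding D2_def u_def by (intro continuous_intros ci) auto
  let ?Q = "cbox (0, 0) (pi, 2 * pi) :: (real \<times> real) set"
  have du1: "((\<lambda>\<theta>. \<phi> (u \<theta> q)) has_real_derivative
      \<phi>' (u \<theta> q) * (sin \<alpha> * cos \<theta> * cos (q - \<psi>) - cos \<alpha> * sin \<theta>)) (at \<theta>)" for \<theta> q
    unfolding u_def
    by (rule DERIV_chain2[OF d]) (auto intro!: derivative_eq_intros)
  have du2: "((\<lambda>q. \<phi> (u \<theta> q)) has_real_derivative
      \<phi>' (u \<theta> q) * (- sin \<alpha> * sin \<theta> * sin (q - \<psi>))) (at q)" for \<theta> q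
    unfolding u_def
    by (rule DERIV_chain2[OF d]) (auto intro!: derivative_eq_intros)
  have "integral ?Q (\<lambda>p. D1 (fst p) (snd p)) = 
      integral (cbox 0 pi) (\<lambda>\<theta>. integral (cbox 0 (2 * pi)) (\<lambda>q. D1 \<theta> q))"
    using integral_prod_continuous[OF c1] by simp
  also have "\<dots> = integral (cbox 0 (2 * pi)) (\<lambda>q. integral (cbox 0 pi) (\<lambda>\<theta>. D1 \<theta> q))"
    using c1 by (intro integral_swap_continuous) (simp add: case_prod_beta)
  \<comment> \<open>The antiderivative of \<open>D1\<close> in the polar angle carries a factor
    \<open>sin \<theta>\<close> and vanishes at both poles; that of \<open>D2\<close> is periodic in
    the azimuth.\<close>
  also have "(\<lambda>q. integral (cbox 0 pi) (\<lambda>\<theta>. D1 \<theta> q)) = (\<lambda>q. 0)"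
  proof
    fix q
    have "((\<lambda>\<theta>. - sin \<theta> * cos (q - \<psi>) * \<phi> (u \<theta> q)) has_real_derivative D1 \<theta> q) (at \<theta>)" for \<theta>
      unfolding D1_def by (rule derivative_eq_intros du1 refl)+ (simp add: algebra_simps)
    then have "((\<lambda>\<theta>. D1 \<theta> q) has_integral
        (- sin pi * cos (q - \<psi>) * \<phi> (u pi q)) - (- sin 0 * cos (q - \<psi>) * \<phi> (u 0 q))) {0..pi}"
      by (intro fundamental_theorem_of_calculus)
        (auto simp flip: has_real_derivative_iff_has_vector_derivative intro: has_field_derivative_at_within)
    then show "integral (cbox 0 pi) (\<lambda>\<theta>. D1 \<theta> q) = 0"
      by (simp add: integral_unique)
  qed
  finally have i1: "integral ?Q (\<lambda>p. D1 (fst p) (snd p)) = 0" by simp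
  have "integral ?Q (\<lambda>p. D2 (fst p) (snd p)) = 
      integral (cbox 0 pi) (\<lambda>\<theta>. integral (cbox 0 (2 * pi)) (\<lambda>q. D2 \<theta> q))"
    using integral_prod_continuous[OF c2] by simp
  also have "(\<lambda>\<theta>. integral (cbox 0 (2 * pi)) (\<lambda>q. D2 \<theta> q)) = (\<lambda>q. 0)"
  proof
    fix \<theta>
    have per: "sin (2 * pi - \<psi>) = sin (0 - \<psi>)" "cos (2 * pi - \<psi>) = cos (0 - \<psi>)"
      by (simp_all add: sin_diff cos_diff)
    have "((\<lambda>q. cos \<theta> * sin (q - \<psi>) * \<phi> (u \<theta> q)) has_real_derivative D2 \<theta> q) (at q)" for q
      unfolding D2_def by (rule derivative_eq_intros du2 refl)+ (simp add: algebra_simps)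
    then have "((\<lambda>q. D2 \<theta> q) has_integral
        (cos \<theta> * sin (2 * pi - \<psi>) * \<phi> (u \<theta> (2 * pi))) - (cos \<theta> * sin (0 - \<psi>) * \<phi> (u \<theta> 0))) {0..2*pi}"
      by (intro fundamental_theorem_of_calculus)
        (auto simp flip: has_real_derivative_iff_has_vector_derivative intro: has_field_derivative_at_within)
    then show "integral (cbox 0 (2 * pi)) (\<lambda>q. D2 \<theta> q) = 0"
      unfolding u_def per by (simp add: integral_unique)
  qed
  finally have i2: "integral ?Q (\<lambda>p. D2 (fst p) (snd p)) = 0" by simp
  have "\<phi>' (u \<theta> q) * (cos \<alpha> * sin \<theta> * cos (q - \<psi>) - sin \<alpha> * cos \<theta>) * sin \<theta> = D1 \<theta> q + D2 \<theta> q" for \<theta> q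
  proof -
    have "D1 \<theta> q + D2 \<theta> q = \<phi>' (u \<theta> q) * sin \<theta> * (cos \<alpha> * sin \<theta> * cos (q - \<psi>)
       - sin \<alpha> * cos \<theta> * ((sin (q - \<psi>))\<^sup>2 + (cos (q - \<psi>))\<^sup>2))"
      unfolding D1_def D2_def by (simp only: power2_eq_square) algebra
    then show ?thesis by (simp add: mult_ac)
  qed
  then have "integral ?Q (\<lambda>(\<theta>, q). \<phi>' (u \<theta> q) * (cos \<alpha> * sin \<theta> * cos (q - \<psi>) - sin \<alpha> * cos \<theta>) * sin \<theta>)
     = integral ?Q (\<lambda>p. D1 (fst p) (snd p) + D2 (fst p) (snd p))"
    by (intro Henstock_Kurzweil_Integration.integral_cong) (auto simp: case_prod_unfold)
  also have "\<dots> = 0"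
    by (subst integral_add) (auto intro!: integrable_continuous c1 c2 simp: i1 i2)
  finally show ?thesis .
qed

lemma sphere_coordinates:
  assumes "x \<in> sphere 0 1"
  obtains \<alpha> \<psi> where "x = sph_coord (\<alpha>, \<psi>)"
proof -
  have n: "(x$1)\<^sup>2 + (x$2)\<^sup>2 + (x$3)\<^sup>2 = 1"
    using assms by (simp add: norm_eq_1 inner_vec_def sum_3 power2_eq_square)
  then have x3: "\<bar>x$3\<bar> \<le> 1"
    by (simp add: abs_square_le_1[symmetric]) (smt (verit) zero_le_power2)
  define \<alpha> where "\<alpha> = arccos (x$3)"
  have c: "cos \<alpha> = x$3"
    unfolding \<alpha>_def using x3 by (intro cos_arccos) auto
  have s: "(sin \<alpha>)\<^sup>2 = (x$1)\<^sup>2 + (x$2)\<^sup>2"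
    using n by (simp add: sin_squared_eq c)
  show thesis
  proof (cases "sin \<alpha> = 0")
    case True
    then have "x = sph_coord (\<alpha>, 0)"
      using s by (simp add: sph_coord_def vec_eq_iff forall_3 c)
    then show ?thesis by (rule that)
  next
    case False
    have "(x$1 / sin \<alpha>)\<^sup>2 + (x$2 / sin \<alpha>)\<^sup>2 = 1"
      using False by (simp add: power_divide add_divide_distrib[symmetric] s[symmetric])
    then obtain \<psi> where "x$1 / sin \<alpha> = cos \<psi>" "x$2 / sin \<alpha> = sin \<psi>"
      using sincos_total_2pi by metis
    then have "x = sph_coord (\<alpha>, \<psi>)"
      using False by (simp add: sph_coord_def vec_eq_iff forall_3 c field_simps)
    then show ?thesis by (rule that)
  qed
qed

lemma has_integral_cos_substitution:
  fixes \<phi> :: "real \<Rightarrow> real"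
  assumes "continuous_on {-1..1} \<phi>"
  shows "((\<lambda>\<theta>. \<phi> (cos \<theta>) * sin \<theta>) has_integral integral {-1..1} \<phi>) {0..pi}"
proof -
  \<comment> \<open>Since \<open>cos\<close> decreases, \<open>{cos 0..cos pi}\<close> is the empty
    interval \<open>{1..-1}\<close> and its integral is 0; the other integral enters with a minus
    sign, which the sign of \<open>- sin \<theta>\<close> cancels.\<close>
  have "((\<lambda>\<theta>. (- sin \<theta>) *\<^sub>R \<phi> (cos \<theta>)) has_integral (integral {cos 0..cos pi} \<phi> - integral {cos pi..cos 0} \<phi>)) {0..pi}"
  proof (rule has_integral_substitution_general[where s="{}" and c="-1" and d=1])
    show "cos ` {0..pi} \<subseteq> {-1..1}" by auto
    show "(cos has_real_derivative - sin \<theta>) (at \<theta> within {0..pi})" for \<theta> :: real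
      by (rule has_field_derivative_at_within[OF DERIV_cos])
    show "continuous_on {0..pi} (cos :: real \<Rightarrow> real)"
      by (intro continuous_intros)
  qed (use assms in auto)
  then have "((\<lambda>\<theta>. - ((- sin \<theta>) *\<^sub>R \<phi> (cos \<theta>))) has_integral - (0 - integral {-1..1} \<phi>)) {0..pi}"
    by (intro has_integral_neg) simp
  then show ?thesis by (simp add: mult.commute)
qed

text \<open>\<open>sphere_prob\<close> is defined in coordinates with a fixed axis, so its rotation
  invariance has to be derived. The point \<open>x\<close> is moved along its meridian to the
  coordinate pole: by \<open>integral_rotated_zonal_derivative\<close> the integral has derivative 0
  in the polar angle \<open>a\<close>, and at \<open>a = 0\<close> the integrand no longer depends
  on the azimuth. The result is Archimedes' theorem: a coordinate of a random point of the sphere is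
  uniform on \<open>{-1..1}\<close>.\<close>

lemma integral_zonal_C1:
  fixes \<phi> \<phi>' :: "real \<Rightarrow> real"
  assumes d: "\<And>u. (\<phi> has_real_derivative \<phi>' u) (at u)" and c: "continuous_on UNIV \<phi>'"
    and x: "x \<in> sphere 0 1"
  shows "(\<integral>z. \<phi> (x \<bullet> z) \<partial>sphere_prob) = integral {-1..1} \<phi> / 2"
proof -
  obtain \<alpha> \<psi> where x: "x = sph_coord (\<alpha>, \<psi>)"
    using sphere_coordinates[OF x] .
  have c0: "continuous_on UNIV \<phi>"
    using d by (meson DERIV_isCont continuous_at_imp_continuous_on)
  note ci = continuous_on_compose2[OF c0] continuous_on_compose2[OF c]
  let ?Q = "cbox (0, 0) (pi, 2 * pi) :: (real \<times> real) set"
  define f where "f a p = \<phi> (sin a * sin (fst p) * cos (snd p - \<psi>) + cos a * cos (fst p)) * sin (fst p)" for a p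
  have cf: "continuous_on A (f a)" for a A
    unfolding f_def by (intro continuous_intros ci) auto
  have "((\<lambda>a. integral ?Q (f a)) has_real_derivative integral ?Q (\<lambda>(\<theta>, q).
     \<phi>' (sin a * sin \<theta> * cos (q - \<psi>) + cos a * cos \<theta>) *
       (cos a * sin \<theta> * cos (q - \<psi>) - sin a * cos \<theta>) * sin \<theta>)) (at a within UNIV)" for a
    unfolding case_prod_beta
  proof (rule leibniz_rule_field_derivative)
    fix a p
    show "((\<lambda>a. f a p) has_real_derivative
         \<phi>' (sin a * sin (fst p) * cos (snd p - \<psi>) + cos a * cos (fst p)) *
         (cos a * sin (fst p) * cos (snd p - \<psi>) - sin a * cos (fst p)) * sin (fst p)) (at a within UNIV)"
      unfolding f_def
      by (auto intro!: derivative_eq_intros DERIV_chain2[OF d])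
  qed (auto intro!: integrable_continuous cf continuous_intros ci simp: case_prod_beta)
  then have "((\<lambda>a. integral ?Q (f a)) has_real_derivative 0) (at a)" for a
    by (simp only: integral_rotated_zonal_derivative[OF d c])
  then have "integral ?Q (f \<alpha>) = integral ?Q (f 0)"
    using DERIV_const_ratio_const by (metis DERIV_isconst_all)
  also have "\<dots> = integral (cbox 0 pi) (\<lambda>\<theta>. integral (cbox 0 (2 * pi)) (\<lambda>q. f 0 (\<theta>, q)))"
    using integral_prod_continuous[OF cf] by simp
  also have "\<dots> = integral {0..pi} (\<lambda>\<theta>. (2 * pi) * (\<phi> (cos \<theta>) * sin \<theta>))"
  proof -
    have "integral (cbox 0 (2 * pi)) (\<lambda>q. f 0 (\<theta>, q)) = (2 * pi) * (\<phi> (cos \<theta>) * sin \<theta>)" for \<theta>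
      by (simp add: f_def)
    then show ?thesis by (simp only: interval_cbox)
  qed
  also have "\<dots> = 2 * pi * integral {0..pi} (\<lambda>\<theta>. \<phi> (cos \<theta>) * sin \<theta>)"
    by (rule integral_mult_right)
  also have "integral {0..pi} (\<lambda>\<theta>. \<phi> (cos \<theta>) * sin \<theta>) = integral {-1..1} \<phi>"
    by (intro integral_unique has_integral_cos_substitution continuous_on_subset[OF c0]) simp
  finally have *: "integral ?Q (f \<alpha>) = 2 * pi * integral {-1..1} \<phi>" .
  have "x \<bullet> sph_coord p = sin \<alpha> * sin (fst p) * cos (snd p - \<psi>) + cos \<alpha> * cos (fst p)" for p
    unfolding x by (cases p) (simp add: sph_coord_def inner_vec_def sum_3 cos_diff algebra_simps)
  then have "(\<integral>z. \<phi> (x \<bullet> z) \<partial>sphere_prob) = integral ?Q (f \<alpha>) / (4 * pi)"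
    by (subst integral_sphere_prob_coord) (auto simp: f_def[abs_def] intro!: ci continuous_intros)
  then show ?thesis using * by simp
qed

text \<open>The later applications to \<open>abs\<close> and to a square root vanishing at
  \<open>u = 1\<close> are not continuously differentiable. Polynomials are uniformly dense, and
  both sides are stable under uniform approximation.\<close>

lemma integral_zonal:
  fixes \<phi> :: "real \<Rightarrow> real"
  assumes c: "continuous_on {-1..1} \<phi>" and x: "x \<in> sphere 0 1"
  shows "(\<integral>z. \<phi> (x \<bullet> z) \<partial>sphere_prob) = integral {-1..1} \<phi> / 2"
proof -
  have rng: "x \<bullet> z \<in> {-1..1}" if "z \<in> sphere 0 1" for z
    using Cauchy_Schwarz_ineq2[of x z] x that by auto
  have *: "\<bar>(\<integral>z. \<phi> (x \<bullet> z) \<partial>sphere_prob) - integral {-1..1} \<phi> / 2\<bar> \<le> 2 * e" if e: "e > 0" for e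
  proof -
    obtain p where p: "real_polynomial_function p" and pe: "\<And>u. u \<in> {-1..1} \<Longrightarrow> \<bar>\<phi> u - p u\<bar> < e"
      using Stone_Weierstrass_real_polynomial_function[OF compact_Icc c e] by blast
    obtain p' where p': "real_polynomial_function p'" and dp: "\<And>u. (p has_real_derivative p' u) (at u)"
      using has_real_derivative_polynomial_function[OF p] by blast
    have cp': "continuous_on A p'" and cp: "continuous_on A p" for A
      using p p' by (auto intro: continuous_on_polymonial_function continuous_polymonial_function simp: real_polynomial_function_eq)
    have eq: "(\<integral>z. p (x \<bullet> z) \<partial>sphere_prob) = integral {-1..1} p / 2"
      by (rule integral_zonal_C1[OF dp cp' x])
    have i1: "integrable sphere_prob (\<lambda>z. \<phi> (x \<bullet> z))"
      by (intro continuous_on_sphere_integrable continuous_on_compose2[OF c]) (use rng in \<open>auto intro!: continuous_intros\<close>)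
    have i2: "integrable sphere_prob (\<lambda>z. p (x \<bullet> z))"
      by (intro continuous_on_sphere_integrable continuous_on_compose2[OF cp]) (use rng in \<open>auto intro!: continuous_intros\<close>)
    have "\<bar>(\<integral>z. \<phi> (x \<bullet> z) \<partial>sphere_prob) - (\<integral>z. p (x \<bullet> z) \<partial>sphere_prob)\<bar>
       = \<bar>\<integral>z. \<phi> (x \<bullet> z) - p (x \<bullet> z) \<partial>sphere_prob\<bar>"
      using i1 i2 by simp
    also have "\<dots> \<le> (\<integral>z. \<bar>\<phi> (x \<bullet> z) - p (x \<bullet> z)\<bar> \<partial>sphere_prob)"
      by (rule integral_abs_bound)
    also have "\<dots> \<le> (\<integral>z. e \<partial>sphere_prob)"
      using i1 i2 pe rng by (intro integral_mono_AE) (auto intro!: AE_I2 less_imp_le)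
    finally have 1: "\<bar>(\<integral>z. \<phi> (x \<bullet> z) \<partial>sphere_prob) - (\<integral>z. p (x \<bullet> z) \<partial>sphere_prob)\<bar> \<le> e"
      using sphere_prob.prob_space by simp
    have "\<bar>integral {-1..1} \<phi> - integral {-1..1} p\<bar> = norm (integral {-1..1} (\<lambda>u. \<phi> u - p u))"
      using c cp by (subst integral_diff) (auto intro!: integrable_continuous_real)
    also have "\<dots> \<le> integral {-1..1} (\<lambda>u::real. e)"
    proof (rule Henstock_Kurzweil_Integration.integral_norm_bound_integral)
      show "(\<lambda>u. \<phi> u - p u) integrable_on {-1..1}"
        by (intro integrable_continuous_real continuous_intros c cp)
      show "norm (\<phi> u - p u) \<le> e" if "u \<in> {-1..1}" for u
        using pe[OF that] by simp
    qed auto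
    finally have 2: "\<bar>integral {-1..1} \<phi> - integral {-1..1} p\<bar> \<le> 2 * e"
      by simp
    show ?thesis using 1 2 eq by linarith
  qed
  have "\<bar>(\<integral>z. \<phi> (x \<bullet> z) \<partial>sphere_prob) - integral {-1..1} \<phi> / 2\<bar> \<le> 0"
  proof (rule field_le_epsilon)
    fix e :: real assume "e > 0"
    then show "\<bar>(\<integral>z. \<phi> (x \<bullet> z) \<partial>sphere_prob) - integral {-1..1} \<phi> / 2\<bar> \<le> 0 + e"
      using *[of "e / 2"] by simp
  qed
  then show ?thesis by simp
qed

subsection \<open>The invariance principle of Stolarsky\<close>

lemma dist_sphere_power2:
  fixes x z :: "'a::real_inner"
  assumes "x \<in> sphere 0 1" "z \<in> sphere 0 1"
  shows "(dist x z)\<^sup>2 = 2 - 2 * (x \<bullet> z)"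
proof -
  have "x \<bullet> x = 1" "z \<bullet> z = 1" using assms by (simp_all add: dot_square_norm)
  then show ?thesis
    by (simp add: dist_norm power2_norm_eq_inner inner_diff inner_commute)
qed

text \<open>By \<open>integral_zonal\<close> the squared distance from a fixed point is uniform on
  \<open>{0..4}\<close>. The derivative of \<open>G\<close> is asked for only in the interior
  because differentiation rules for square roots break down at \<open>s = 0\<close>.\<close>

lemma integral_chordal:
  fixes g G :: "real \<Rightarrow> real"
  assumes g: "continuous_on {0..4} g" and G: "continuous_on {0..4} G"
    and d: "\<And>s. s \<in> {0<..<4} \<Longrightarrow> (G has_real_derivative g s) (at s)"
    and x: "x \<in> sphere 0 1"
  shows "(\<integral>z. g ((dist x z)\<^sup>2) \<partial>sphere_prob) = (G 4 - G 0) / 4"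
proof -
  have "(\<integral>z. g ((dist x z)\<^sup>2) \<partial>sphere_prob) = (\<integral>z. g (2 - 2 * (x \<bullet> z)) \<partial>sphere_prob)"
    using x by (intro Bochner_Integration.integral_cong) (auto simp: dist_sphere_power2)
  also have "\<dots> = integral {-1..1} (\<lambda>u. g (2 - 2 * u)) / 2"
    by (rule integral_zonal[OF _ x], rule continuous_on_compose2[OF g]) (auto intro!: continuous_intros)
  also have "((\<lambda>u. g (2 - 2 * u)) has_integral (- G (2 - 2 * 1) / 2 - (- G (2 - 2 * (-1)) / 2))) {-1..1}"
  proof (rule fundamental_theorem_of_calculus_interior)
    show "continuous_on {-1..1} (\<lambda>u. - G (2 - 2 * u) / 2)"
      by (intro continuous_intros continuous_on_compose2[OF G]) auto
    fix u :: real assume u: "u \<in> {-1<..<1}"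
    have "((\<lambda>u. - G (2 - 2 * u) / 2) has_real_derivative - (g (2 - 2 * u) * (- 2)) / 2) (at u)"
      by (intro DERIV_cdivide DERIV_minus DERIV_chain2[OF d]) (use u in \<open>auto intro!: derivative_eq_intros\<close>)
    then show "((\<lambda>u. - G (2 - 2 * u) / 2) has_vector_derivative g (2 - 2 * u)) (at u)"
      by (simp add: has_real_derivative_iff_has_vector_derivative)
  qed simp
  then have "integral {-1..1} (\<lambda>u. g (2 - 2 * u)) = (G 4 - G 0) / 2"
    by (simp add: integral_unique diff_divide_distrib)
  finally show ?thesis by simp
qed

lemma integral_chordal_sqrt:
  assumes c: "c \<ge> 0" and x: "x \<in> sphere 0 1"
  shows "(\<integral>z. sqrt ((dist x z)\<^sup>2 + c) \<partial>sphere_prob) = ((4 + c) * sqrt (4 + c) - c * sqrt c) / 6"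
proof -
  have "(\<integral>z. sqrt ((dist x z)\<^sup>2 + c) \<partial>sphere_prob)
      = (2/3 * ((4 + c) * sqrt (4 + c)) - 2/3 * ((0 + c) * sqrt (0 + c))) / 4"
  proof (rule integral_chordal[where G="\<lambda>s. 2/3 * ((s + c) * sqrt (s + c))", OF _ _ _ x])
    fix s :: real assume s: "s \<in> {0<..<4}"
    then have p: "s + c > 0" using c by auto
    have "((\<lambda>s. 2/3 * ((s + c) * sqrt (s + c))) has_real_derivative
        2/3 * (1 * sqrt (s + c) + inverse (sqrt (s + c)) / 2 * (s + c))) (at s)"
      using p by (auto intro!: derivative_eq_intros)
    moreover have "inverse (sqrt (s + c)) / 2 * (s + c) = sqrt (s + c) / 2"
      using p real_div_sqrt[of "s + c"] by (simp add: field_simps)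
    ultimately show "((\<lambda>s. 2/3 * ((s + c) * sqrt (s + c))) has_real_derivative sqrt (s + c)) (at s)"
      by simp
  qed (auto intro!: continuous_intros)
  then show ?thesis by (simp add: field_simps)
qed

lemma integral_dist_sphere:
  assumes "x \<in> sphere 0 1"
  shows "(\<integral>z. dist x z \<partial>sphere_prob) = 4/3"
  using integral_chordal_sqrt[OF order_refl assms] by simp

lemma integral_inner_sphere: "(\<integral>z. v \<bullet> z \<partial>sphere_prob) = 0"
proof (cases "v = 0")
  case False
  define x where "x = v /\<^sub>R norm v"
  have x: "x \<in> sphere 0 1" using False by (simp add: x_def)
  have "integral {-1..1} (\<lambda>u::real. u) = 0"
    by simp
  then have "(\<integral>z. x \<bullet> z \<partial>sphere_prob) = 0"
    using integral_zonal[of "\<lambda>u. u", OF _ x] by simp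
  moreover have "v \<bullet> z = norm v * (x \<bullet> z)" for z
    using False by (simp add: x_def)
  ultimately show ?thesis by simp
qed simp

lemma integral_abs_inner_sphere: "(\<integral>z. \<bar>v \<bullet> z\<bar> \<partial>sphere_prob) = norm v / 2"
proof (cases "v = 0")
  case False
  define x where "x = v /\<^sub>R norm v"
  have x: "x \<in> sphere 0 1" using False by (simp add: x_def)
  have "integral {-1..1} (\<lambda>u::real. \<bar>u\<bar>) = integral {-1..0} (\<lambda>u::real. \<bar>u\<bar>) + integral {0..1} (\<lambda>u::real. \<bar>u\<bar>)"
    by (rule Henstock_Kurzweil_Integration.integral_combine[symmetric])
      (auto intro!: integrable_continuous_real continuous_intros)
  also have "integral {-1..0} (\<lambda>u::real. \<bar>u\<bar>) = integral {-1..0} (\<lambda>u::real. - u)"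
    by (intro Henstock_Kurzweil_Integration.integral_cong) auto
  also have "integral {0..1} (\<lambda>u::real. \<bar>u\<bar>) = integral {0..1} (\<lambda>u::real. u)"
    by (intro Henstock_Kurzweil_Integration.integral_cong) auto
  finally have "integral {-1..1} (\<lambda>u::real. \<bar>u\<bar>) = 1" by simp
  then have "(\<integral>z. \<bar>x \<bullet> z\<bar> \<partial>sphere_prob) = 1 / 2"
    using integral_zonal[of abs, OF _ x] by (simp add: continuous_intros)
  moreover have "\<bar>v \<bullet> z\<bar> = norm v * \<bar>x \<bullet> z\<bar>" for z
    using False by (simp add: x_def abs_mult)
  ultimately show ?thesis by simp
qed simp

section \<open>Caps as a family of indicator functions parametrized by height and centre\<close>

lemma measurable_ident_sphere_prob [measurable]: "(\<lambda>x. x) \<in> sphere_prob \<rightarrow>\<^sub>M borel"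
  by (simp add: measurable_cong_sets[OF sets_sphere_prob] measurable_restrict_space1)

definition cap_ind :: "real \<times> (real^3) \<Rightarrow> real^3 \<Rightarrow> real" where
  "cap_ind p y = (if fst p \<le> snd p \<bullet> y then 1 else 0)"

text \<open>Merging height and centre into one parameter turns the double integral in
  \<open>L2_cap_discrepancy\<close> into a squared distance in a single \<open>L^2\<close> space.
  The total mass is 2, not 1.\<close>

definition cap_param :: "(real \<times> (real^3)) measure" where
  "cap_param = restrict_space lborel {-1..1} \<Otimes>\<^sub>M sphere_prob"

lemma finite_measure_Icc: "finite_measure (restrict_space lborel {a..b::real})"
  by (intro finite_measureI) (simp add: space_restrict_space emeasure_restrict_space emeasure_lborel_Icc_eq)

interpretation cap_param: finite_measure cap_param
proof -
  interpret finite_measure "restrict_space lborel {-1..1::real}"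
    by (rule finite_measure_Icc)
  show "finite_measure cap_param"
    unfolding cap_param_def
    by (intro finite_measure_pair_measure sphere_prob.finite_measure_axioms finite_measure_axioms)
qed

lemma cap_ind_measurable_pair [measurable]:
  "(\<lambda>q. cap_ind (fst q) (snd q)) \<in> borel_measurable (cap_param \<Otimes>\<^sub>M sphere_prob)"
proof -
  have [measurable]: "(\<lambda>q. fst (fst q)) \<in> borel_measurable (cap_param \<Otimes>\<^sub>M sphere_prob)"
    unfolding cap_param_def
    by (rule measurable_compose[OF measurable_compose[OF measurable_fst measurable_fst]])
      (simp add: measurable_restrict_space1)
  have [measurable]: "(\<lambda>q. snd (fst q)) \<in> borel_measurable (cap_param \<Otimes>\<^sub>M sphere_prob)"
    unfolding cap_param_def
    by (rule measurable_compose[OF measurable_compose[OF measurable_fst measurable_snd] measurable_ident_sphere_prob])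
  have [measurable]: "(\<lambda>q. snd q) \<in> borel_measurable (cap_param \<Otimes>\<^sub>M sphere_prob)"
    by (rule measurable_compose[OF measurable_snd measurable_ident_sphere_prob])
  show ?thesis
    unfolding cap_ind_def by measurable
qed

lemma cap_ind_measurable1 [measurable]:
  assumes "y \<in> sphere 0 1" shows "(\<lambda>p. cap_ind p y) \<in> borel_measurable cap_param"
  using measurable_compose[OF measurable_Pair2'[of y sphere_prob cap_param] cap_ind_measurable_pair]
  using assms by simp

lemma cap_ind_le: "cap_ind p y \<le> 1" "0 \<le> cap_ind p y"
  by (auto simp: cap_ind_def)

text \<open>For a fixed centre \<open>z\<close> both caps contain their points exactly for heights
  up to \<open>min (z \<bullet> a) (z \<bullet> b)\<close>, and a minimum is half of sum minus
  absolute difference. Averaged over \<open>z\<close>, the linear part vanishes and the absolute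
  value leaves the distance. This is where Euclidean distance enters the discrepancy.\<close>

lemma integral_cap_ind_min:
  assumes a: "a \<in> sphere 0 1" and b: "b \<in> sphere 0 1"
  shows "(\<integral>p. cap_ind p a * cap_ind p b \<partial>cap_param) = 1 - dist a b / 4"
proof -
  let ?T = "restrict_space lborel {-1..1::real}"
  interpret T: finite_measure ?T by (rule finite_measure_Icc)
  interpret P: pair_sigma_finite ?T sphere_prob ..
  have int: "integrable cap_param (\<lambda>p. cap_ind p a * cap_ind p b)"
    using a b by (intro cap_param.integrable_const_bound[where B=1] borel_measurable_times cap_ind_measurable1)
      (auto simp: cap_ind_def intro!: AE_I2)
  have "(\<integral>p. cap_ind p a * cap_ind p b \<partial>cap_param)
      = (\<integral>z. (\<integral>t. cap_ind (t, z) a * cap_ind (t, z) b \<partial>?T) \<partial>sphere_prob)"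
    using int unfolding cap_param_def by (subst P.integral_snd) (simp_all add: case_prod_unfold)
  also have "\<dots> = (\<integral>z. 1 + ((a + b) \<bullet> z) / 2 - \<bar>(a - b) \<bullet> z\<bar> / 2 \<partial>sphere_prob)"
  proof (rule Bochner_Integration.integral_cong)
    fix z assume "z \<in> space sphere_prob"
    then have z: "z \<in> sphere 0 1" by simp
    define m where "m = min (z \<bullet> a) (z \<bullet> b)"
    have "\<bar>z \<bullet> a\<bar> \<le> 1" "\<bar>z \<bullet> b\<bar> \<le> 1"
      using Cauchy_Schwarz_ineq2[of z a] Cauchy_Schwarz_ineq2[of z b] a b z by auto
    then have m: "-1 \<le> m" "m \<le> 1" unfolding m_def by auto
    have "(\<integral>t. cap_ind (t, z) a * cap_ind (t, z) b \<partial>?T) = (\<integral>t. indicator {..m} t \<partial>?T)"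
      by (intro Bochner_Integration.integral_cong) (auto simp: cap_ind_def m_def)
    also have "\<dots> = measure lborel ({..m} \<inter> {-1..1})"
      by (simp add: measure_restrict_space space_restrict_space Int_assoc)
    also have "{..m} \<inter> {-1..1} = {-1..m}"
      using m by auto
    also have "measure lborel {-1..m} = m + 1" using m by simp
    also have "m + 1 = 1 + ((a + b) \<bullet> z) / 2 - \<bar>(a - b) \<bullet> z\<bar> / 2"
      unfolding m_def by (simp add: inner_add_left inner_diff_left inner_commute[of z] min_def)
        (auto simp: field_simps)
    finally show "(\<integral>t. cap_ind (t, z) a * cap_ind (t, z) b \<partial>?T) = 1 + ((a + b) \<bullet> z) / 2 - \<bar>(a - b) \<bullet> z\<bar> / 2" .
  qed simp
  also have "\<dots> = 1 + 0 / 2 - (norm (a - b) / 2) / 2"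
  proof -
    have 1: "integrable sphere_prob (\<lambda>z. ((a + b) \<bullet> z) / 2)" "integrable sphere_prob (\<lambda>z. \<bar>(a - b) \<bullet> z\<bar> / 2)"
      by (intro continuous_on_sphere_integrable continuous_intros; simp)+
    then show ?thesis
      using integral_abs_inner_sphere[of "a - b"] integral_inner_sphere[of "a + b"]
      by (simp add: sphere_prob.prob_space[unfolded space_sphere_prob])
  qed
  finally show ?thesis by (simp add: dist_norm)
qed

lemma measure_cap:
  "measure sphere_prob (cap z t) = (\<integral>y. cap_ind (t, z) y \<partial>sphere_prob)"
proof -
  have "(\<integral>y. cap_ind (t, z) y \<partial>sphere_prob) = (\<integral>y. indicator (cap z t) y \<partial>sphere_prob)"
    by (intro Bochner_Integration.integral_cong) (auto simp: cap_ind_def cap_def indicator_def)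
  also have "\<dots> = measure sphere_prob (cap z t \<inter> sphere 0 1)"
    by simp
  also have "cap z t \<inter> sphere 0 1 = cap z t" by (auto simp: cap_def)
  finally show ?thesis by simp
qed

text \<open>\<open>V\<close> and \<open>S\<close> are the empirical and the true cap measure.
  Expanding \<open>(V - S)^2\<close> and exchanging integrals reduces every term to
  \<open>integral_cap_ind_min\<close>; in the terms with \<open>S\<close> the distance is averaged
  to 4/3, which gives \<open>1 - 1/3 = 2/3\<close> for every point, whatever its position.\<close>

theorem stolarsky_invariance:
  assumes X: "finite X" "X \<noteq> {}" "X \<subseteq> sphere 0 1"
  shows "(L2_cap_discrepancy X)\<^sup>2 = (4/3 - (\<Sum>a\<in>X. \<Sum>b\<in>X. dist a b) / (real (card X))\<^sup>2) / 4"
proof -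
  let ?T = "restrict_space lborel {-1..1::real}"
  interpret T: finite_measure ?T by (rule finite_measure_Icc)
  interpret P: pair_sigma_finite ?T sphere_prob ..
  interpret Q: pair_sigma_finite cap_param sphere_prob ..
  interpret Q: finite_measure "cap_param \<Otimes>\<^sub>M sphere_prob"
    by (intro finite_measure_pair_measure sphere_prob.finite_measure_axioms cap_param.finite_measure_axioms)
  define N where "N = real (card X)"
  have N: "N > 0" using X by (simp add: N_def card_gt_0_iff)
  define S where "S p = (\<integral>y. cap_ind p y \<partial>sphere_prob)" for p
  define V where "V p = (\<Sum>a\<in>X. cap_ind p a) / N" for p
  have [measurable]: "S \<in> borel_measurable cap_param"
    unfolding S_def by measurable
  have Xs: "a \<in> sphere 0 1" if "a \<in> X" for a using X that by auto
  have [measurable]: "V \<in> borel_measurable cap_param"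
    unfolding V_def using Xs by measurable
  have S1: "S p \<le> 1" "0 \<le> S p" if "p \<in> space cap_param" for p
  proof -
    have "(\<lambda>y. cap_ind p y) \<in> borel_measurable sphere_prob"
      using measurable_compose[OF measurable_Pair1'[OF that] cap_ind_measurable_pair] by simp
    then have "integrable sphere_prob (\<lambda>y. cap_ind p y)"
      by (intro sphere_prob.integrable_const_bound[where B=1]) (auto simp: cap_ind_def intro!: AE_I2)
    then show "S p \<le> 1"
      unfolding S_def by (intro sphere_prob.integral_le_const) (auto intro!: AE_I2 simp: cap_ind_def)
    show "0 \<le> S p" unfolding S_def by (intro integral_nonneg_AE) (auto simp: cap_ind_le)
  qed
  have swap: "(\<integral>p. f p * S p \<partial>cap_param) = (\<integral>y. (\<integral>p. f p * cap_ind p y \<partial>cap_param) \<partial>sphere_prob)"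
    if [measurable]: "f \<in> borel_measurable cap_param" and f: "\<And>p. p \<in> space cap_param \<Longrightarrow> \<bar>f p\<bar> \<le> 1" for f
  proof -
    have "integrable (cap_param \<Otimes>\<^sub>M sphere_prob) (\<lambda>q. f (fst q) * cap_ind (fst q) (snd q))"
      using f by (intro Q.integrable_const_bound[where B=1])
        (auto simp: abs_mult cap_ind_le space_pair_measure intro!: AE_I2 mult_le_one)
    then have "(\<integral>y. (\<integral>p. f p * cap_ind p y \<partial>cap_param) \<partial>sphere_prob) = (\<integral>p. (\<integral>y. f p * cap_ind p y \<partial>sphere_prob) \<partial>cap_param)"
      by (intro Q.Fubini_integral) (simp add: case_prod_unfold)
    then show ?thesis by (simp add: S_def)
  qed
  have IS: "(\<integral>p. cap_ind p a * S p \<partial>cap_param) = 2/3" if a: "a \<in> sphere 0 1" for a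
  proof -
    have "(\<integral>p. cap_ind p a * S p \<partial>cap_param) = (\<integral>y. (\<integral>p. cap_ind p a * cap_ind p y \<partial>cap_param) \<partial>sphere_prob)"
      using a by (intro swap) (auto simp: cap_ind_le)
    also have "\<dots> = (\<integral>y. 1 - dist a y / 4 \<partial>sphere_prob)"
      using a by (intro Bochner_Integration.integral_cong) (auto simp: integral_cap_ind_min)
    also have "\<dots> = 1 - (4/3) / 4"
    proof -
      have "integrable sphere_prob (\<lambda>y. dist a y / 4)"
        by (intro continuous_on_sphere_integrable continuous_intros) auto
      then show ?thesis
        using integral_dist_sphere[OF a] by (simp add: sphere_prob.prob_space[unfolded space_sphere_prob])
    qed
    finally show ?thesis by simp
  qed
  have SS: "(\<integral>p. S p * S p \<partial>cap_param) = 2/3"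
  proof -
    have "(\<integral>p. S p * S p \<partial>cap_param) = (\<integral>y. (\<integral>p. S p * cap_ind p y \<partial>cap_param) \<partial>sphere_prob)"
      by (intro swap) (auto simp: S1)
    also have "\<dots> = (\<integral>y. 2/3 \<partial>sphere_prob)"
      using IS by (intro Bochner_Integration.integral_cong) (auto simp: mult.commute)
    finally show ?thesis by (simp add: sphere_prob.prob_space[unfolded space_sphere_prob])
  qed
  have i1: "integrable cap_param (\<lambda>p. cap_ind p a * cap_ind p b)" if "a \<in> X" "b \<in> X" for a b
    using Xs that by (intro cap_param.integrable_const_bound[where B=1] borel_measurable_times cap_ind_measurable1)
      (auto simp: cap_ind_def intro!: AE_I2)
  have i2: "integrable cap_param (\<lambda>p. cap_ind p a * S p)" if "a \<in> X" for a
    using Xs that by (intro cap_param.integrable_const_bound[where B=1])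
      (auto simp: abs_mult cap_ind_le S1 intro!: AE_I2 mult_le_one)
  have i3: "integrable cap_param (\<lambda>p. S p * S p)"
    by (intro cap_param.integrable_const_bound[where B=1])
      (auto simp: abs_mult S1 intro!: AE_I2 mult_le_one)
  have exp: "(V p - S p)\<^sup>2 = (\<Sum>a\<in>X. \<Sum>b\<in>X. cap_ind p a * cap_ind p b) / N\<^sup>2
      - (\<Sum>a\<in>X. cap_ind p a * S p) * (2 / N) + S p * S p" for p
  proof -
    have "(\<Sum>a\<in>X. \<Sum>b\<in>X. cap_ind p a * cap_ind p b) = (\<Sum>a\<in>X. cap_ind p a)\<^sup>2"
      by (simp add: power2_eq_square sum_product)
    moreover have "(\<Sum>a\<in>X. cap_ind p a * S p) = (\<Sum>a\<in>X. cap_ind p a) * S p"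
      by (simp add: sum_distrib_right)
    ultimately show ?thesis
      using N by (simp add: V_def power2_eq_square field_simps)
  qed
  have "(\<integral>p. (V p - S p)\<^sup>2 \<partial>cap_param) = (\<Sum>a\<in>X. \<Sum>b\<in>X. 1 - dist a b / 4) / N\<^sup>2
      - (\<Sum>a\<in>X. 2/3) * (2 / N) + 2/3"
    unfolding exp using i1 i2 i3 Xs
    by (simp add: IS SS integral_cap_ind_min)
  also have "\<dots> = (4/3 - (\<Sum>a\<in>X. \<Sum>b\<in>X. dist a b) / N\<^sup>2) / 4"
    using N by (simp add: sum_subtractf sum_divide_distrib[symmetric] N_def[symmetric] field_simps power2_eq_square)
  finally have eq: "(\<integral>p. (V p - S p)\<^sup>2 \<partial>cap_param) = (4/3 - (\<Sum>a\<in>X. \<Sum>b\<in>X. dist a b) / N\<^sup>2) / 4" .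
  have int: "integrable cap_param (\<lambda>p. (V p - S p)\<^sup>2)"
    unfolding exp using i1 i2 i3 by auto
  have card: "real (card (X \<inter> cap z t)) / N = V (t, z)" for z t
  proof -
    have "(\<Sum>a\<in>X. cap_ind (t, z) a) = real (card {a \<in> X. t \<le> z \<bullet> a})"
      using X by (simp add: cap_ind_def sum.If_cases Int_def)
    moreover have "X \<inter> cap z t = {a \<in> X. t \<le> z \<bullet> a}"
      using Xs by (auto simp: cap_def)
    ultimately show ?thesis by (simp add: V_def)
  qed
  have "(LINT t:{-1..1}|lborel. LINT x|sphere_prob.
       \<bar>real (card (X \<inter> cap x t)) / real (card X) - measure sphere_prob (cap x t)\<bar>\<^sup>2)
     = (LINT t|?T. LINT x|sphere_prob. (V (t, x) - S (t, x))\<^sup>2)"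
    unfolding card[unfolded N_def] measure_cap S_def[symmetric] power2_abs
    by (subst integral_restrict_space) (auto simp: set_lebesgue_integral_def)
  also have "\<dots> = (\<integral>p. (V p - S p)\<^sup>2 \<partial>cap_param)"
    using int unfolding cap_param_def by (subst P.integral_fst) (simp_all add: case_prod_unfold)
  finally have D: "L2_cap_discrepancy X = sqrt (\<integral>p. (V p - S p)\<^sup>2 \<partial>cap_param)"
    unfolding L2_cap_discrepancy_def by simp
  have "0 \<le> (\<integral>p. (V p - S p)\<^sup>2 \<partial>cap_param)" by (intro integral_nonneg_AE) auto
  then show ?thesis unfolding D N_def[symmetric] eq by simp
qed

subsection \<open>Lower bound for arbitrary finite sets\<close>

text \<open>The point is positive definiteness: integrated twice against a signed measure, the kernel gives a sum of squares.\<close>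
lemma inner_power_eq_sum:
  "\<exists>(F :: nat \<Rightarrow> real^3 \<Rightarrow> real) K. (\<forall>k. continuous_on UNIV (F k)) \<and>
    (\<forall>x y. (x \<bullet> y) ^ n = (\<Sum>k<K. F k x * F k y))"
proof (induction n)
  case 0
  show ?case
    by (rule exI[of _ "\<lambda>_ _. 1"], rule exI[of _ "Suc 0"]) simp
next
  case (Suc n)
  then obtain F :: "nat \<Rightarrow> real^3 \<Rightarrow> real" and K where c: "\<And>k. continuous_on UNIV (F k)"
    and e: "\<And>x y. (x \<bullet> y) ^ n = (\<Sum>k<K. F k x * F k y)" by blast
  \<comment> \<open>One more factor \<open>x \<bullet> y\<close> is a sum of three coordinate
    products, so the list of functions is tripled: each block of length \<open>K\<close> is the old
    list times one coordinate.\<close>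
  define G :: "nat \<Rightarrow> real^3 \<Rightarrow> real" where
    "G k x = (if k < K then x$1 * F k x else if k < K + K then x$2 * F (k - K) x else x$3 * F (k - (K + K)) x)" for k x
  have "continuous_on UNIV (G k)" for k
    unfolding G_def using c by (cases "k < K"; cases "k < K + K") (auto intro!: continuous_intros)
  moreover have "(x \<bullet> y) ^ Suc n = (\<Sum>k<K + K + K. G k x * G k y)" for x y
  proof -
    have split: "(\<Sum>k<a + b. f k) = (\<Sum>k<a. f k) + (\<Sum>k<b. f (a + k))" for a b :: nat and f :: "nat \<Rightarrow> real"
      by (induction b) auto
    have "(\<Sum>k<K + K + K. G k x * G k y) = x$1 * y$1 * (x \<bullet> y) ^ n + x$2 * y$2 * (x \<bullet> y) ^ n + x$3 * y$3 * (x \<bullet> y) ^ n"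
      unfolding split e sum_distrib_left by (simp add: G_def mult_ac)
    also have "\<dots> = (x \<bullet> y) ^ Suc n"
      by (simp add: inner_vec_def sum_3 algebra_simps)
    finally show ?thesis by simp
  qed
  ultimately show ?case by blast
qed

text \<open>Nonnegativity of the sum of \<open>(s k - m k)^2\<close>, where \<open>s k\<close> and
  \<open>m k\<close> are the means of \<open>F k\<close> over \<open>X\<close> and over the sphere.
  The sphere mean of \<open>(x \<bullet> y) ^ n\<close> in \<open>y\<close> is the same for all
  \<open>x\<close>, so the mixed sum and the sum of the \<open>m k * m k\<close> both equal
  \<open>\<mu>\<close>.\<close>

lemma avg_inner_power_ge:
  fixes X :: "(real^3) set"
  assumes X: "finite X" "X \<noteq> {}" "X \<subseteq> sphere 0 1"
  shows "integral {-1..1} (\<lambda>u::real. u ^ n) / 2 \<le> (\<Sum>a\<in>X. \<Sum>b\<in>X. (a \<bullet> b) ^ n) / (real (card X))\<^sup>2"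
proof -
  define N where "N = real (card X)"
  have N: "N > 0" using X by (simp add: N_def card_gt_0_iff)
  define \<mu> where "\<mu> = integral {-1..1} (\<lambda>u::real. u ^ n) / 2"
  obtain F :: "nat \<Rightarrow> real^3 \<Rightarrow> real" and K where c: "\<And>k. continuous_on UNIV (F k)"
    and e: "\<And>x y. (x \<bullet> y) ^ n = (\<Sum>k<K. F k x * F k y)" using inner_power_eq_sum by blast
  have i: "integrable sphere_prob (F k)" for k
    by (intro continuous_on_sphere_integrable continuous_on_subset[OF c]) auto
  define m where "m k = (\<integral>x. F k x \<partial>sphere_prob)" for k
  define s where "s k = (\<Sum>a\<in>X. F k a) / N" for k
  have 1: "(\<Sum>k<K. m k * F k x) = \<mu>" if x: "x \<in> sphere 0 1" for x
  proof -
    have "\<mu> = (\<integral>y. (x \<bullet> y) ^ n \<partial>sphere_prob)"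
      unfolding \<mu>_def by (intro integral_zonal[symmetric] x continuous_intros)
    also have "\<dots> = (\<Sum>k<K. m k * F k x)"
      unfolding e m_def using i by (simp add: mult.commute)
    finally show ?thesis by simp
  qed
  have "(\<Sum>k<K. m k * s k) = (\<Sum>a\<in>X. \<Sum>k<K. m k * F k a) / N"
    unfolding s_def by (subst sum.swap) (simp add: sum_distrib_left sum_divide_distrib)
  also have "\<dots> = \<mu>"
    using X(3) 1 N by (simp add: subset_eq N_def)
  finally have 2: "(\<Sum>k<K. m k * s k) = \<mu>" .
  have "(\<Sum>k<K. m k * m k) = (\<integral>x. (\<Sum>k<K. m k * F k x) \<partial>sphere_prob)"
    using i by (simp add: m_def)
  also have "\<dots> = (\<integral>x. \<mu> \<partial>sphere_prob)"
    by (intro Bochner_Integration.integral_cong) (auto simp: 1)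
  also have "\<dots> = \<mu>" by (simp add: sphere_prob.prob_space[unfolded space_sphere_prob])
  finally have 3: "(\<Sum>k<K. m k * m k) = \<mu>" .
  have "(\<Sum>k<K. s k * s k) = (\<Sum>k<K. \<Sum>a\<in>X. \<Sum>b\<in>X. F k a * F k b) / N\<^sup>2"
    unfolding s_def by (simp add: sum_product power2_eq_square sum_divide_distrib)
  also have "(\<Sum>k<K. \<Sum>a\<in>X. \<Sum>b\<in>X. F k a * F k b) = (\<Sum>a\<in>X. \<Sum>b\<in>X. (a \<bullet> b) ^ n)"
    unfolding e by (subst sum.swap, intro sum.cong refl, subst sum.swap) simp
  finally have 4: "(\<Sum>k<K. s k * s k) = (\<Sum>a\<in>X. \<Sum>b\<in>X. (a \<bullet> b) ^ n) / N\<^sup>2" .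
  have "0 \<le> (\<Sum>k<K. (s k - m k)\<^sup>2)" by (intro sum_nonneg) simp
  also have "\<dots> = (\<Sum>k<K. s k * s k) - 2 * (\<Sum>k<K. m k * s k) + (\<Sum>k<K. m k * m k)"
    by (simp add: power2_eq_square algebra_simps sum.distrib sum_subtractf sum_distrib_left)
  also have "\<dots> = (\<Sum>a\<in>X. \<Sum>b\<in>X. (a \<bullet> b) ^ n) / N\<^sup>2 - \<mu>"
    unfolding 2 3 4 by simp
  finally show ?thesis by (simp add: \<mu>_def N_def)
qed

text \<open>The sign condition starts at \<open>n = 1\<close> because constants have the same mean
  over \<open>X\<close> and over the sphere; the kernel used later has \<open>c 0 < 0\<close>.
  Convergence at \<open>u = 1\<close> makes the coefficients absolutely summable, so the series
  converges uniformly and the inequality for powers passes to the limit.\<close>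

lemma avg_positive_definite_ge:
  fixes X :: "(real^3) set" and h :: "real \<Rightarrow> real"
  assumes X: "finite X" "X \<noteq> {}" "X \<subseteq> sphere 0 1"
    and c: "\<And>n. n \<ge> 1 \<Longrightarrow> c n \<ge> 0"
    and h: "\<And>u. u \<in> {-1..1} \<Longrightarrow> (\<lambda>n. c n * u ^ n) sums h u"
  shows "integral {-1..1} h / 2 \<le> (\<Sum>a\<in>X. \<Sum>b\<in>X. h (a \<bullet> b)) / (real (card X))\<^sup>2"
proof -
  define N where "N = real (card X)"
  have N: "N > 0" using X by (simp add: N_def card_gt_0_iff)
  have "summable c" using h[of 1] by (simp add: sums_iff)
  have ev: "eventually (\<lambda>n. \<bar>c n\<bar> = c n) sequentially"
    using c by (auto simp: eventually_sequentially intro!: exI[of _ 1])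
  have s: "summable (\<lambda>n. \<bar>c n\<bar>)"
    using summable_cong[OF ev] \<open>summable c\<close> by simp
  define S where "S K u = (\<Sum>n<K. c n * u ^ n)" for K and u :: real
  have "uniform_limit {-1..1} S (\<lambda>u. \<Sum>n. c n * u ^ n) sequentially"
    unfolding S_def
  proof (rule Weierstrass_m_test)
    show "norm (c n * u ^ n) \<le> \<bar>c n\<bar>" if "u \<in> {-1..1}" for n and u :: real
      using that by (auto simp: abs_mult power_abs intro!: mult_left_le power_le_one)
  qed (use s in auto)
  then have ul: "uniform_limit {-1..1} S h sequentially"
    by (rule uniform_limit_cong'[THEN iffD1, rotated -1]) (use h in \<open>auto simp: sums_iff\<close>)
  obtain I J where I: "\<And>K. (S K has_integral I K) {-1..1}" and J: "(h has_integral J) {-1..1}"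
    and lim: "I \<longlonglongrightarrow> J"
    by (rule uniform_limit_integral[OF ul]) (auto simp: S_def intro!: continuous_intros)
  have rng: "a \<bullet> b \<in> {-1..1}" if "a \<in> X" "b \<in> X" for a b
    using Cauchy_Schwarz_ineq2[of a b] that X(3) by (auto simp: subset_eq)
  have "(\<lambda>K. S K (a \<bullet> b)) \<longlonglongrightarrow> h (a \<bullet> b)" if "a \<in> X" "b \<in> X" for a b
    using h[OF rng[OF that]] by (simp add: S_def sums_def)
  then have lim2: "(\<lambda>K. (\<Sum>a\<in>X. \<Sum>b\<in>X. S K (a \<bullet> b)) / N\<^sup>2) \<longlonglongrightarrow> (\<Sum>a\<in>X. \<Sum>b\<in>X. h (a \<bullet> b)) / N\<^sup>2"
    using N by (intro tendsto_intros) auto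
  have "I K / 2 \<le> (\<Sum>a\<in>X. \<Sum>b\<in>X. S K (a \<bullet> b)) / N\<^sup>2" for K
  proof -
    have "I K = (\<Sum>n<K. c n * integral {-1..1} (\<lambda>u::real. u ^ n))"
      using integral_unique[OF I[of K]] unfolding S_def
      by (subst (asm) Henstock_Kurzweil_Integration.integral_sum) (auto intro!: integrable_continuous_real continuous_intros)
    then have "I K / 2 = (\<Sum>n<K. c n * (integral {-1..1} (\<lambda>u::real. u ^ n) / 2))"
      by (simp add: sum_divide_distrib)
    also have "\<dots> \<le> (\<Sum>n<K. c n * ((\<Sum>a\<in>X. \<Sum>b\<in>X. (a \<bullet> b) ^ n) / N\<^sup>2))"
    proof (rule sum_mono)
      fix n
      show "c n * (integral {-1..1} (\<lambda>u::real. u ^ n) / 2) \<le> c n * ((\<Sum>a\<in>X. \<Sum>b\<in>X. (a \<bullet> b) ^ n) / N\<^sup>2)"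
      proof (cases "n = 0")
        case True
        then show ?thesis using N by (simp add: N_def[symmetric] power2_eq_square)
      next
        case False
        then show ?thesis using avg_inner_power_ge[OF X, of n] c[of n]
          unfolding N_def by (intro mult_left_mono) auto
      qed
    qed
    also have "\<dots> = (\<Sum>a\<in>X. \<Sum>b\<in>X. S K (a \<bullet> b)) / N\<^sup>2"
    proof -
      have "(\<Sum>n<K. c n * (\<Sum>a\<in>X. \<Sum>b\<in>X. (a \<bullet> b) ^ n)) = (\<Sum>a\<in>X. \<Sum>b\<in>X. S K (a \<bullet> b))"
        unfolding S_def sum_distrib_left
        by (subst sum.swap, intro sum.cong refl, subst sum.swap) simp
      then show ?thesis by (simp add: sum_divide_distrib[symmetric])
    qed
    finally show ?thesis .
  qed
  then have "J / 2 \<le> (\<Sum>a\<in>X. \<Sum>b\<in>X. h (a \<bullet> b)) / N\<^sup>2"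
    by (intro LIMSEQ_le[OF tendsto_divide[OF lim tendsto_const] lim2]) auto
  then show ?thesis using J by (simp add: integral_unique N_def)
qed

section \<open>Square roots as power series in the inner product\<close>

lemma gbinomial_half_sign:
  assumes "n \<ge> 1" shows "(1/2 gchoose n) * (- 1) ^ n \<le> (0::real)"
  using assms
proof (induction n rule: nat_induct_at_least)
  case (Suc n)
  have "(1/2 - real n) * (1/2 gchoose n) = real (Suc n) * (1/2 gchoose Suc n)"
    using gbinomial_mult_1[of "1/2::real" n] by (simp add: algebra_simps)
  then have h: "(1/2 gchoose Suc n) = (1/2 - real n) / real (Suc n) * (1/2 gchoose n)"
    by (simp add: field_simps)
  \<comment> \<open>From \<open>n = 1\<close> on the signed coefficient is only multiplied by
    positive numbers, so it keeps the sign of the first one, \<open>- 1/2\<close>.\<close>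
  then have "(1/2 gchoose Suc n) * (- 1) ^ Suc n = ((real n - 1/2) / real (Suc n)) * ((1/2 gchoose n) * (- 1) ^ n)"
    unfolding h by (simp add: field_simps)
  also have "\<dots> \<le> 0"
    using Suc by (intro mult_nonneg_nonpos[of "(real n - 1/2) / real (Suc n)"]) auto
  finally show ?case .
qed simp

text \<open>On the sphere \<open>dist^2 + e\<close> is \<open>(2 + e) - 2 * u\<close>, so
  \<open>B = 2 + e\<close>: the positive shift keeps \<open>2 * u / B\<close> strictly inside the
  disc of convergence of the binomial series on the whole closed interval.\<close>

lemma sqrt_power_series:
  fixes B u :: real
  assumes B: "B > 2" and u: "u \<in> {-1..1}"
  shows "(\<lambda>n. (sqrt B * ((1/2 gchoose n) * (- 1) ^ n) * (2 / B) ^ n) * u ^ n) sums sqrt (B - 2 * u)"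
proof -
  have a: "\<bar>- (2 / B) * u\<bar> < 1"
  proof -
    have "\<bar>- (2 / B) * u\<bar> \<le> 2 / B * 1"
      using B u unfolding abs_mult by (intro mult_mono) auto
    also have "\<dots> < 1" using B by simp
    finally show ?thesis .
  qed
  have 1: "(\<lambda>n. sqrt B * ((1/2 gchoose n) * (- (2 / B) * u) ^ n)) sums (sqrt B * (1 + - (2 / B) * u) powr (1/2))"
    by (intro sums_mult gen_binomial_real a)
  have 2: "sqrt B * (1 + - (2 / B) * u) powr (1/2) = sqrt (B - 2 * u)"
  proof -
    have "1 + - (2 / B) * u > 0" using a by linarith
    then have "sqrt B * (1 + - (2 / B) * u) powr (1/2) = sqrt (B * (1 + - (2 / B) * u))"
      by (simp add: powr_half_sqrt real_sqrt_mult)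
    also have "B * (1 + - (2 / B) * u) = B - 2 * u"
      using B by (simp add: field_simps)
    finally show ?thesis .
  qed
  have 3: "sqrt B * ((1/2 gchoose n) * (- (2 / B) * u) ^ n)
     = (sqrt B * ((1/2 gchoose n) * (- 1) ^ n) * (2 / B) ^ n) * u ^ n" for n
  proof -
    have "(- (2 / B) * u) ^ n = (- 1) ^ n * (2 / B) ^ n * u ^ n"
      by (metis mult_minus1 power_mult_distrib)
    then show ?thesis by simp
  qed
  show ?thesis using 1 unfolding 2 3 .
qed

text \<open>Midpoint convexity of \<open>s powr (3/2)\<close>, with \<open>p\<close>,
  \<open>q\<close>, \<open>r\<close> the square roots of the two ends and of the midpoint. The
  tangent at \<open>q^2\<close> lies below because the difference factors as
  \<open>(s - q)^2 * (s + q / 2)\<close>.\<close>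

lemma convex_cube_second_difference:
  fixes p q r :: real
  assumes "p \<ge> 0" "q \<ge> 0" "r \<ge> 0" "p\<^sup>2 + r\<^sup>2 = 2 * q\<^sup>2"
  shows "2 * q ^ 3 \<le> p ^ 3 + r ^ 3"
proof -
  have t: "q ^ 3 + 3/2 * q * (s\<^sup>2 - q\<^sup>2) \<le> s ^ 3" if "s \<ge> 0" for s
  proof -
    have "s ^ 3 - (q ^ 3 + 3/2 * q * (s\<^sup>2 - q\<^sup>2)) = (s - q)\<^sup>2 * (s + q / 2)"
      by (simp add: power2_eq_square power3_eq_cube field_simps)
    also have "\<dots> \<ge> 0" using that assms by simp
    finally show ?thesis by simp
  qed
  have r: "r\<^sup>2 - q\<^sup>2 = - (p\<^sup>2 - q\<^sup>2)" using assms by simp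
  show ?thesis using t[of p] t[of r] assms(1,3) unfolding r by (simp add: algebra_simps)
qed

theorem L2_cap_discrepancy_lower:
  assumes X: "finite X" "X \<noteq> {}" "X \<subseteq> sphere 0 1"
  shows "1/10 * real (card X) powr (-3/2) \<le> (L2_cap_discrepancy X)\<^sup>2"
proof -
  define N where "N = real (card X)"
  have N: "N > 0" using X by (simp add: N_def card_gt_0_iff)
  define e where "e = 1 / N"
  have e: "e > 0" using N by (simp add: e_def)
  define V where "V c = ((4 + c) * sqrt (4 + c) - c * sqrt c) / 6" for c :: real
  define h where "h u = - 2 * sqrt ((2 + e) - 2 * u) + sqrt ((2 + 2 * e) - 2 * u)" for u
  have inth: "integral {-1..1} h / 2 = - 2 * V e + V (2 * e)"
  proof -
    obtain x where x: "x \<in> X" using X by auto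
    then have x: "x \<in> sphere 0 1" using X by auto
    have "integral {-1..1} h / 2 = (\<integral>z. h (x \<bullet> z) \<partial>sphere_prob)"
      unfolding h_def by (intro integral_zonal[symmetric] x continuous_intros)
    also have "\<dots> = (\<integral>z. - 2 * sqrt ((dist x z)\<^sup>2 + e) + sqrt ((dist x z)\<^sup>2 + 2 * e) \<partial>sphere_prob)"
      using x by (intro Bochner_Integration.integral_cong) (auto simp: dist_sphere_power2 h_def algebra_simps)
    also have "\<dots> = - 2 * V e + V (2 * e)"
    proof -
      have "integrable sphere_prob (\<lambda>z. sqrt ((dist x z)\<^sup>2 + c))" for c
        by (intro continuous_on_sphere_integrable continuous_intros)
      moreover have "(\<integral>z. sqrt ((dist x z)\<^sup>2 + c) \<partial>sphere_prob) = V c" if "c \<ge> 0" for c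
        unfolding V_def by (rule integral_chordal_sqrt[OF that x])
      ultimately show ?thesis using e by simp
    qed
    finally show ?thesis .
  qed
  define c where "c n = - 2 * (sqrt (2 + e) * ((1/2 gchoose n) * (- 1) ^ n) * (2 / (2 + e)) ^ n)
     + sqrt (2 + 2 * e) * ((1/2 gchoose n) * (- 1) ^ n) * (2 / (2 + 2 * e)) ^ n" for n
  have "integral {-1..1} h / 2 \<le> (\<Sum>a\<in>X. \<Sum>b\<in>X. h (a \<bullet> b)) / N\<^sup>2"
    unfolding N_def
  proof (rule avg_positive_definite_ge[OF X, where c=c])
    fix n :: nat assume n: "n \<ge> 1"
    \<comment> \<open>The weight 2 on the root with the smaller shift makes its coefficient dominate
      in every degree: both the prefactor and the ratio of the geometric factor are the larger ones.
      The common binomial factor is nonpositive, and the minus sign in \<open>H\<close> turns this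
      into \<open>c n \<ge> 0\<close>.\<close>
    have "sqrt (2 + 2 * e) \<le> sqrt (4 * (2 + e))" using e by simp
    also have "\<dots> = 2 * sqrt (2 + e)" by (subst real_sqrt_mult) simp
    finally have "sqrt (2 + 2 * e) * (2 / (2 + 2 * e)) ^ n \<le> (2 * sqrt (2 + e)) * (2 / (2 + e)) ^ n"
      using e by (intro mult_mono power_mono divide_left_mono zero_le_power divide_nonneg_pos) auto
    then have "0 \<le> (- ((1/2 gchoose n) * (- 1) ^ n)) * ((2 * sqrt (2 + e)) * (2 / (2 + e)) ^ n - sqrt (2 + 2 * e) * (2 / (2 + 2 * e)) ^ n)"
      using gbinomial_half_sign[OF n] by (intro mult_nonneg_nonneg) auto
    also have "\<dots> = c n" by (simp add: c_def algebra_simps)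
    finally show "0 \<le> c n" .
  next
    fix u :: real assume u: "u \<in> {-1..1}"
    show "(\<lambda>n. c n * u ^ n) sums h u"
      using sums_add[OF sums_mult[OF sqrt_power_series[OF _ u, of "2 + e"], of "- 2"] sqrt_power_series[OF _ u, of "2 + 2 * e"]] e
      unfolding c_def h_def by (simp add: algebra_simps)
  qed
  also have "(\<Sum>a\<in>X. \<Sum>b\<in>X. h (a \<bullet> b)) = (\<Sum>a\<in>X. \<Sum>b\<in>X. - 2 * sqrt ((dist a b)\<^sup>2 + e) + sqrt ((dist a b)\<^sup>2 + 2 * e))"
    using X(3) by (intro sum.cong refl) (auto simp: dist_sphere_power2 h_def algebra_simps subset_eq)
  finally have H: "- 2 * V e + V (2 * e) \<le> (\<Sum>a\<in>X. \<Sum>b\<in>X. - 2 * sqrt ((dist a b)\<^sup>2 + e) + sqrt ((dist a b)\<^sup>2 + 2 * e)) / N\<^sup>2"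
    unfolding inth .
  define G where "G a b = - dist a b + 2 * sqrt ((dist a b)\<^sup>2 + e) - sqrt ((dist a b)\<^sup>2 + 2 * e)" for a b :: "real^3"
  have Gpos: "0 \<le> G a b" for a b
  proof -
    let ?d = "dist a b" and ?r = "sqrt ((dist a b)\<^sup>2 + 2 * e)" and ?q = "sqrt ((dist a b)\<^sup>2 + e)"
    have "(?d + ?r)\<^sup>2 \<le> 2 * (?d\<^sup>2 + ?r\<^sup>2)"
      using sum_squares_ge_zero[of "?d - ?r" 0] by (simp add: power2_eq_square algebra_simps)
    also have "\<dots> = (2 * ?q)\<^sup>2" using e by (simp add: power_mult_distrib)
    finally have "?d + ?r \<le> 2 * ?q" by (rule power2_le_imp_le) (use e in simp)
    then show ?thesis by (simp add: G_def)
  qed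
  have "N * ((2 - sqrt 2) * sqrt e) = (\<Sum>a\<in>X. G a a)"
    by (simp add: G_def N_def real_sqrt_mult algebra_simps)
  also have "\<dots> \<le> (\<Sum>a\<in>X. \<Sum>b\<in>X. G a b)"
    using X Gpos by (intro sum_mono member_le_sum) auto
  finally have GG: "(2 - sqrt 2) * sqrt e / N \<le> (\<Sum>a\<in>X. \<Sum>b\<in>X. G a b) / N\<^sup>2"
    using divide_right_mono[of "N * ((2 - sqrt 2) * sqrt e)" _ "N\<^sup>2"] N by (simp add: power2_eq_square)
  have GE: "(\<Sum>a\<in>X. \<Sum>b\<in>X. G a b) / N\<^sup>2 = - ((\<Sum>a\<in>X. \<Sum>b\<in>X. dist a b) / N\<^sup>2)
     - (\<Sum>a\<in>X. \<Sum>b\<in>X. - 2 * sqrt ((dist a b)\<^sup>2 + e) + sqrt ((dist a b)\<^sup>2 + 2 * e)) / N\<^sup>2"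
  proof -
    have "(\<Sum>a\<in>X. \<Sum>b\<in>X. G a b) = - (\<Sum>a\<in>X. \<Sum>b\<in>X. dist a b)
       - (\<Sum>a\<in>X. \<Sum>b\<in>X. - 2 * sqrt ((dist a b)\<^sup>2 + e) + sqrt ((dist a b)\<^sup>2 + 2 * e))"
      by (simp add: G_def sum_negf[symmetric] sum_subtractf[symmetric] algebra_simps)
    then show ?thesis by (simp add: diff_divide_distrib)
  qed
  have main: "(2 - sqrt 2) * sqrt e / N + (4/3 - 2 * V e + V (2 * e)) \<le> 4 * (L2_cap_discrepancy X)\<^sup>2"
  proof -
    have "4 * (L2_cap_discrepancy X)\<^sup>2 = 4/3 - (\<Sum>a\<in>X. \<Sum>b\<in>X. dist a b) / N\<^sup>2"
      by (simp only: stolarsky_invariance[OF X] N_def) simp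
    then show ?thesis using H GG GE by linarith
  qed
  have eV: "4/3 - 2 * V e + V (2 * e) \<ge> - ((2 * sqrt 2 - 2) / 6 * (e * sqrt e))"
  proof -
    have cube: "sqrt s ^ 3 = s * sqrt s" if "s \<ge> 0" for s
      using that by (simp add: power3_eq_cube)
    \<comment> \<open>The left-hand side is the second difference of \<open>V\<close> at 0,
      \<open>e\<close>, \<open>2 * e\<close>, as \<open>V 0 = 4/3\<close>. Its part from the
      antipodal end \<open>s = 4\<close> is nonnegative by convexity and is dropped; what remains
      comes from distance 0 and is of order \<open>e * sqrt e\<close>.\<close>
    have "2 * sqrt (4 + e) ^ 3 \<le> 2 ^ 3 + sqrt (4 + 2 * e) ^ 3"
      using e by (intro convex_cube_second_difference) auto
    then have "2 * ((4 + e) * sqrt (4 + e)) \<le> 8 + (4 + 2 * e) * sqrt (4 + 2 * e)"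
      using e by (simp add: cube)
    then show ?thesis
      by (simp add: V_def real_sqrt_mult field_simps)
  qed
  have ee: "(2 - sqrt 2) * sqrt e / N = (2 - sqrt 2) * (e * sqrt e)" by (simp add: e_def)
  have "((2 - sqrt 2) - (2 * sqrt 2 - 2) / 6) * (e * sqrt e) \<le> 4 * (L2_cap_discrepancy X)\<^sup>2"
    using main eV unfolding ee left_diff_distrib[of "2 - sqrt 2" "(2 * sqrt 2 - 2) / 6"] by linarith
  \<comment> \<open>The diagonal gain outweighs the loss on the sphere; a quarter of 2/5 is the
    constant 1/10.\<close>
  moreover have "2/5 * (e * sqrt e) \<le> ((2 - sqrt 2) - (2 * sqrt 2 - 2) / 6) * (e * sqrt e)"
  proof (rule mult_right_mono)
    have "sqrt 2 \<le> 71/50" by (rule real_le_lsqrt) (auto simp: power2_eq_square)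
    then show "2/5 \<le> (2 - sqrt 2) - (2 * sqrt 2 - 2) / 6" by (simp add: field_simps)
  qed (use e in auto)
  moreover have "N powr (-3/2) = e * sqrt e"
  proof -
    have "N powr (-3/2) = N powr ((-1) + (- (1/2)))" by simp
    also have "\<dots> = N powr (-1) * N powr (- (1/2))" by (rule powr_add)
    also have "\<dots> = 1 / N * (1 / sqrt N)"
      using N by (simp add: powr_minus_divide powr_half_sqrt)
    also have "\<dots> = e * sqrt e"
      by (simp add: e_def real_sqrt_divide)
    finally show ?thesis .
  qed
  ultimately have "1/10 * N powr (-3/2) \<le> (L2_cap_discrepancy X)\<^sup>2" by linarith
  then show ?thesis by (simp only: N_def)
qed

subsection \<open>Second order expansion of the distance\<close>

text \<open>In terms of \<open>z = sqrt (1 + s)\<close> the remainder is a polynomial divisible by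
  \<open>(z - 1) ^ 4\<close>, while \<open>s ^ 4 = (z - 1) ^ 4 * (z + 1) ^ 4\<close>. Hence the
  bound reaches down to the branch point \<open>s = -1\<close> and requires no smallness of
  \<open>s\<close>.\<close>

lemma sqrt_taylor_3:
  fixes s :: real
  assumes "s \<ge> -1"
  shows "\<bar>sqrt (1 + s) - (1 + s / 2 - s\<^sup>2 / 8 + s ^ 3 / 16)\<bar> \<le> s ^ 4"
proof -
  define z where "z = sqrt (1 + s)"
  have z: "z \<ge> 0" and s: "s = z\<^sup>2 - 1" using assms by (auto simp: z_def)
  have "z - (1 + s / 2 - s\<^sup>2 / 8 + s ^ 3 / 16) = - ((z - 1) ^ 4 * ((z\<^sup>2 + 4 * z + 5) / 16))"
    unfolding s by (simp add: field_simps eval_nat_numeral)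
  then have "\<bar>z - (1 + s / 2 - s\<^sup>2 / 8 + s ^ 3 / 16)\<bar> = (z - 1) ^ 4 * ((z\<^sup>2 + 4 * z + 5) / 16)"
    using z by (simp add: abs_mult)
  also have "\<dots> \<le> (z - 1) ^ 4 * (z + 1) ^ 4"
  proof (rule mult_left_mono)
    have "(z + 1) ^ 4 = z ^ 4 + 4 * z ^ 3 + 6 * z\<^sup>2 + 4 * z + 1"
      by (simp add: eval_nat_numeral algebra_simps)
    moreover have "0 \<le> z ^ 4" "0 \<le> z ^ 3" "0 \<le> z\<^sup>2" using z by auto
    ultimately show "(z\<^sup>2 + 4 * z + 5) / 16 \<le> (z + 1) ^ 4" using z by simp
  qed simp
  also have "\<dots> = s ^ 4"
    unfolding s power_mult_distrib[symmetric] by (simp add: power2_eq_square algebra_simps)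
  finally show ?thesis by (simp add: z_def)
qed

text \<open>The part of weight at most 3 of the cubic Taylor polynomial of
  \<open>sqrt (1 + (P + A)) - 1\<close>, where \<open>P\<close> counts once and \<open>A\<close>
  twice.\<close>

definition sqrt_jet :: "real \<Rightarrow> real \<Rightarrow> real" where
  "sqrt_jet P A = P / 2 + A / 2 - P\<^sup>2 / 8 - P * A / 4 + P ^ 3 / 16"

text \<open>In the weighted Taylor expansion \<open>P\<close> has order 1 and \<open>A\<close> has order 2.\<close>
lemma sqrt_jet_error:
  fixes P A \<epsilon> :: real
  assumes P: "\<bar>P\<bar> \<le> 4 * \<epsilon>" and A: "\<bar>A\<bar> \<le> 4 * \<epsilon>\<^sup>2" and \<epsilon>: "0 \<le> \<epsilon>" "\<epsilon> \<le> 1" and PA: "P + A \<ge> -1"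
  shows "\<bar>sqrt (1 + (P + A)) - 1 - sqrt_jet P A\<bar> \<le> 4200 * \<epsilon> ^ 4"
proof -
  have e: "\<epsilon> ^ 5 \<le> \<epsilon> ^ 4" "\<epsilon> ^ 6 \<le> \<epsilon> ^ 4" "\<epsilon>\<^sup>2 \<le> \<epsilon>"
    using \<epsilon> power_decreasing[of 4 5 \<epsilon>] power_decreasing[of 4 6 \<epsilon>] power_decreasing[of 1 2 \<epsilon>] by auto
  \<comment> \<open>The Taylor remainder contributes \<open>8 ^ 4 = 4096\<close>, the monomials of
    weight 4 and more that \<open>sqrt_jet\<close> omits contribute at most
    \<open>2 + 28 = 30\<close>; 4200 leaves room.\<close>
  have "\<bar>P + A\<bar> \<le> 8 * \<epsilon>" using P A e by linarith
  then have "\<bar>P + A\<bar> ^ 4 \<le> (8 * \<epsilon>) ^ 4" by (intro power_mono) auto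
  then have 1: "(P + A) ^ 4 \<le> 4096 * \<epsilon> ^ 4" by (simp add: power_mult_distrib)
  have "\<bar>A\<bar> ^ 2 \<le> (4 * \<epsilon>\<^sup>2) ^ 2" using A by (intro power_mono) auto
  then have 2: "\<bar>A\<^sup>2\<bar> \<le> 16 * \<epsilon> ^ 4" by (simp add: power_mult_distrib)
  have "\<bar>P\<bar>\<^sup>2 * \<bar>A\<bar> \<le> (4 * \<epsilon>)\<^sup>2 * (4 * \<epsilon>\<^sup>2)" using P A by (intro mult_mono power_mono) auto
  then have 3: "\<bar>P\<^sup>2 * A\<bar> \<le> 64 * \<epsilon> ^ 4" by (simp add: power_mult_distrib abs_mult eval_nat_numeral)
  have "\<bar>P\<bar> * \<bar>A\<bar>\<^sup>2 \<le> (4 * \<epsilon>) * (4 * \<epsilon>\<^sup>2)\<^sup>2" using P A by (intro mult_mono power_mono) auto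
  also have "\<dots> = 64 * \<epsilon> ^ 5" by (simp add: eval_nat_numeral)
  finally have 4: "\<bar>P * A\<^sup>2\<bar> \<le> 64 * \<epsilon> ^ 4" using e by (simp add: abs_mult)
  have "\<bar>A\<bar> ^ 3 \<le> (4 * \<epsilon>\<^sup>2) ^ 3" using A by (intro power_mono) auto
  also have "\<dots> = 64 * \<epsilon> ^ 6" by (simp add: eval_nat_numeral)
  finally have 5: "\<bar>A ^ 3\<bar> \<le> 64 * \<epsilon> ^ 4" using e by (simp add: power_abs)
  define R where "R = 1 + (P + A) / 2 - (P + A)\<^sup>2 / 8 + (P + A) ^ 3 / 16"
  have "R - 1 - sqrt_jet P A = - (A\<^sup>2 / 8) + (3 * (P\<^sup>2 * A) + 3 * (P * A\<^sup>2) + A ^ 3) / 16"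
    unfolding R_def sqrt_jet_def by (simp add: field_simps eval_nat_numeral)
  moreover have "\<bar>- (a / 8) + (3 * b + 3 * c + d) / 16\<bar> \<le> 30 * k"
    if "\<bar>a\<bar> \<le> 16 * k" "\<bar>b\<bar> \<le> 64 * k" "\<bar>c\<bar> \<le> 64 * k" "\<bar>d\<bar> \<le> 64 * k" for a b c d k :: real
    using that by (simp add: abs_le_iff field_simps)
  ultimately have "\<bar>R - 1 - sqrt_jet P A\<bar> \<le> 30 * \<epsilon> ^ 4"
    using 2 3 4 5 by presburger
  moreover have "\<bar>sqrt (1 + (P + A)) - R\<bar> \<le> 4096 * \<epsilon> ^ 4"
    using sqrt_taylor_3[OF PA] 1 unfolding R_def by linarith
  ultimately show ?thesis using zero_le_power[OF \<epsilon>(1), of 4] by linarith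
qed

text \<open>Minus the part quadratic in \<open>u\<close> of the gradient of \<open>norm\<close> at
  \<open>w + u\<close>; \<open>norm_jet_linear\<close> is minus the linear part. The signs suit a
  second displacement by \<open>- v\<close>.\<close>

definition norm_jet_quadratic :: "'a::real_inner \<Rightarrow> 'a \<Rightarrow> 'a" where
  "norm_jet_quadratic w u = (let d = norm w in
     (w \<bullet> u / d ^ 3) *\<^sub>R u + ((u \<bullet> u) / (2 * d ^ 3) - 3 * (w \<bullet> u)\<^sup>2 / (2 * d ^ 5)) *\<^sub>R w)"

definition norm_jet_linear :: "'a::real_inner \<Rightarrow> 'a \<Rightarrow> 'a" where
  "norm_jet_linear w u = (w \<bullet> u / norm w ^ 3) *\<^sub>R w - (1 / norm w) *\<^sub>R u"

text \<open>
  In the second difference only the mixed terms survive. Up to third order each of them is linear in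
  \<open>u\<close> or in \<open>v\<close>, hence negligible on average over well-centred cells.
\<close>
lemma norm_double_difference:
  fixes w u v :: "'a::real_inner"
  assumes w: "0 < \<eta>" "\<eta> \<le> norm w" and u: "norm u \<le> \<eta>" and v: "norm v \<le> \<eta>"
  shows "\<bar>norm w - norm (w + u) - norm (w - v) + norm (w + u - v)
     - (v \<bullet> (norm_jet_linear w u + norm_jet_quadratic w u) - u \<bullet> norm_jet_quadratic w v)\<bar> \<le> 12600 * \<eta> ^ 4 / norm w ^ 3"
proof -
  define d where "d = norm w"
  have d: "d > 0" using w unfolding d_def by linarith
  define \<epsilon> where "\<epsilon> = \<eta> / d"
  have \<epsilon>: "0 \<le> \<epsilon>" "\<epsilon> \<le> 1" using w d by (auto simp: \<epsilon>_def d_def)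
  define p where "p = 2 * (w \<bullet> u) / d\<^sup>2"
  define q where "q = 2 * (w \<bullet> v) / d\<^sup>2"
  define a where "a = (u \<bullet> u) / d\<^sup>2"
  define b where "b = (v \<bullet> v) / d\<^sup>2"
  define c where "c = 2 * (u \<bullet> v) / d\<^sup>2"
  have wu: "\<bar>w \<bullet> u\<bar> \<le> d * \<eta>" and wv: "\<bar>w \<bullet> v\<bar> \<le> d * \<eta>"
    using Cauchy_Schwarz_ineq2[of w u] Cauchy_Schwarz_ineq2[of w v] mult_left_mono[OF u, of d] mult_left_mono[OF v, of d] d
    unfolding d_def by linarith+
  have uu: "u \<bullet> u \<le> \<eta>\<^sup>2" and vv: "v \<bullet> v \<le> \<eta>\<^sup>2"
    using u v by (auto simp: dot_square_norm intro!: power_mono)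
  have "norm u * norm v \<le> \<eta> * \<eta>" using u v w by (intro mult_mono) auto
  then have uv: "\<bar>u \<bullet> v\<bar> \<le> \<eta>\<^sup>2"
    using Cauchy_Schwarz_ineq2[of u v] by (simp add: power2_eq_square)
  have \<epsilon>d: "\<eta> = \<epsilon> * d" using d by (simp add: \<epsilon>_def)
  have p: "\<bar>p\<bar> \<le> 2 * \<epsilon>" and q: "\<bar>q\<bar> \<le> 2 * \<epsilon>"
    using wu wv d unfolding p_def q_def \<epsilon>d by (auto simp: abs_mult divide_le_eq power2_eq_square mult_ac)
  have a: "0 \<le> a" "a \<le> \<epsilon>\<^sup>2" and b: "0 \<le> b" "b \<le> \<epsilon>\<^sup>2"
    using uu vv d unfolding a_def b_def \<epsilon>d by (auto simp: divide_le_eq power_mult_distrib)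
  have c: "\<bar>c\<bar> \<le> 2 * \<epsilon>\<^sup>2"
    using uv d unfolding c_def \<epsilon>d by (auto simp: abs_mult divide_le_eq power_mult_distrib)
  have nrm: "norm z = d * sqrt (1 + s)" "s \<ge> -1" if "z \<bullet> z = d\<^sup>2 * (1 + s)" for z :: 'a and s
  proof -
    have "0 \<le> d\<^sup>2 * (1 + s)" using that by (metis inner_ge_zero)
    then show "s \<ge> -1" using d by (simp add: zero_le_mult_iff)
    show "norm z = d * sqrt (1 + s)"
      using d that by (simp add: norm_eq_sqrt_inner real_sqrt_mult)
  qed
  have ww: "w \<bullet> w = d\<^sup>2" by (simp add: d_def dot_square_norm)
  have i1: "(w + u) \<bullet> (w + u) = d\<^sup>2 * (1 + (p + a))"
    using d by (simp add: p_def a_def inner_add inner_commute[of u w] ww field_simps)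
  have i2: "(w - v) \<bullet> (w - v) = d\<^sup>2 * (1 + (- q + b))"
    using d by (simp add: q_def b_def inner_diff inner_commute[of v w] ww field_simps)
  have i3: "(w + u - v) \<bullet> (w + u - v) = d\<^sup>2 * (1 + ((p - q) + (a + b - c)))"
    using d by (simp add: p_def q_def a_def b_def c_def inner_add inner_diff inner_commute[of v w]
      inner_commute[of u w] inner_commute[of v u] ww field_simps)
  have e1: "\<bar>sqrt (1 + (p + a)) - 1 - sqrt_jet p a\<bar> \<le> 4200 * \<epsilon> ^ 4"
    using p a \<epsilon> nrm(2)[OF i1] by (intro sqrt_jet_error) auto
  have e2: "\<bar>sqrt (1 + (- q + b)) - 1 - sqrt_jet (- q) b\<bar> \<le> 4200 * \<epsilon> ^ 4"
    using q b \<epsilon> nrm(2)[OF i2] by (intro sqrt_jet_error) auto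
  have e3: "\<bar>sqrt (1 + ((p - q) + (a + b - c))) - 1 - sqrt_jet (p - q) (a + b - c)\<bar> \<le> 4200 * \<epsilon> ^ 4"
    using p q a b c \<epsilon> nrm(2)[OF i3] by (intro sqrt_jet_error) auto
  \<comment> \<open>Terms in \<open>p\<close> and \<open>a\<close> alone depend only on
    \<open>u\<close>, those in \<open>q\<close> and \<open>b\<close> alone only on \<open>v\<close>;
    they cancel here, so that every remaining monomial mixes \<open>u\<close> and
    \<open>v\<close>.\<close>
  define J where "J = sqrt_jet (p - q) (a + b - c) - sqrt_jet p a - sqrt_jet (- q) b"
  have J: "d * J = v \<bullet> (norm_jet_linear w u + norm_jet_quadratic w u) - u \<bullet> norm_jet_quadratic w v"
  proof -
    have j: "d * J = d * (- c / 2) + d * (p * q / 4) + d * (p * c / 4) + d * (q * a / 4) - d * (3 * p\<^sup>2 * q / 16)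
        - d * (p * b / 4) - d * (q * c / 4) + d * (3 * p * q\<^sup>2 / 16)"
      unfolding J_def sqrt_jet_def by (simp add: field_simps eval_nat_numeral)
    have j1: "d * (- c / 2) = v \<bullet> (- (1 / d) *\<^sub>R u)"
      using d by (simp add: c_def inner_commute[of v u] power2_eq_square)
    have j2: "d * (p * q / 4) = v \<bullet> ((w \<bullet> u / d ^ 3) *\<^sub>R w)"
      using d by (simp add: p_def q_def inner_commute[of v w] eval_nat_numeral)
    have j3: "d * (p * c / 4) = v \<bullet> ((w \<bullet> u / d ^ 3) *\<^sub>R u)"
      using d by (simp add: p_def c_def inner_commute[of v u] eval_nat_numeral)
    have j4: "d * (q * a / 4) = v \<bullet> (((u \<bullet> u) / (2 * d ^ 3)) *\<^sub>R w)"
      using d by (simp add: q_def a_def inner_commute[of v w] eval_nat_numeral)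
    have j5: "d * (3 * p\<^sup>2 * q / 16) = v \<bullet> ((3 * (w \<bullet> u)\<^sup>2 / (2 * d ^ 5)) *\<^sub>R w)"
      using d by (simp add: q_def p_def inner_commute[of v w] eval_nat_numeral)
    have j6: "d * (p * b / 4) = u \<bullet> (((v \<bullet> v) / (2 * d ^ 3)) *\<^sub>R w)"
      using d by (simp add: p_def b_def inner_commute[of u w] eval_nat_numeral)
    have j7: "d * (q * c / 4) = u \<bullet> ((w \<bullet> v / d ^ 3) *\<^sub>R v)"
      using d by (simp add: q_def c_def eval_nat_numeral)
    have j8: "d * (3 * p * q\<^sup>2 / 16) = u \<bullet> ((3 * (w \<bullet> v)\<^sup>2 / (2 * d ^ 5)) *\<^sub>R w)"
      using d by (simp add: q_def p_def inner_commute[of u w] eval_nat_numeral)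
    show ?thesis
      unfolding j j1 j2 j3 j4 j5 j6 j7 j8 norm_jet_linear_def norm_jet_quadratic_def Let_def d_def[symmetric]
      by (simp add: inner_add_right inner_diff_right algebra_simps)
  qed
  have "norm w - norm (w + u) - norm (w - v) + norm (w + u - v) - d * J
     = d * ((sqrt (1 + ((p - q) + (a + b - c))) - 1 - sqrt_jet (p - q) (a + b - c))
        - (sqrt (1 + (p + a)) - 1 - sqrt_jet p a) - (sqrt (1 + (- q + b)) - 1 - sqrt_jet (- q) b))"
    unfolding nrm(1)[OF i1] nrm(1)[OF i2] nrm(1)[OF i3] d_def[symmetric] J_def by (simp add: algebra_simps)
  \<comment> \<open>One application of \<open>sqrt_jet_error\<close> for each of the three displaced
    norms, hence \<open>12600 = 3 * 4200\<close>.\<close>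
  also have "\<bar>\<dots>\<bar> \<le> d * (12600 * \<epsilon> ^ 4)"
    unfolding abs_mult using e1 e2 e3 d by (intro mult_mono) auto
  also have "\<dots> = 12600 * \<eta> ^ 4 / d ^ 3"
    using d by (simp add: \<epsilon>_def power_divide eval_nat_numeral)
  finally show ?thesis unfolding J unfolding d_def .
qed

lemma norm_norm_jet_quadratic_le:
  fixes w u :: "'a::real_inner"
  assumes w: "w \<noteq> 0" and u: "norm u \<le> \<eta>"
  shows "norm (norm_jet_quadratic w u) \<le> 3 * \<eta>\<^sup>2 / (norm w)\<^sup>2"
proof -
  define d where "d = norm w"
  have d: "d > 0" using w by (simp add: d_def)
  have \<eta>: "\<eta> \<ge> 0" using u norm_ge_zero[of u] by linarith
  have wu: "\<bar>w \<bullet> u\<bar> \<le> d * \<eta>"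
    using Cauchy_Schwarz_ineq2[of w u] mult_left_mono[OF u, of d] d unfolding d_def by linarith
  have uu: "u \<bullet> u \<le> \<eta>\<^sup>2"
    using u by (auto simp: dot_square_norm intro!: power_mono)
  have wu2: "(w \<bullet> u)\<^sup>2 \<le> (d * \<eta>)\<^sup>2"
    using power_mono[OF wu, of 2] by simp
  have "norm ((w \<bullet> u / d ^ 3) *\<^sub>R u) \<le> (d * \<eta> / d ^ 3) * \<eta>"
    using wu u d by (simp add: abs_divide) (intro mult_mono divide_right_mono; simp)
  also have "\<dots> = \<eta>\<^sup>2 / d\<^sup>2" using d by (simp add: eval_nat_numeral)
  finally have 1: "norm ((w \<bullet> u / d ^ 3) *\<^sub>R u) \<le> \<eta>\<^sup>2 / d\<^sup>2" .
  have "norm (((u \<bullet> u) / (2 * d ^ 3) - 3 * (w \<bullet> u)\<^sup>2 / (2 * d ^ 5)) *\<^sub>R w)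
     = \<bar>(u \<bullet> u) / (2 * d ^ 3) - 3 * (w \<bullet> u)\<^sup>2 / (2 * d ^ 5)\<bar> * d"
    by (simp add: d_def)
  also have "\<dots> \<le> (\<eta>\<^sup>2 / (2 * d ^ 3) + 3 * (d * \<eta>)\<^sup>2 / (2 * d ^ 5)) * d"
  proof (rule mult_right_mono)
    have "0 \<le> (u \<bullet> u) / (2 * d ^ 3)" "0 \<le> 3 * (w \<bullet> u)\<^sup>2 / (2 * d ^ 5)" using d by auto
    moreover have "(u \<bullet> u) / (2 * d ^ 3) \<le> \<eta>\<^sup>2 / (2 * d ^ 3)" "3 * (w \<bullet> u)\<^sup>2 / (2 * d ^ 5) \<le> 3 * (d * \<eta>)\<^sup>2 / (2 * d ^ 5)"
      using d uu wu2 by (auto intro!: divide_right_mono)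
    ultimately show "\<bar>(u \<bullet> u) / (2 * d ^ 3) - 3 * (w \<bullet> u)\<^sup>2 / (2 * d ^ 5)\<bar> \<le> \<eta>\<^sup>2 / (2 * d ^ 3) + 3 * (d * \<eta>)\<^sup>2 / (2 * d ^ 5)"
      by linarith
  qed (use d in simp)
  also have "\<dots> = 2 * \<eta>\<^sup>2 / d\<^sup>2" using d by (simp add: field_simps eval_nat_numeral)
  finally have 2: "norm (((u \<bullet> u) / (2 * d ^ 3) - 3 * (w \<bullet> u)\<^sup>2 / (2 * d ^ 5)) *\<^sub>R w) \<le> 2 * \<eta>\<^sup>2 / d\<^sup>2" .
  show ?thesis
    unfolding norm_jet_quadratic_def Let_def d_def[symmetric] using norm_triangle_mono[OF 1 2] by simp
qed

lemma norm_norm_jet_linear_le: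
  fixes w u :: "'a::real_inner"
  shows "norm (norm_jet_linear w u) \<le> 2 * norm u / norm w"
proof (cases "w = 0")
  case False
  have "norm ((w \<bullet> u / norm w ^ 3) *\<^sub>R w) = \<bar>w \<bullet> u\<bar> / (norm w)\<^sup>2"
    using False by (simp add: eval_nat_numeral)
  also have "\<dots> \<le> (norm w * norm u) / (norm w)\<^sup>2"
    by (intro divide_right_mono Cauchy_Schwarz_ineq2) simp
  finally have "norm ((w \<bullet> u / norm w ^ 3) *\<^sub>R w) \<le> norm u / norm w"
    using False by (simp add: power2_eq_square)
  moreover have "norm ((1 / norm w) *\<^sub>R u) = norm u / norm w" by simp
  ultimately have "norm (norm_jet_linear w u) \<le> norm u / norm w + norm u / norm w"
    unfolding norm_jet_linear_def by (intro order_trans[OF norm_triangle_ineq4] add_mono) auto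
  then show ?thesis by simp
qed (simp add: norm_jet_linear_def)

section \<open>Averages of double differences over two independent displacements\<close>

lemma (in prob_space) abs_expectation_le:
  fixes f :: "'a \<Rightarrow> real"
  assumes "\<And>x. x \<in> space M \<Longrightarrow> \<bar>f x\<bar> \<le> B"
  shows "\<bar>expectation f\<bar> \<le> B"
proof (cases "integrable M f")
  case True
  have "expectation f \<le> B" "- B \<le> expectation f"
    using assms True by (auto intro!: integral_le_const integral_ge_const AE_I2 simp: abs_le_iff minus_le_iff)
  then show ?thesis by simp
next
  case False
  \<comment> \<open>A non-integrable function has expectation 0 by convention, so only
    \<open>0 \<le> B\<close> is left, which any point of the nonempty space provides.\<close>
  obtain x where "x \<in> space M" using not_empty by auto
  then have "0 \<le> B" using assms[of x] by linarith
  then show ?thesis using False by (simp add: not_integrable_integral_eq)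
qed

lemma (in prob_space) norm_expectation_le:
  fixes f :: "'a \<Rightarrow> 'b::euclidean_space"
  assumes f: "f \<in> borel_measurable M" and B: "\<And>x. x \<in> space M \<Longrightarrow> norm (f x) \<le> B"
  shows "norm (expectation f) \<le> B"
proof -
  have "norm (expectation f) \<le> expectation (\<lambda>x. norm (f x))"
    by (rule integral_norm_bound)
  also have "\<dots> \<le> B"
    using abs_expectation_le[of "\<lambda>x. norm (f x)" B] B by simp
  finally show ?thesis .
qed

lemma (in prob_space) bounded_integrable:
  fixes f :: "'a \<Rightarrow> 'b::euclidean_space"
  assumes "f \<in> borel_measurable M" and "\<And>x. x \<in> space M \<Longrightarrow> norm (f x) \<le> B"
  shows "integrable M f"
  using assms by (intro integrable_const_bound[where B=B]) (auto intro!: AE_I2)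

lemma norm_jet_quadratic_measurable [measurable]:
  fixes w :: "real^3"
  shows "norm_jet_quadratic w \<in> borel_measurable borel"
  unfolding norm_jet_quadratic_def Let_def by measurable

text \<open>The expectations are iterated, so \<open>U\<close> and \<open>V\<close> act as
  independent variables. In the expansion of \<open>norm_double_difference\<close> each term is
  linear in one of them, and averaging replaces that factor by its mean. Displacements with small
  mean therefore gain over the naive bound, and the linear jet even yields the product of both
  means.\<close>

lemma (in prob_space) double_expectation_far:
  fixes U V :: "'a \<Rightarrow> real^3" and w :: "real^3"
  assumes [measurable]: "U \<in> borel_measurable M" "V \<in> borel_measurable M"
    and U: "\<And>x. x \<in> space M \<Longrightarrow> norm (U x) \<le> \<eta>" and V: "\<And>x. x \<in> space M \<Longrightarrow> norm (V x) \<le> \<eta>"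
    and \<eta>: "0 < \<eta>" "\<eta> \<le> norm w"
  shows "\<bar>expectation (\<lambda>x. expectation (\<lambda>y. norm w - norm (w + U x) - norm (w - V y) + norm (w + U x - V y)))\<bar>
    \<le> 3 * ((norm (expectation U))\<^sup>2 + (norm (expectation V))\<^sup>2) / norm w + 12604 * \<eta> ^ 4 / norm w ^ 3"
proof -
  define d where "d = norm w"
  have d: "d > 0" and w0: "w \<noteq> 0" using \<eta> unfolding d_def by auto
  define mu where "mu = expectation U"
  define mv where "mv = expectation V"
  define P where "P x = norm_jet_linear w (U x) + norm_jet_quadratic w (U x)" for x
  define Q where "Q y = norm_jet_quadratic w (V y)" for y
  have [measurable]: "P \<in> borel_measurable M" "Q \<in> borel_measurable M"
    unfolding P_def Q_def norm_jet_linear_def by measurable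
  define f where "f x y = norm w - norm (w + U x) - norm (w - V y) + norm (w + U x - V y)" for x y
  define T where "T x y = V y \<bullet> P x - U x \<bullet> Q y" for x y
  have iU: "integrable M U" and iV: "integrable M V"
    by (auto intro!: bounded_integrable U V)
  have bP2: "norm (norm_jet_quadratic w (U x)) \<le> 3 * \<eta>\<^sup>2 / d\<^sup>2" if "x \<in> space M" for x
    unfolding d_def by (intro norm_norm_jet_quadratic_le w0 U that)
  have iP2: "integrable M (\<lambda>x. norm_jet_quadratic w (U x))"
    by (rule bounded_integrable[OF _ bP2]) measurable
  have bQ: "norm (Q y) \<le> 3 * \<eta>\<^sup>2 / d\<^sup>2" if "y \<in> space M" for y
    unfolding d_def Q_def by (intro norm_norm_jet_quadratic_le w0 V that)
  have iQ: "integrable M Q"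
    by (rule bounded_integrable[OF _ bQ]) auto
  have iP1: "integrable M (\<lambda>x. norm_jet_linear w (U x))"
    and eP1: "expectation (\<lambda>x. norm_jet_linear w (U x)) = norm_jet_linear w mu"
    unfolding norm_jet_linear_def mu_def using iU by (auto simp: divide_inverse)
  have iP: "integrable M P"
    unfolding P_def using iP1 iP2 by auto
  have inner_T: "expectation (\<lambda>y. T x y) = mv \<bullet> P x - U x \<bullet> expectation Q" for x
    unfolding T_def mv_def using iV iQ by simp
  have ET: "expectation (\<lambda>x. expectation (\<lambda>y. T x y)) = mv \<bullet> expectation P - mu \<bullet> expectation Q"
    unfolding inner_T mu_def using iP iU by simp
  have nP: "norm (expectation P) \<le> 2 * norm mu / d + 3 * \<eta>\<^sup>2 / d\<^sup>2"
  proof -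
    have "expectation P = norm_jet_linear w mu + expectation (\<lambda>x. norm_jet_quadratic w (U x))"
      unfolding P_def using iP1 iP2 eP1 by simp
    also have "norm \<dots> \<le> 2 * norm mu / d + 3 * \<eta>\<^sup>2 / d\<^sup>2"
      unfolding d_def
      by (intro norm_triangle_mono norm_norm_jet_linear_le norm_expectation_le) (auto intro: bP2[unfolded d_def])
    finally show ?thesis .
  qed
  have nQ: "norm (expectation Q) \<le> 3 * \<eta>\<^sup>2 / d\<^sup>2"
    by (intro norm_expectation_le bQ) auto
  have "\<bar>expectation (\<lambda>x. expectation (\<lambda>y. T x y))\<bar> \<le> norm mv * norm (expectation P) + norm mu * norm (expectation Q)"
    unfolding ET by (smt (verit) Cauchy_Schwarz_ineq2)
  also have "\<dots> \<le> norm mv * (2 * norm mu / d + 3 * \<eta>\<^sup>2 / d\<^sup>2) + norm mu * (3 * \<eta>\<^sup>2 / d\<^sup>2)"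
    by (intro add_mono mult_left_mono nP nQ) auto
  also have "\<dots> \<le> 3 * ((norm mu)\<^sup>2 + (norm mv)\<^sup>2) / d + 4 * \<eta> ^ 4 / d ^ 3"
  proof -
    define a b c where "a = norm mu" and "b = norm mv" and "c = \<eta>\<^sup>2 / d"
    \<comment> \<open>Completing squares removes the mixed products, leaving one error per cell and
      a term independent of the means. \<open>c\<close> is such that
      \<open>c^2 / d = \<eta> ^ 4 / d ^ 3\<close>, the size of the Taylor remainder.\<close>
    have "3 * (a\<^sup>2 + b\<^sup>2) + 4 * c\<^sup>2 - (2 * a * b + 3 * a * c + 3 * b * c)
        = (a - b)\<^sup>2 + 2 * (a - 3/4 * c)\<^sup>2 + 2 * (b - 3/4 * c)\<^sup>2 + 7/4 * c\<^sup>2"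
      by (simp add: power2_eq_square algebra_simps)
    also have "\<dots> \<ge> 0" by (intro add_nonneg_nonneg mult_nonneg_nonneg) auto
    finally have *: "2 * a * b + 3 * a * c + 3 * b * c \<le> 3 * (a\<^sup>2 + b\<^sup>2) + 4 * c\<^sup>2" by simp
    have "b * (2 * a / d + 3 * \<eta>\<^sup>2 / d\<^sup>2) + a * (3 * \<eta>\<^sup>2 / d\<^sup>2) = (2 * a * b + 3 * a * c + 3 * b * c) / d"
      using d by (simp add: c_def field_simps power2_eq_square)
    also have "\<dots> \<le> (3 * (a\<^sup>2 + b\<^sup>2) + 4 * c\<^sup>2) / d"
      using * d by (intro divide_right_mono) auto
    also have "\<dots> = 3 * (a\<^sup>2 + b\<^sup>2) / d + 4 * \<eta> ^ 4 / d ^ 3"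
      using d by (simp add: c_def add_divide_distrib power_divide eval_nat_numeral)
    finally show ?thesis unfolding a_def b_def .
  qed
  finally have 1: "\<bar>expectation (\<lambda>x. expectation (\<lambda>y. T x y))\<bar> \<le> 3 * ((norm mu)\<^sup>2 + (norm mv)\<^sup>2) / d + 4 * \<eta> ^ 4 / d ^ 3" .
  have fT: "\<bar>f x y - T x y\<bar> \<le> 12600 * \<eta> ^ 4 / d ^ 3" if "x \<in> space M" "y \<in> space M" for x y
    unfolding f_def T_def P_def Q_def d_def using \<eta> U V that by (intro norm_double_difference) auto
  have fb: "\<bar>f x y\<bar> \<le> 2 * \<eta>" if "x \<in> space M" for x y
    using U[OF that] norm_triangle_ineq3[of w "w + U x"] norm_triangle_ineq3[of "w + U x - V y" "w - V y"]
    unfolding f_def by simp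
  have iT: "integrable M (\<lambda>y. T x y)" for x
    unfolding T_def using iV iQ by auto
  have iff: "integrable M (\<lambda>y. f x y)" if "x \<in> space M" for x
    by (rule bounded_integrable[where B="2 * \<eta>"]) (use fb[OF that] in \<open>auto simp: f_def\<close>)
  have iET: "integrable M (\<lambda>x. expectation (\<lambda>y. T x y))"
    unfolding inner_T using iP iU by auto
  have [measurable]: "(\<lambda>x. expectation (\<lambda>y. f x y)) \<in> borel_measurable M"
    unfolding f_def by measurable
  have iEf: "integrable M (\<lambda>x. expectation (\<lambda>y. f x y))"
    by (rule bounded_integrable[where B="2 * \<eta>"]) (use abs_expectation_le fb in auto)
  have "\<bar>expectation (\<lambda>x. expectation (\<lambda>y. f x y)) - expectation (\<lambda>x. expectation (\<lambda>y. T x y))\<bar>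
      = \<bar>expectation (\<lambda>x. expectation (\<lambda>y. f x y) - expectation (\<lambda>y. T x y))\<bar>"
    using iEf iET by simp
  also have "\<dots> \<le> 12600 * \<eta> ^ 4 / d ^ 3"
  proof (rule abs_expectation_le)
    fix x assume x: "x \<in> space M"
    have "expectation (\<lambda>y. f x y) - expectation (\<lambda>y. T x y) = expectation (\<lambda>y. f x y - T x y)"
      using iT iff[OF x] by simp
    then show "\<bar>expectation (\<lambda>y. f x y) - expectation (\<lambda>y. T x y)\<bar> \<le> 12600 * \<eta> ^ 4 / d ^ 3"
      using abs_expectation_le[of "\<lambda>y. f x y - T x y"] fT[OF x] by simp
  qed
  finally have 2: "\<bar>expectation (\<lambda>x. expectation (\<lambda>y. f x y)) - expectation (\<lambda>x. expectation (\<lambda>y. T x y))\<bar> \<le> 12600 * \<eta> ^ 4 / d ^ 3" .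
  have "12604 * \<eta> ^ 4 / d ^ 3 = 12600 * \<eta> ^ 4 / d ^ 3 + 4 * \<eta> ^ 4 / d ^ 3"
    by (simp add: add_divide_distrib[symmetric])
  then show ?thesis
    using 1 2 unfolding f_def d_def mu_def mv_def by linarith
qed

text \<open>For \<open>norm w \<ge> \<eta>\<close> one has \<open>q \<le> 2 * norm w\<close>, which
  costs the factors 2 and 8 (\<open>8 * 12604 = 100832\<close>). Otherwise
  \<open>q \<le> 2 * \<eta>\<close>, and the trivial bound \<open>2 * \<eta>\<close> is already of
  order \<open>\<eta> ^ 4 / q ^ 3\<close>. Thus pairs at any distance, including a cell with itself,
  obey the same estimate.\<close>

lemma (in prob_space) double_expectation_le:
  fixes U V :: "'a \<Rightarrow> real^3" and w :: "real^3"
  assumes [measurable]: "U \<in> borel_measurable M" "V \<in> borel_measurable M"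
    and U: "\<And>x. x \<in> space M \<Longrightarrow> norm (U x) \<le> \<eta>" and V: "\<And>x. x \<in> space M \<Longrightarrow> norm (V x) \<le> \<eta>"
    and \<eta>: "0 < \<eta>"
  defines "q \<equiv> sqrt ((norm w)\<^sup>2 + \<eta>\<^sup>2)"
  shows "\<bar>expectation (\<lambda>x. expectation (\<lambda>y. norm w - norm (w + U x) - norm (w - V y) + norm (w + U x - V y)))\<bar>
    \<le> 6 * ((norm (expectation U))\<^sup>2 + (norm (expectation V))\<^sup>2) / q + 110000 * \<eta> ^ 4 / q ^ 3"
    (is "\<bar>?E\<bar> \<le> _")
proof -
  have q0: "q > 0" using \<eta> unfolding q_def by (simp add: add_nonneg_pos)
  have four_square: "(2 * z)\<^sup>2 = 4 * z\<^sup>2" for z :: real by simp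
  define m where "m = (norm (expectation U))\<^sup>2 + (norm (expectation V))\<^sup>2"
  have m: "m \<ge> 0" by (simp add: m_def)
  show ?thesis
  proof (cases "\<eta> \<le> norm w")
    case True
    define d where "d = norm w"
    have d: "d > 0" using True \<eta> unfolding d_def by linarith
    have "q \<le> sqrt ((2 * d)\<^sup>2)"
      unfolding q_def d_def[symmetric]
    proof (rule real_sqrt_le_mono)
      have "\<eta>\<^sup>2 \<le> d\<^sup>2" using True \<eta> unfolding d_def by (intro power_mono) auto
      then show "d\<^sup>2 + \<eta>\<^sup>2 \<le> (2 * d)\<^sup>2" using zero_le_power2[of d] four_square[of d] by linarith
    qed
    then have q: "q \<le> 2 * d" unfolding real_sqrt_abs using d by simp
    have "q ^ 3 \<le> (2 * d) ^ 3" using q q0 by (intro power_mono) auto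
    then have q3: "q ^ 3 \<le> 8 * d ^ 3" by (simp add: power_mult_distrib)
    have "3 * m / d = 6 * m / (2 * d)" using d by simp
    also have "\<dots> \<le> 6 * m / q"
      using q q0 m d by (intro divide_left_mono) auto
    finally have 1: "3 * m / d \<le> 6 * m / q" .
    have "12604 * \<eta> ^ 4 / d ^ 3 = 100832 * \<eta> ^ 4 / (8 * d ^ 3)" using d by simp
    also have "\<dots> \<le> 100832 * \<eta> ^ 4 / q ^ 3"
      using q3 q0 d by (intro divide_left_mono) auto
    also have "\<dots> \<le> 110000 * \<eta> ^ 4 / q ^ 3"
      using q0 by (intro divide_right_mono) auto
    finally have 2: "12604 * \<eta> ^ 4 / d ^ 3 \<le> 110000 * \<eta> ^ 4 / q ^ 3" .
    have "\<bar>?E\<bar> \<le> 3 * m / d + 12604 * \<eta> ^ 4 / d ^ 3"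
      unfolding m_def d_def using True \<eta> U V by (intro double_expectation_far) auto
    then show ?thesis using 1 2 unfolding m_def by linarith
  next
    case False
    have "q \<le> sqrt ((2 * \<eta>)\<^sup>2)"
      unfolding q_def
    proof (rule real_sqrt_le_mono)
      have "(norm w)\<^sup>2 \<le> \<eta>\<^sup>2" using False \<eta> by (intro power_mono) auto
      then show "(norm w)\<^sup>2 + \<eta>\<^sup>2 \<le> (2 * \<eta>)\<^sup>2" using zero_le_power2[of \<eta>] four_square[of \<eta>] by linarith
    qed
    then have "q \<le> 2 * \<eta>" unfolding real_sqrt_abs using \<eta> by simp
    then have "q ^ 3 \<le> (2 * \<eta>) ^ 3" using q0 by (intro power_mono) auto
    then have q3: "q ^ 3 \<le> 8 * \<eta> ^ 3" by (simp add: power_mult_distrib)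
    have "2 * \<eta> = 16 * \<eta> ^ 4 / (8 * \<eta> ^ 3)" using \<eta> by (simp add: eval_nat_numeral)
    also have "\<dots> \<le> 16 * \<eta> ^ 4 / q ^ 3"
      using q3 q0 \<eta> by (intro divide_left_mono) auto
    also have "\<dots> \<le> 110000 * \<eta> ^ 4 / q ^ 3"
      using q0 by (intro divide_right_mono) auto
    finally have 2: "2 * \<eta> \<le> 110000 * \<eta> ^ 4 / q ^ 3" .
    have "\<bar>norm w - norm (w + U x) - norm (w - V y) + norm (w + U x - V y)\<bar> \<le> 2 * \<eta>" if "x \<in> space M" for x y
      using U[OF that] norm_triangle_ineq3[of w "w + U x"] norm_triangle_ineq3[of "w + U x - V y" "w - V y"]
      by simp
    then have "\<bar>?E\<bar> \<le> 2 * \<eta>"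
      by (intro abs_expectation_le) auto
    moreover have "0 \<le> 6 * m / q" using m q0 by simp
    ultimately show ?thesis using 2 unfolding m_def by linarith
  qed
qed

section \<open>Interaction energy of well-centred cells\<close>

lemma integral_inverse_sqrt_chordal:
  assumes c: "c > 0" and x: "x \<in> sphere 0 1"
  shows "(\<integral>z. 1 / sqrt ((dist x z)\<^sup>2 + c) \<partial>sphere_prob) \<le> 1"
proof -
  have "(\<integral>z. 1 / sqrt ((dist x z)\<^sup>2 + c) \<partial>sphere_prob) = (2 * sqrt (4 + c) - 2 * sqrt (0 + c)) / 4"
  proof (rule integral_chordal[where G="\<lambda>s. 2 * sqrt (s + c)", OF _ _ _ x])
    show "((\<lambda>s. 2 * sqrt (s + c)) has_real_derivative 1 / sqrt (s + c)) (at s)" if "s \<in> {0<..<4}" for s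
      using that c by (auto intro!: derivative_eq_intros simp: field_simps)
  qed (use c in \<open>auto intro!: continuous_intros\<close>)
  also have "sqrt (4 + c) \<le> 2 + sqrt c"
    using sqrt_add_le_add_sqrt[of 4 c] c by simp
  finally show ?thesis by simp
qed

text \<open>The inverse cube of the distance is not integrable on a surface; smoothing at scale
  \<open>sqrt c\<close> costs one factor \<open>1 / sqrt c\<close>. With \<open>c = \<eta>^2\<close>
  the interaction \<open>\<eta> ^ 4 / q ^ 3\<close> thus averages to order
  \<open>\<eta> ^ 3\<close>.\<close>

lemma integral_inverse_sqrt_cubed_chordal:
  assumes c: "c > 0" and x: "x \<in> sphere 0 1"
  shows "(\<integral>z. 1 / sqrt ((dist x z)\<^sup>2 + c) ^ 3 \<partial>sphere_prob) \<le> 1 / (2 * sqrt c)"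
proof -
  have "(\<integral>z. 1 / sqrt ((dist x z)\<^sup>2 + c) ^ 3 \<partial>sphere_prob) = (- 2 / sqrt (4 + c) - (- 2 / sqrt (0 + c))) / 4"
  proof (rule integral_chordal[where G="\<lambda>s. - 2 / sqrt (s + c)", OF _ _ _ x])
    show "((\<lambda>s. - 2 / sqrt (s + c)) has_real_derivative 1 / sqrt (s + c) ^ 3) (at s)" if "s \<in> {0<..<4}" for s
    proof -
      have p: "s + c > 0" using that c by auto
      have "((\<lambda>s. - 2 / sqrt (s + c)) has_real_derivative
          - (- 2 * (inverse (sqrt (s + c)) / 2)) / (sqrt (s + c) * sqrt (s + c))) (at s)"
        using p by (auto intro!: derivative_eq_intros simp: power2_eq_square)
      then show ?thesis using p by (simp add: power3_eq_cube field_simps)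
    qed
  qed (use c in \<open>auto intro!: continuous_intros\<close>)
  also have "\<dots> \<le> (2 / sqrt c) / 4" using c by (intro divide_right_mono) auto
  finally show ?thesis by simp
qed

text \<open>\<open>y i\<close> is a random point of the \<open>i\<close>-th cell, and
  \<open>cell\<close> says that a random point in a random cell is uniform on the sphere. So in the
  double difference \<open>L i j\<close>, averaged over all pairs, each of the three terms
  containing some \<open>y\<close> gives 4/3, and the left-hand side is minus the mean of
  \<open>L i j\<close>. The constants are \<open>440000 = 110000 * 4\<close> and
  \<open>24 = 12 * 2\<close>, from \<open>s3\<close> and \<open>s1\<close>.\<close>

theorem energy_upper:
  fixes M :: "'a measure" and x :: "'i \<Rightarrow> real^3" and y :: "'i \<Rightarrow> 'a \<Rightarrow> real^3"
  assumes M: "prob_space M" and I: "finite I" "I \<noteq> {}"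
    and x: "\<And>i. i \<in> I \<Longrightarrow> x i \<in> sphere 0 1"
    and ym: "\<And>i. i \<in> I \<Longrightarrow> y i \<in> borel_measurable M"
    and ys: "\<And>i p. i \<in> I \<Longrightarrow> p \<in> space M \<Longrightarrow> y i p \<in> sphere 0 1"
    and near: "\<And>i p. i \<in> I \<Longrightarrow> p \<in> space M \<Longrightarrow> norm (y i p - x i) \<le> \<eta>" and \<eta>: "0 < \<eta>"
    and cell: "\<And>F :: real^3 \<Rightarrow> real. continuous_on (sphere 0 1) F \<Longrightarrow>
      (\<integral>z. F z \<partial>sphere_prob) = (\<Sum>i\<in>I. \<integral>p. F (y i p) \<partial>M) / card I"
  shows "4/3 - (\<Sum>i\<in>I. \<Sum>j\<in>I. dist (x i) (x j)) / (real (card I))\<^sup>2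
    \<le> 440000 * \<eta> ^ 3 + 24 * (\<Sum>i\<in>I. (norm ((\<integral>p. y i p \<partial>M) - x i))\<^sup>2) / card I"
proof -
  interpret prob_space M by fact
  define N where "N = real (card I)"
  have N: "N > 0" using I by (simp add: N_def card_gt_0_iff)
  define m where "m i = (norm ((\<integral>p. y i p \<partial>M) - x i))\<^sup>2" for i
  have m: "m i \<ge> 0" for i by (simp add: m_def)
  define q where "q i j = sqrt ((dist (x i) (x j))\<^sup>2 + \<eta>\<^sup>2)" for i j
  define L where "L i j = expectation (\<lambda>p. expectation (\<lambda>r. dist (x i) (x j) - dist (y i p) (x j)
     - dist (x i) (y j r) + dist (y i p) (y j r)))" for i j
  have iy: "integrable M (y i)" if "i \<in> I" for i
    using ys[OF that] by (intro bounded_integrable[where B=1] ym that) auto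
  have Lb: "\<bar>L i j\<bar> \<le> 6 * (m i + m j) / q i j + 110000 * \<eta> ^ 4 / q i j ^ 3" if "i \<in> I" "j \<in> I" for i j
  proof -
    have [measurable]: "y i \<in> borel_measurable M" "y j \<in> borel_measurable M" using ym that by auto
    have eq: "L i j = expectation (\<lambda>p. expectation (\<lambda>r. norm (x i - x j) - norm (x i - x j + (y i p - x i))
       - norm (x i - x j - (y j r - x j)) + norm (x i - x j + (y i p - x i) - (y j r - x j))))"
      unfolding L_def by (simp add: dist_norm)
    have e: "m k = (norm (expectation (\<lambda>p. y k p - x k)))\<^sup>2" if "k \<in> I" for k
      using iy[OF that] by (simp add: m_def prob_space)
    show ?thesis
      unfolding eq e[OF that(1)] e[OF that(2)] q_def dist_norm using that near \<eta>
      by (intro double_expectation_le) auto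
  qed
  have di: "integrable M (\<lambda>p. dist a (y j p))" if "j \<in> I" for a j
  proof (rule bounded_integrable)
    show "(\<lambda>p. dist a (y j p)) \<in> borel_measurable M" using ym[OF that] by measurable
    show "norm (dist a (y j p)) \<le> norm a + 1" if "p \<in> space M" for p
      using ys[OF \<open>j \<in> I\<close> that] dist_triangle[of a "y j p" 0] by simp
  qed
  have avg: "(\<Sum>j\<in>I. expectation (\<lambda>r. dist a (y j r))) = 4/3 * N" if a: "a \<in> sphere 0 1" for a
    using cell[of "\<lambda>z. dist a z"] integral_dist_sphere[OF a] N
    by (simp add: continuous_intros N_def field_simps)
  have LL: "L i j = dist (x i) (x j) - expectation (\<lambda>r. dist (x j) (y i r)) - expectation (\<lambda>r. dist (x i) (y j r))
     + expectation (\<lambda>p. expectation (\<lambda>r. dist (y i p) (y j r)))" if i: "i \<in> I" and j: "j \<in> I" for i j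
  proof -
    have [measurable]: "y i \<in> borel_measurable M" "y j \<in> borel_measurable M" using ym that by auto
    have 1: "expectation (\<lambda>r. dist (x i) (x j) - dist (y i p) (x j) - dist (x i) (y j r) + dist (y i p) (y j r))
       = dist (x i) (x j) - dist (x j) (y i p) - expectation (\<lambda>r. dist (x i) (y j r)) + expectation (\<lambda>r. dist (y i p) (y j r))" for p
      using di[OF j] by (simp add: prob_space dist_commute)
    have "integrable M (\<lambda>p. expectation (\<lambda>r. dist (y i p) (y j r)))"
    proof (rule bounded_integrable)
      show "norm (expectation (\<lambda>r. dist (y i p) (y j r))) \<le> 2" if p: "p \<in> space M" for p
        unfolding real_norm_def
      proof (rule abs_expectation_le)
        fix r assume r: "r \<in> space M"
        show "\<bar>dist (y i p) (y j r)\<bar> \<le> 2"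
          using dist_triangle[of "y i p" "y j r" 0] ys[OF i p] ys[OF j r] by simp
      qed
    qed measurable
    then show ?thesis
      unfolding L_def 1 using di[OF i] by (simp add: prob_space)
  qed
  have SL: "(\<Sum>i\<in>I. \<Sum>j\<in>I. L i j) = (\<Sum>i\<in>I. \<Sum>j\<in>I. dist (x i) (x j)) - 4/3 * N\<^sup>2"
  proof -
    have "(\<Sum>i\<in>I. \<Sum>j\<in>I. expectation (\<lambda>r. dist (x i) (y j r))) = (\<Sum>i\<in>I. 4/3 * N)"
      by (intro sum.cong refl avg x)
    then have e2: "(\<Sum>i\<in>I. \<Sum>j\<in>I. expectation (\<lambda>r. dist (x i) (y j r))) = 4/3 * N\<^sup>2"
      by (simp add: N_def power2_eq_square)
    then have e1: "(\<Sum>i\<in>I. \<Sum>j\<in>I. expectation (\<lambda>r. dist (x j) (y i r))) = 4/3 * N\<^sup>2"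
      by (subst sum.swap)
    have "(\<Sum>j\<in>I. expectation (\<lambda>p. expectation (\<lambda>r. dist (y i p) (y j r)))) = 4/3 * N" if i: "i \<in> I" for i
    proof -
      have [measurable]: "y j \<in> borel_measurable M" if "j \<in> I" for j using ym that by auto
      have "integrable M (\<lambda>p. expectation (\<lambda>r. dist (y i p) (y j r)))" if j: "j \<in> I" for j
      proof (rule bounded_integrable)
        show "(\<lambda>p. expectation (\<lambda>r. dist (y i p) (y j r))) \<in> borel_measurable M"
          using i j by measurable
        show "norm (expectation (\<lambda>r. dist (y i p) (y j r))) \<le> 2" if p: "p \<in> space M" for p
          unfolding real_norm_def
        proof (rule abs_expectation_le)
          fix r assume r: "r \<in> space M"
          show "\<bar>dist (y i p) (y j r)\<bar> \<le> 2"
            using dist_triangle[of "y i p" "y j r" 0] ys[OF i p] ys[OF j r] by simp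
        qed
      qed
      then have "(\<Sum>j\<in>I. expectation (\<lambda>p. expectation (\<lambda>r. dist (y i p) (y j r))))
         = expectation (\<lambda>p. \<Sum>j\<in>I. expectation (\<lambda>r. dist (y i p) (y j r)))"
        by simp
      also have "\<dots> = expectation (\<lambda>p. 4/3 * N)"
        using ys[OF i] by (intro Bochner_Integration.integral_cong refl avg)
      finally show ?thesis by (simp add: prob_space)
    qed
    then have e3: "(\<Sum>i\<in>I. \<Sum>j\<in>I. expectation (\<lambda>p. expectation (\<lambda>r. dist (y i p) (y j r)))) = 4/3 * N\<^sup>2"
      by (simp only: sum_constant cong: sum.cong) (simp add: N_def power2_eq_square)
    show ?thesis using e1 e2 e3 by (simp add: LL sum.distrib sum_subtractf)
  qed
  have "4/3 - (\<Sum>i\<in>I. \<Sum>j\<in>I. dist (x i) (x j)) / N\<^sup>2 = - (\<Sum>i\<in>I. \<Sum>j\<in>I. L i j) / N\<^sup>2"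
    unfolding SL using N by (simp add: diff_divide_distrib)
  also have "\<dots> \<le> (\<Sum>i\<in>I. \<Sum>j\<in>I. \<bar>L i j\<bar>) / N\<^sup>2"
    by (intro divide_right_mono) (auto simp: sum_negf[symmetric] intro!: sum_mono)
  also have "\<dots> \<le> (\<Sum>i\<in>I. \<Sum>j\<in>I. 6 * (m i + m j) / q i j + 110000 * \<eta> ^ 4 / q i j ^ 3) / N\<^sup>2"
    using Lb by (intro divide_right_mono sum_mono) auto
  also have "(\<Sum>i\<in>I. \<Sum>j\<in>I. 6 * (m i + m j) / q i j + 110000 * \<eta> ^ 4 / q i j ^ 3)
     = 12 * (\<Sum>i\<in>I. m i * (\<Sum>j\<in>I. 1 / q i j)) + 110000 * \<eta> ^ 4 * (\<Sum>i\<in>I. \<Sum>j\<in>I. 1 / q i j ^ 3)"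
  proof -
    \<comment> \<open>By symmetry of \<open>q\<close> both centroid errors can be charged to the
      first index, whence \<open>12 = 6 + 6\<close>.\<close>
    have "(\<Sum>i\<in>I. \<Sum>j\<in>I. m j / q i j) = (\<Sum>i\<in>I. \<Sum>j\<in>I. m i / q i j)"
      by (subst sum.swap) (simp add: q_def dist_commute)
    then show ?thesis
      by (simp add: sum.distrib sum_distrib_left add_divide_distrib distrib_left)
        (simp add: sum_distrib_left[symmetric] flip: times_divide_eq_right)
  qed
  also have "\<dots> / N\<^sup>2 \<le> (12 * (\<Sum>i\<in>I. m i * (2 * N)) + 110000 * \<eta> ^ 4 * (\<Sum>i\<in>I. 4 * N / \<eta>)) / N\<^sup>2"
  proof -
    \<comment> \<open>Moving \<open>x j\<close> within its cell changes the smoothed distance at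
      most by a factor 2. So each summand is bounded by a cell average, at the cost of 2 or
      \<open>8 = 2 ^ 3\<close>, and the cell averages add up to an integral over the sphere.\<close>
    have comp: "q' \<le> 2 * q i j" "q' > 0" "q i j > 0"
      if i: "i \<in> I" and j: "j \<in> I" and p: "p \<in> space M" and q': "q' = sqrt ((dist (x i) (y j p))\<^sup>2 + \<eta>\<^sup>2)" for i j p q'
    proof -
      show "q' > 0" "q i j > 0" using \<eta> unfolding q_def q' by (auto simp: add_nonneg_pos)
      have "dist (x i) (y j p) \<le> dist (x i) (x j) + \<eta>"
        using dist_triangle[of "x i" "y j p" "x j"] near[OF j p] by (simp add: dist_norm norm_minus_commute)
      then have "(dist (x i) (y j p))\<^sup>2 \<le> (dist (x i) (x j) + \<eta>)\<^sup>2" by (intro power_mono) auto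
      also have "\<dots> \<le> 2 * (dist (x i) (x j))\<^sup>2 + 2 * \<eta>\<^sup>2"
        using zero_le_power2[of "dist (x i) (x j) - \<eta>"] by (simp add: power2_eq_square algebra_simps)
      finally have "(dist (x i) (y j p))\<^sup>2 + \<eta>\<^sup>2 \<le> 4 * ((dist (x i) (x j))\<^sup>2 + \<eta>\<^sup>2)"
        by (rule order_trans[OF add_right_mono]) (simp add: distrib_left)
      then have "q' \<le> sqrt (4 * ((dist (x i) (x j))\<^sup>2 + \<eta>\<^sup>2))"
        unfolding q' by (rule real_sqrt_le_mono)
      then show "q' \<le> 2 * q i j" unfolding q_def real_sqrt_mult by simp
    qed
    have c1: "continuous_on (sphere 0 1) (\<lambda>z. 1 / sqrt ((dist a z)\<^sup>2 + \<eta>\<^sup>2))"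
      and c3: "continuous_on (sphere 0 1) (\<lambda>z. 1 / sqrt ((dist a z)\<^sup>2 + \<eta>\<^sup>2) ^ 3)" for a :: "real^3"
      using \<eta> by (auto intro!: continuous_intros simp: add_nonneg_eq_0_iff)
    have s1: "(\<Sum>j\<in>I. 1 / q i j) \<le> 2 * N" if i: "i \<in> I" for i
    proof -
      have "1 / q i j \<le> 2 * expectation (\<lambda>p. 1 / sqrt ((dist (x i) (y j p))\<^sup>2 + \<eta>\<^sup>2))" if j: "j \<in> I" for j
      proof -
        have [measurable]: "y j \<in> borel_measurable M" using ym j by auto
        have "1 / q i j = expectation (\<lambda>p. 1 / q i j)" by (simp add: prob_space)
        also have "\<dots> \<le> expectation (\<lambda>p. 2 * (1 / sqrt ((dist (x i) (y j p))\<^sup>2 + \<eta>\<^sup>2)))"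
        proof (rule integral_mono)
          show "integrable M (\<lambda>p. 2 * (1 / sqrt ((dist (x i) (y j p))\<^sup>2 + \<eta>\<^sup>2)))"
          proof (rule bounded_integrable[where B="2 / \<eta>"])
            have "\<eta> \<le> sqrt ((dist (x i) (y j p))\<^sup>2 + \<eta>\<^sup>2)" for p
              using \<eta> by (intro real_le_rsqrt) simp
            then show "norm (2 * (1 / sqrt ((dist (x i) (y j p))\<^sup>2 + \<eta>\<^sup>2))) \<le> 2 / \<eta>" for p
              using \<eta> by (auto intro!: divide_left_mono mult_pos_pos simp: add_nonneg_pos abs_mult)
          qed measurable
          show "1 / q i j \<le> 2 * (1 / sqrt ((dist (x i) (y j p))\<^sup>2 + \<eta>\<^sup>2))" if p: "p \<in> space M" for p
            using comp[OF i j p refl] by (simp add: field_simps)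
        qed simp
        also have "\<dots> = 2 * expectation (\<lambda>p. 1 / sqrt ((dist (x i) (y j p))\<^sup>2 + \<eta>\<^sup>2))"
          by (rule integral_mult_right_zero)
        finally show ?thesis .
      qed
      then have "(\<Sum>j\<in>I. 1 / q i j) \<le> 2 * (\<Sum>j\<in>I. expectation (\<lambda>p. 1 / sqrt ((dist (x i) (y j p))\<^sup>2 + \<eta>\<^sup>2)))"
        unfolding sum_distrib_left by (rule sum_mono)
      also have "\<dots> = 2 * N * (\<integral>z. 1 / sqrt ((dist (x i) z)\<^sup>2 + \<eta>\<^sup>2) \<partial>sphere_prob)"
        using N cell[OF c1] by (simp add: N_def)
      also have "\<dots> \<le> 2 * N * 1"
        using N \<eta> x[OF i] by (intro mult_left_mono integral_inverse_sqrt_chordal) auto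
      finally show ?thesis by simp
    qed
    have s3: "(\<Sum>j\<in>I. 1 / q i j ^ 3) \<le> 4 * N / \<eta>" if i: "i \<in> I" for i
    proof -
      have "1 / q i j ^ 3 \<le> 8 * expectation (\<lambda>p. 1 / sqrt ((dist (x i) (y j p))\<^sup>2 + \<eta>\<^sup>2) ^ 3)" if j: "j \<in> I" for j
      proof -
        have [measurable]: "y j \<in> borel_measurable M" using ym j by auto
        have "1 / q i j ^ 3 = expectation (\<lambda>p. 1 / q i j ^ 3)" by (simp add: prob_space)
        also have "\<dots> \<le> expectation (\<lambda>p. 8 * (1 / sqrt ((dist (x i) (y j p))\<^sup>2 + \<eta>\<^sup>2) ^ 3))"
        proof (rule integral_mono)
          show "integrable M (\<lambda>p. 8 * (1 / sqrt ((dist (x i) (y j p))\<^sup>2 + \<eta>\<^sup>2) ^ 3))"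
          proof (rule bounded_integrable[where B="8 / \<eta> ^ 3"])
            have "\<eta> \<le> sqrt ((dist (x i) (y j p))\<^sup>2 + \<eta>\<^sup>2)" for p
              using \<eta> by (intro real_le_rsqrt) simp
            then have "\<eta> ^ 3 \<le> sqrt ((dist (x i) (y j p))\<^sup>2 + \<eta>\<^sup>2) ^ 3" for p
              using \<eta> by (intro power_mono) auto
            then show "norm (8 * (1 / sqrt ((dist (x i) (y j p))\<^sup>2 + \<eta>\<^sup>2) ^ 3)) \<le> 8 / \<eta> ^ 3" for p
              using \<eta> by (auto intro!: divide_left_mono mult_pos_pos simp: add_nonneg_pos abs_mult power_abs)
          qed measurable
          show "1 / q i j ^ 3 \<le> 8 * (1 / sqrt ((dist (x i) (y j p))\<^sup>2 + \<eta>\<^sup>2) ^ 3)" if p: "p \<in> space M" for p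
          proof -
            define q' where "q' = sqrt ((dist (x i) (y j p))\<^sup>2 + \<eta>\<^sup>2)"
            note c = comp[OF i j p q'_def]
            have "q' ^ 3 \<le> (2 * q i j) ^ 3" using c by (intro power_mono) auto
            then have "q' ^ 3 \<le> 8 * q i j ^ 3" by (simp add: power_mult_distrib)
            then show ?thesis using c unfolding q'_def[symmetric] by (simp add: field_simps)
          qed
        qed simp
        also have "\<dots> = 8 * expectation (\<lambda>p. 1 / sqrt ((dist (x i) (y j p))\<^sup>2 + \<eta>\<^sup>2) ^ 3)"
          by (rule integral_mult_right_zero)
        finally show ?thesis .
      qed
      then have "(\<Sum>j\<in>I. 1 / q i j ^ 3) \<le> 8 * (\<Sum>j\<in>I. expectation (\<lambda>p. 1 / sqrt ((dist (x i) (y j p))\<^sup>2 + \<eta>\<^sup>2) ^ 3))"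
        unfolding sum_distrib_left by (rule sum_mono)
      also have "\<dots> = 8 * N * (\<integral>z. 1 / sqrt ((dist (x i) z)\<^sup>2 + \<eta>\<^sup>2) ^ 3 \<partial>sphere_prob)"
        using N cell[OF c3] by (simp add: N_def)
      also have "\<dots> \<le> 8 * N * (1 / (2 * sqrt (\<eta>\<^sup>2)))"
        using N \<eta> x[OF i] by (intro mult_left_mono integral_inverse_sqrt_cubed_chordal) auto
      finally show ?thesis using \<eta> by simp
    qed
    show ?thesis
      using s1 s3 m \<eta> by (intro divide_right_mono add_mono mult_left_mono sum_mono) auto
  qed
  also have "\<dots> = 440000 * \<eta> ^ 3 + 24 * (\<Sum>i\<in>I. m i) / N"
  proof -
    have "\<eta> ^ 4 = \<eta> ^ 3 * \<eta>" by (simp add: eval_nat_numeral)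
    then show ?thesis
      using N \<eta> by (simp add: N_def[symmetric] sum_distrib_right[symmetric] add_divide_distrib power2_eq_square)
  qed
  finally show ?thesis by (simp add: m_def N_def)
qed

subsection \<open>Cells of equal area\<close>

definition cyl_point :: "real \<Rightarrow> real \<Rightarrow> real^3" where
  "cyl_point h \<phi> = vector [sqrt (1 - h\<^sup>2) * cos \<phi>, sqrt (1 - h\<^sup>2) * sin \<phi>, h]"

lemma continuous_on_cyl_point [continuous_intros]:
  fixes f g :: "'a::t2_space \<Rightarrow> real"
  assumes "continuous_on A f" "continuous_on A g"
  shows "continuous_on A (\<lambda>x. cyl_point (f x) (g x))"
  unfolding cyl_point_def vector_3_eq by (intro continuous_intros assms)

lemma cyl_point_in_sphere:
  assumes "h \<in> {-1..1}" shows "cyl_point h \<phi> \<in> sphere 0 1"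
proof -
  have "h\<^sup>2 \<le> 1" using assms by (simp add: abs_square_le_1 abs_le_iff)
  then have s: "(sqrt (1 - h\<^sup>2))\<^sup>2 = 1 - h\<^sup>2" by simp
  have "(norm (cyl_point h \<phi>))\<^sup>2 = (sqrt (1 - h\<^sup>2))\<^sup>2 * ((sin \<phi>)\<^sup>2 + (cos \<phi>)\<^sup>2) + h\<^sup>2"
    unfolding cyl_point_def power2_norm_eq_inner inner_vec_def sum_3
    by (simp add: algebra_simps power2_eq_square
        del: sin_cos_squared_add sin_cos_squared_add2 sin_cos_squared_add3)
  then have "(norm (cyl_point h \<phi>))\<^sup>2 = 1\<^sup>2" unfolding s by simp
  then have "norm (cyl_point h \<phi>) = 1" by (rule power2_eq_imp_eq) auto
  then show ?thesis by simp
qed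

lemma cyl_point_periodic: "cyl_point h (\<phi> + 2 * pi) = cyl_point h \<phi>"
  by (simp add: cyl_point_def)

text \<open>Substituting \<open>h = cos \<theta>\<close> absorbs the area factor
  \<open>sin \<theta>\<close>. Hence a band of half-height \<open>w\<close> has measure
  \<open>w\<close>, and one of half-height \<open>r / N\<close> splits into \<open>r\<close> cells
  of measure \<open>1 / N\<close>.\<close>

lemma integral_sphere_prob_cyl:
  fixes F :: "real^3 \<Rightarrow> real"
  assumes F: "continuous_on (sphere 0 1) F"
  shows "continuous_on {-1..1} (\<lambda>h. integral {0..2*pi} (\<lambda>\<phi>. F (cyl_point h \<phi>)))"
    and "(\<integral>z. F z \<partial>sphere_prob) = integral {-1..1} (\<lambda>h. integral {0..2*pi} (\<lambda>\<phi>. F (cyl_point h \<phi>))) / (4 * pi)"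
proof -
  define g where "g h = integral {0..2*pi} (\<lambda>\<phi>. F (cyl_point h \<phi>))" for h
  have "continuous_on ({-1..1} \<times> cbox 0 (2*pi)) (\<lambda>p. F (cyl_point (fst p) (snd p)))"
    by (rule continuous_on_compose2[OF F])
      (use cyl_point_in_sphere in \<open>auto intro!: continuous_intros simp del: mem_sphere_0\<close>)
  then have "continuous_on {-1..1} (\<lambda>h. integral (cbox 0 (2*pi)) (\<lambda>\<phi>. F (cyl_point h \<phi>)))"
    by (intro integral_continuous_on_param) (simp add: case_prod_unfold)
  then show c: "continuous_on {-1..1} (\<lambda>h. integral {0..2*pi} (\<lambda>\<phi>. F (cyl_point h \<phi>)))" by simp
  have cc: "continuous_on (cbox (0, 0) (pi, 2 * pi)) (\<lambda>p. F (sph_coord p) * sin (fst p))"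
    by (intro continuous_intros continuous_on_compose2[OF F continuous_on_sph_coord])
      (use sph_coord_in_sphere in auto)
  have "integral (cbox (0, 0) (pi, 2 * pi)) (\<lambda>p. F (sph_coord p) * sin (fst p))
      = integral (cbox 0 pi) (\<lambda>\<theta>. integral (cbox 0 (2 * pi)) (\<lambda>q. F (sph_coord (\<theta>, q)) * sin \<theta>))"
    using integral_prod_continuous[OF cc] by simp
  also have "\<dots> = integral {0..pi} (\<lambda>\<theta>. g (cos \<theta>) * sin \<theta>)"
  proof (simp only: interval_cbox[symmetric], intro Henstock_Kurzweil_Integration.integral_cong)
    fix \<theta> assume "\<theta> \<in> {0..pi}"
    then have "sqrt (1 - (cos \<theta>)\<^sup>2) = sin \<theta>"
      by (simp add: sin_squared_eq[symmetric] sin_ge_zero)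
    then have "cyl_point (cos \<theta>) q = sph_coord (\<theta>, q)" for q
      by (simp add: cyl_point_def sph_coord_def)
    then show "integral {0..2 * pi} (\<lambda>q. F (sph_coord (\<theta>, q)) * sin \<theta>) = g (cos \<theta>) * sin \<theta>"
      by (simp add: g_def)
  qed
  also have "\<dots> = integral {-1..1} g"
    using c by (intro integral_unique has_integral_cos_substitution) (simp add: g_def[abs_def])
  finally show "(\<integral>z. F z \<partial>sphere_prob) = integral {-1..1} (\<lambda>h. integral {0..2*pi} (\<lambda>\<phi>. F (cyl_point h \<phi>))) / (4 * pi)"
    by (simp add: integral_sphere_prob_coord[OF F] g_def[abs_def])
qed

section \<open>Tools for tiling: adjacent intervals, periodicity and the parameter square\<close>

lemma integral_affine_Icc:
  fixes k :: "real \<Rightarrow> real"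
  assumes m: "m > 0" and k: "continuous_on {c - m..c + m} k"
  shows "integral {-1..1} (\<lambda>t. k (c + m * t)) = integral {c - m..c + m} k / m"
proof -
  have "((\<lambda>t. m *\<^sub>R k (c + m * t)) has_integral integral {c + m * (-1)..c + m * 1} k) {-1..1}"
  proof (rule has_integral_substitution)
    show "(\<lambda>t. c + m * t) ` {-1..1} \<subseteq> {c - m..c + m}"
    proof (intro image_subsetI)
      fix t :: real assume "t \<in> {-1..1}"
      then have "m * t \<le> m * 1" "m * (-1) \<le> m * t"
        using m by (intro mult_left_mono; simp)+
      then show "c + m * t \<in> {c - m..c + m}" by auto
    qed
    show "((\<lambda>t. c + m * t) has_real_derivative m) (at t within {-1..1})" for t
      by (auto intro!: derivative_eq_intros)
  qed (use m k in auto)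
  then have "integral {-1..1} (\<lambda>t. m *\<^sub>R k (c + m * t)) = integral {c + m * (-1)..c + m * 1} k"
    by (rule integral_unique)
  then have "m * integral {-1..1} (\<lambda>t. k (c + m * t)) = integral {c - m..c + m} k"
    by simp
  then show ?thesis using m by (simp add: field_simps)
qed

lemma integral_sum_adjacent:
  fixes k :: "real \<Rightarrow> real" and a :: "nat \<Rightarrow> real"
  assumes a: "\<And>i. i < n \<Longrightarrow> a i \<le> a (Suc i)" and k: "continuous_on {a 0..a n} k"
  shows "(\<Sum>i<n. integral {a i..a (Suc i)} k) = integral {a 0..a n} k"
proof -
  have mono: "a i \<le> a j" if "i \<le> j" "j \<le> n" for i j
    using that by (induction j rule: dec_induct) (auto intro: order_trans[OF _ a])
  have "m \<le> n \<Longrightarrow> (\<Sum>i<m. integral {a i..a (Suc i)} k) = integral {a 0..a m} k" for m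
  proof (induction m)
    case (Suc m)
    have "integral {a 0..a m} k + integral {a m..a (Suc m)} k = integral {a 0..a (Suc m)} k"
      using Suc.prems mono[of 0 m] mono[of m "Suc m"] mono[of "Suc m" n]
      by (intro Henstock_Kurzweil_Integration.integral_combine integrable_continuous_real
        continuous_on_subset[OF k]) auto
    then show ?case using Suc by simp
  qed simp
  then show ?thesis by simp
qed

lemma integral_periodic_shift:
  fixes k :: "real \<Rightarrow> real"
  assumes k: "continuous_on UNIV k" and per: "\<And>x. k (x + T) = k x" and c: "0 \<le> c" "c \<le> T"
  shows "integral {-c..T - c} k = integral {0..T} k"
proof -
  have i: "k integrable_on {a..b}" for a b
    by (intro integrable_continuous_real continuous_on_subset[OF k]) auto
  have "integral {-c..T - c} k = integral {-c..0} k + integral {0..T - c} k"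
    using c i by (intro Henstock_Kurzweil_Integration.integral_combine[symmetric]) auto
  also have "integral {-c..0} k = integral {T - c..T} k"
  proof -
    have "integral {-c..0} (k \<circ> (\<lambda>x. x + T)) = integral {-c + T..0 + T} k"
      by (intro integral_shift continuous_on_subset[OF k]) auto
    moreover have "k \<circ> (\<lambda>x. x + T) = k" using per by auto
    ultimately show ?thesis by (simp add: add.commute)
  qed
  also have "integral {T - c..T} k + integral {0..T - c} k = integral {0..T} k"
    using c i by (subst add.commute, intro Henstock_Kurzweil_Integration.integral_combine) auto
  finally show ?thesis .
qed

text \<open>One parameter space serves all cells, since \<open>energy_upper\<close> takes the random
  points of the cells as functions on a common probability space.\<close>

definition square_prob :: "(real \<times> real) measure" where
  "square_prob = uniform_measure (restrict_space lborel (cbox (-1, -1) (1, 1))) (cbox (-1, -1) (1, 1))"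

lemma space_square_prob [simp]: "space square_prob = cbox (-1, -1) (1, 1)"
  by (simp add: square_prob_def space_restrict_space)

lemma emeasure_square:
  "emeasure (restrict_space lborel (cbox (-1, -1) (1, 1))) (cbox (-1, -1) (1, 1) :: (real \<times> real) set) = 4"
proof -
  have "emeasure lborel (cbox (-1, -1) (1, 1) :: (real \<times> real) set) = ennreal (\<Prod>b\<in>Basis. ((1, 1) - (-1, -1) :: real \<times> real) \<bullet> b)"
    by (rule emeasure_lborel_cbox) (auto simp: Basis_prod_def)
  also have "\<dots> = 4" by (simp add: Basis_prod_def prod.union_disjoint)
  finally show ?thesis by (simp add: emeasure_restrict_space)
qed

interpretation square_prob: prob_space square_prob
  unfolding square_prob_def by (rule prob_space_uniform_measure) (simp_all add: emeasure_square)

lemma continuous_on_square_measurable: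
  fixes f :: "real \<times> real \<Rightarrow> 'b::topological_space"
  shows "continuous_on (cbox (-1, -1) (1, 1)) f \<Longrightarrow> f \<in> borel_measurable square_prob"
  unfolding square_prob_def using borel_measurable_continuous_on_restrict[of "cbox (-1, -1) (1, 1)" f]
  by (simp cong: measurable_cong_sets add: sets_restrict_space_cong[OF sets_lborel])

lemma integral_square_prob:
  fixes f :: "real \<times> real \<Rightarrow> real"
  assumes f: "continuous_on (cbox (-1, -1) (1, 1)) f"
  shows "(\<integral>p. f p \<partial>square_prob) = integral {-1..1} (\<lambda>s. integral {-1..1} (\<lambda>t. f (s, t))) / 4"
proof -
  let ?S = "cbox (-1, -1) (1, 1) :: (real \<times> real) set"
  let ?R = "restrict_space lborel ?S"
  have fm: "f \<in> borel_measurable ?R"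
    using borel_measurable_continuous_on_restrict[OF f]
    by (simp cong: measurable_cong_sets add: sets_restrict_space_cong[OF sets_lborel])
  have im: "(\<lambda>x. indicator ?S x / 4 :: real) \<in> borel_measurable ?R"
    by (intro borel_measurable_divide borel_measurable_indicator borel_measurable_const) (auto simp: sets_restrict_space)
  have "square_prob = density ?R (\<lambda>x. ennreal (indicator ?S x / 4))"
    unfolding square_prob_def uniform_measure_def emeasure_square
    by (intro arg_cong2[where f=density] refl ext)
      (auto simp: indicator_def divide_ennreal[of 1 4, simplified])
  then have "(\<integral>p. f p \<partial>square_prob) = (\<integral>p. f p \<partial>density ?R (\<lambda>x. ennreal (indicator ?S x / 4)))"
    by simp
  also have "\<dots> = (\<integral>p. (indicator ?S p / 4) *\<^sub>R f p \<partial>?R)"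
    by (intro integral_density fm im) auto
  also have "\<dots> = (\<integral>p. f p / 4 \<partial>?R)"
    by (intro Bochner_Integration.integral_cong) (auto simp: space_restrict_space)
  also have "\<dots> = (LINT p:?S|lborel. f p / 4)"
    by (subst integral_restrict_space) (auto simp: set_lebesgue_integral_def)
  also have "\<dots> = integral ?S (\<lambda>p. f p / 4)"
    by (intro set_borel_integral_eq_integral(2), unfold set_integrable_def,
      intro borel_integrable_compact compact_cbox continuous_intros f) auto
  also have "\<dots> = integral ?S f / 4" by simp
  also have "integral ?S f = integral {-1..1} (\<lambda>s. integral {-1..1} (\<lambda>t. f (s, t)))"
    using integral_prod_continuous[OF f] by simp
  finally show ?thesis .
qed

section \<open>Cells of a ring: tiling, diameter and centroid\<close>

lemma cos_sin_linear_error: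
  fixes \<phi> \<delta> :: real
  shows "\<bar>cos (\<phi> + \<delta>) - cos \<phi> + \<delta> * sin \<phi>\<bar> \<le> \<delta>\<^sup>2"
    and "\<bar>sin (\<phi> + \<delta>) - sin \<phi> - \<delta> * cos \<phi>\<bar> \<le> \<delta>\<^sup>2"
proof -
  have s: "\<bar>sin \<delta> - \<delta>\<bar> \<le> \<delta>\<^sup>2 / 2"
    using Maclaurin_sin_bound[of \<delta> 2] by (simp add: sin_coeff_def eval_nat_numeral)
  have "\<bar>sin (\<delta> / 2)\<bar>\<^sup>2 \<le> \<bar>\<delta> / 2\<bar>\<^sup>2"
    by (intro power_mono abs_sin_x_le_abs_x) auto
  moreover have "cos \<delta> = 1 - 2 * (sin (\<delta> / 2))\<^sup>2"
    using cos_double_sin[of "\<delta> / 2"] by simp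
  ultimately have c: "\<bar>cos \<delta> - 1\<bar> \<le> \<delta>\<^sup>2 / 2"
    by (simp add: power_divide)
  have b: "\<bar>x * (cos \<delta> - 1) - y * (sin \<delta> - \<delta>)\<bar> \<le> \<delta>\<^sup>2" if "\<bar>x\<bar> \<le> 1" "\<bar>y\<bar> \<le> 1" for x y
  proof -
    have "\<bar>x * (cos \<delta> - 1)\<bar> \<le> 1 * (\<delta>\<^sup>2 / 2)" "\<bar>y * (sin \<delta> - \<delta>)\<bar> \<le> 1 * (\<delta>\<^sup>2 / 2)"
      unfolding abs_mult by (intro mult_mono that s c; simp)+
    then have "\<bar>x * (cos \<delta> - 1) - y * (sin \<delta> - \<delta>)\<bar> \<le> \<delta>\<^sup>2 / 2 + \<delta>\<^sup>2 / 2"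
      by (intro order_trans[OF abs_triangle_ineq4] add_mono) auto
    then show ?thesis by simp
  qed
  have "cos (\<phi> + \<delta>) - cos \<phi> + \<delta> * sin \<phi> = cos \<phi> * (cos \<delta> - 1) - sin \<phi> * (sin \<delta> - \<delta>)"
    by (simp add: cos_add algebra_simps)
  then show "\<bar>cos (\<phi> + \<delta>) - cos \<phi> + \<delta> * sin \<phi>\<bar> \<le> \<delta>\<^sup>2"
    using b[of "cos \<phi>" "sin \<phi>"] by simp
  have "sin (\<phi> + \<delta>) - sin \<phi> - \<delta> * cos \<phi> = sin \<phi> * (cos \<delta> - 1) - (- cos \<phi>) * (sin \<delta> - \<delta>)"
    by (simp add: sin_add algebra_simps)
  then show "\<bar>sin (\<phi> + \<delta>) - sin \<phi> - \<delta> * cos \<phi>\<bar> \<le> \<delta>\<^sup>2"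
    using b[of "sin \<phi>" "- cos \<phi>"] by simp
qed

lemma abs_cos_sin_diff_le:
  fixes \<phi> \<delta> :: real
  shows "\<bar>cos (\<phi> + \<delta>) - cos \<phi>\<bar> \<le> \<bar>\<delta>\<bar>" and "\<bar>sin (\<phi> + \<delta>) - sin \<phi>\<bar> \<le> \<bar>\<delta>\<bar>"
proof -
  have *: "\<bar>2 * (x * sin (\<delta> / 2))\<bar> \<le> \<bar>\<delta>\<bar>" if "\<bar>x\<bar> \<le> 1" for x
  proof -
    have "\<bar>x\<bar> * \<bar>sin (\<delta> / 2)\<bar> \<le> 1 * \<bar>\<delta> / 2\<bar>"
      by (intro mult_mono that abs_sin_x_le_abs_x) auto
    then show ?thesis by (simp add: abs_mult)
  qed
  have "cos (\<phi> + \<delta>) - cos \<phi> = - (2 * (sin (\<phi> + \<delta> / 2) * sin (\<delta> / 2)))"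
    using cos_diff_cos[of "\<phi> + \<delta>" \<phi>] by (simp add: sin_diff_sin minus_diff_commute add_divide_distrib
      diff_divide_distrib minus_divide_left[symmetric] algebra_simps)
  then show "\<bar>cos (\<phi> + \<delta>) - cos \<phi>\<bar> \<le> \<bar>\<delta>\<bar>" using *[of "sin (\<phi> + \<delta> / 2)"] by simp
  have "sin (\<phi> + \<delta>) - sin \<phi> = 2 * (cos (\<phi> + \<delta> / 2) * sin (\<delta> / 2))"
    using sin_diff_sin[of "\<phi> + \<delta>" \<phi>] by (simp add: add_divide_distrib algebra_simps)
  then show "\<bar>sin (\<phi> + \<delta>) - sin \<phi>\<bar> \<le> \<bar>\<delta>\<bar>" using *[of "cos (\<phi> + \<delta> / 2)"] by simp
qed

text \<open>
  Uniformly distributed parameters in the square give uniformly distributed points of the cell, because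
  the area element in the coordinates \<open>(h, \<phi>)\<close> is constant.
\<close>
definition ring_cell :: "real \<Rightarrow> real \<Rightarrow> nat \<Rightarrow> nat \<Rightarrow> real \<times> real \<Rightarrow> real^3" where
  "ring_cell h w r l p = cyl_point (h + w * fst p) (2 * pi * real l / real r + pi / real r * snd p)"

lemma continuous_on_ring_cell: "continuous_on A (ring_cell h w r l)"
  unfolding ring_cell_def[abs_def] by (intro continuous_intros)

text \<open>The cells are centred at the directions of their points, so together they cover the full
  turn from \<open>- \<alpha>\<close> to \<open>2 * pi - \<alpha>\<close>, not the one from 0;
  periodicity of the longitude repairs this.\<close>

lemma sum_ring_cell_integral:
  fixes F :: "real^3 \<Rightarrow> real"
  assumes F: "continuous_on (sphere 0 1) F" and w: "w > 0" and r: "r > 0"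
    and band: "{h - w..h + w} \<subseteq> {-1..1}"
  shows "(\<Sum>l<r. \<integral>p. F (ring_cell h w r l p) \<partial>square_prob)
    = real r / (4 * pi * w) * integral {h - w..h + w} (\<lambda>h. integral {0..2*pi} (\<lambda>\<phi>. F (cyl_point h \<phi>)))"
proof -
  define \<alpha> where "\<alpha> = pi / real r"
  have \<alpha>: "\<alpha> > 0" "2 * pi = 2 * real r * \<alpha>" using r by (auto simp: \<alpha>_def)
  define g where "g h = integral {0..2*pi} (\<lambda>\<phi>. F (cyl_point h \<phi>))" for h
  have cg: "continuous_on {-1..1} g"
    unfolding g_def[abs_def] by (rule integral_sphere_prob_cyl(1)[OF F])
  have inb: "h + w * s \<in> {-1..1}" if "s \<in> {-1..1}" for s
  proof -
    have "w * s \<le> w * 1" "w * (-1) \<le> w * s"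
      using that w by (intro mult_left_mono; simp)+
    then have "h + w * s \<in> {h - w..h + w}" by auto
    then show ?thesis using band by blast
  qed
  have cF: "continuous_on A (\<lambda>p. F (cyl_point (h + w * fst p) (c p)))"
    if "continuous_on A c" "fst ` A \<subseteq> {-1..1}" for c :: "real \<times> real \<Rightarrow> real" and A
  proof (rule continuous_on_compose2[OF F])
    show "continuous_on A (\<lambda>p. cyl_point (h + w * fst p) (c p))"
      by (intro continuous_intros that)
    show "(\<lambda>p. cyl_point (h + w * fst p) (c p)) ` A \<subseteq> sphere 0 1"
      using that(2) by (intro image_subsetI cyl_point_in_sphere inb) auto
  qed
  have cell: "(\<integral>p. F (ring_cell h w r l p) \<partial>square_prob)
     = integral {-1..1} (\<lambda>s. integral {(2 * real l - 1) * \<alpha>..(2 * real (Suc l) - 1) * \<alpha>} (\<lambda>\<phi>. F (cyl_point (h + w * s) \<phi>))) / (4 * \<alpha>)" for l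
  proof -
    have "(\<integral>p. F (ring_cell h w r l p) \<partial>square_prob)
       = integral {-1..1} (\<lambda>s. integral {-1..1} (\<lambda>t. F (ring_cell h w r l (s, t)))) / 4"
      unfolding ring_cell_def
      using r by (intro integral_square_prob cF) (auto intro!: continuous_intros simp: cbox_Pair_eq)
    also have "integral {-1..1} (\<lambda>s. integral {-1..1} (\<lambda>t. F (ring_cell h w r l (s, t))))
       = integral {-1..1} (\<lambda>s. integral {(2 * real l - 1) * \<alpha>..(2 * real (Suc l) - 1) * \<alpha>} (\<lambda>\<phi>. F (cyl_point (h + w * s) \<phi>)) / \<alpha>)"
    proof (intro Henstock_Kurzweil_Integration.integral_cong)
      fix s :: real assume s: "s \<in> {-1..1}"
      have "integral {-1..1} (\<lambda>t. F (cyl_point (h + w * s) (2 * real l * \<alpha> + \<alpha> * t)))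
        = integral {2 * real l * \<alpha> - \<alpha>..2 * real l * \<alpha> + \<alpha>} (\<lambda>\<phi>. F (cyl_point (h + w * s) \<phi>)) / \<alpha>"
        by (intro integral_affine_Icc \<alpha> continuous_on_compose2[OF F])
          (use inb[OF s] in \<open>auto intro!: continuous_intros cyl_point_in_sphere simp del: mem_sphere_0\<close>)
      then show "integral {-1..1} (\<lambda>t. F (ring_cell h w r l (s, t)))
        = integral {(2 * real l - 1) * \<alpha>..(2 * real (Suc l) - 1) * \<alpha>} (\<lambda>\<phi>. F (cyl_point (h + w * s) \<phi>)) / \<alpha>"
        by (simp add: ring_cell_def \<alpha>_def algebra_simps)
    qed
    finally show ?thesis by simp
  qed
  have "(\<Sum>l<r. \<integral>p. F (ring_cell h w r l p) \<partial>square_prob)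
     = (\<Sum>l<r. integral {-1..1} (\<lambda>s. integral {(2 * real l - 1) * \<alpha>..(2 * real (Suc l) - 1) * \<alpha>} (\<lambda>\<phi>. F (cyl_point (h + w * s) \<phi>)))) / (4 * \<alpha>)"
    unfolding cell by (simp add: sum_divide_distrib)
  also have "(\<Sum>l<r. integral {-1..1} (\<lambda>s. integral {(2 * real l - 1) * \<alpha>..(2 * real (Suc l) - 1) * \<alpha>} (\<lambda>\<phi>. F (cyl_point (h + w * s) \<phi>))))
    = integral {-1..1} (\<lambda>s. \<Sum>l<r. integral {(2 * real l - 1) * \<alpha>..(2 * real (Suc l) - 1) * \<alpha>} (\<lambda>\<phi>. F (cyl_point (h + w * s) \<phi>)))"
  proof (rule Henstock_Kurzweil_Integration.integral_sum[symmetric])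
    fix l
    have "continuous_on ({-1..1} \<times> cbox ((2 * real l - 1) * \<alpha>) ((2 * real (Suc l) - 1) * \<alpha>)) (\<lambda>p. F (cyl_point (h + w * fst p) (snd p)))"
      by (rule cF) (auto intro!: continuous_intros)
    then have "continuous_on {-1..1} (\<lambda>s. integral (cbox ((2 * real l - 1) * \<alpha>) ((2 * real (Suc l) - 1) * \<alpha>)) (\<lambda>\<phi>. F (cyl_point (h + w * s) \<phi>)))"
      by (intro integral_continuous_on_param) (simp add: case_prod_unfold)
    then show "(\<lambda>s. integral {(2 * real l - 1) * \<alpha>..(2 * real (Suc l) - 1) * \<alpha>} (\<lambda>\<phi>. F (cyl_point (h + w * s) \<phi>))) integrable_on {-1..1}"
      by (intro integrable_continuous_real) simp
  qed simp
  also have "\<dots> = integral {-1..1} (\<lambda>s. g (h + w * s))"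
  proof (intro Henstock_Kurzweil_Integration.integral_cong)
    fix s :: real assume s: "s \<in> {-1..1}"
    define k where "k \<phi> = F (cyl_point (h + w * s) \<phi>)" for \<phi>
    have ck: "continuous_on A k" for A
      unfolding k_def[abs_def] by (intro continuous_on_compose2[OF F])
        (use inb[OF s] in \<open>auto intro!: continuous_intros cyl_point_in_sphere simp del: mem_sphere_0\<close>)
    have "(\<Sum>l<r. integral {(2 * real l - 1) * \<alpha>..(2 * real (Suc l) - 1) * \<alpha>} k)
      = integral {(2 * real 0 - 1) * \<alpha>..(2 * real r - 1) * \<alpha>} k"
      using \<alpha> by (intro integral_sum_adjacent ck) (auto simp: algebra_simps)
    also have "\<dots> = integral {- \<alpha>..2 * pi - \<alpha>} k"
      unfolding \<alpha>(2) by (simp add: algebra_simps)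
    also have "\<dots> = integral {0..2 * pi} k"
    proof (rule integral_periodic_shift[OF ck])
      show "k (x + 2 * pi) = k x" for x by (simp add: k_def cyl_point_periodic)
      show "0 \<le> \<alpha>" using \<alpha> by simp
      have "1 * \<alpha> \<le> (2 * real r) * \<alpha>" using r \<alpha> by (intro mult_right_mono) auto
      then show "\<alpha> \<le> 2 * pi" using \<alpha>(2) by simp
    qed
    finally show "(\<Sum>l<r. integral {(2 * real l - 1) * \<alpha>..(2 * real (Suc l) - 1) * \<alpha>} (\<lambda>\<phi>. F (cyl_point (h + w * s) \<phi>))) = g (h + w * s)"
      by (simp add: k_def[abs_def] g_def)
  qed
  also have "\<dots> = integral {h - w..h + w} g / w"
    by (intro integral_affine_Icc w continuous_on_subset[OF cg] band)
  finally show ?thesis by (simp add: g_def[abs_def] \<alpha>_def mult_ac)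
qed

lemma norm_vec3_le:
  fixes x :: "real^3"
  assumes "\<bar>x$1\<bar> \<le> a" "\<bar>x$2\<bar> \<le> b" "\<bar>x$3\<bar> \<le> c"
  shows "norm x \<le> a + b + c"
  using norm_le_l1_cart[of x] assms by (simp add: sum_3)

text \<open>The assumptions \<open>up\<close> and \<open>lo\<close> make \<open>r\<close> comparable
  to \<open>sqrt n\<close> times the radius, so that a cell is roughly a square of side
  \<open>1 / sqrt n\<close>. \<open>lo\<close> concerns every parallel of the band, because the
  width of the cell is needed at each of them. The vectors in the second bound are the partial
  derivatives of \<open>ring_cell\<close> at the centre of the square; their contribution has mean
  zero, so the remainder controls the centroid.\<close>

lemma ring_cell_estimates:
  fixes h \<rho> w n :: real and r l :: nat
  assumes n: "n > 0" and r: "r > 0" and w: "w = real r / n" and \<rho>: "\<rho> = sqrt (1 - h\<^sup>2)"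
    and band: "{h - w..h + w} \<subseteq> {-1..1}"
    and up: "real r \<le> 8 * sqrt n * \<rho>"
    and lo: "\<And>k. k \<in> {h - w..h + w} \<Longrightarrow> sqrt (1 - k\<^sup>2) \<le> real r / sqrt n"
    and p: "p \<in> cbox (-1, -1) (1, 1)"
  defines "\<phi> \<equiv> 2 * pi * real l / real r"
  shows "norm (ring_cell h w r l p - cyl_point h \<phi>) \<le> 48 / sqrt n"
    and "norm (ring_cell h w r l p - cyl_point h \<phi>
       - fst p *\<^sub>R vector [- (h * w / \<rho>) * cos \<phi>, - (h * w / \<rho>) * sin \<phi>, w]
       - snd p *\<^sub>R vector [- (\<rho> * (pi / real r)) * sin \<phi>, \<rho> * (pi / real r) * cos \<phi>, 0]) \<le> 480 / (n * \<rho>)"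
proof -
  define S where "S = sqrt n"
  have S: "S > 0" "n = S * S" using n by (auto simp: S_def)
  obtain s t where p': "p = (s, t)" by (cases p)
  have st: "\<bar>s\<bar> \<le> 1" "\<bar>t\<bar> \<le> 1" using p by (auto simp: p' cbox_Pair_eq abs_le_iff)
  have w0: "w > 0" using n r w by simp
  have "S * \<rho> > 0" using up r unfolding S_def[symmetric] by (simp add: mult.assoc)
  then have \<rho>0: "\<rho> > 0" using S by (simp add: zero_less_mult_iff)
  have \<rho>2: "\<rho> * \<rho> = 1 - h\<^sup>2"
  proof -
    have "0 < 1 - h\<^sup>2" using \<rho>0 \<rho> by simp
    then show ?thesis unfolding \<rho> by simp
  qed
  have \<rho>1: "\<rho> \<le> 1" unfolding \<rho> by simp
  have \<rho>r: "\<rho> \<le> real r / S"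
    using lo[of h] w0 unfolding \<rho> S_def by auto
  define k where "k = h + w * s"
  have ws: "\<bar>w * s\<bar> \<le> w" using st w0 by (simp add: abs_mult mult_left_le)
  have kb: "k \<in> {h - w..h + w}" using ws unfolding k_def abs_le_iff by auto
  then have k1: "\<bar>k\<bar> \<le> 1" using band by (auto simp: abs_le_iff)
  have h1: "\<bar>h\<bar> \<le> 1" using band w0 by (auto simp: abs_le_iff)
  define \<rho>' where "\<rho>' = sqrt (1 - k\<^sup>2)"
  have \<rho>'0: "\<rho>' \<ge> 0" and \<rho>'2: "\<rho>' * \<rho>' = 1 - k\<^sup>2"
    using k1 by (auto simp: \<rho>'_def abs_square_le_1)
  have \<rho>'r: "\<rho>' \<le> real r / S" using lo[OF kb] unfolding \<rho>'_def S_def .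
  have w8: "w \<le> 8 * \<rho> / S"
    using up S unfolding w S_def[symmetric] by (simp add: field_simps)
  have "8 * \<rho> / S \<le> 8 / S" using \<rho>1 S by (intro divide_right_mono) auto
  then have w8': "w \<le> 8 / S" using w8 by linarith
  have dr: "\<bar>\<rho>' - \<rho>\<bar> \<le> 16 / S"
  proof -
    \<comment> \<open>Multiplying by the sum of the radii gives a difference of squares, which is
      polynomial in the heights. Only \<open>\<rho>\<close> is divided by; \<open>\<rho>'\<close>
      may vanish, since a band can touch the pole.\<close>
    have "\<bar>\<rho>' - \<rho>\<bar> * \<rho> \<le> \<bar>\<rho>' - \<rho>\<bar> * (\<rho>' + \<rho>)" using \<rho>'0 by (intro mult_left_mono) auto
    also have "\<dots> = \<bar>(\<rho>' - \<rho>) * (\<rho>' + \<rho>)\<bar>" using \<rho>'0 \<rho>0 by (simp add: abs_mult)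
    also have "(\<rho>' - \<rho>) * (\<rho>' + \<rho>) = - (w * s) * (h + k)"
      using \<rho>2 \<rho>'2 by (simp add: k_def power2_eq_square algebra_simps)
    also have "\<bar>- (w * s) * (h + k)\<bar> \<le> w * 2"
      unfolding abs_mult abs_minus_cancel
      using ws k1 h1 w0 by (intro mult_mono) (auto simp: abs_mult)
    also have "\<dots> \<le> (16 / S) * \<rho>" using w8 by simp
    finally show ?thesis using \<rho>0 by (rule mult_right_le_imp_le)
  qed
  define \<delta> where "\<delta> = pi / real r * t"
  have \<delta>: "\<bar>\<delta>\<bar> \<le> 4 / real r"
  proof -
    have "\<bar>\<delta>\<bar> \<le> pi / real r * 1" unfolding \<delta>_def abs_mult using st r by (intro mult_mono) auto
    also have "\<dots> \<le> 4 / real r" using pi_less_4 r by (simp add: divide_right_mono)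
    finally show ?thesis .
  qed
  have ir: "1 / real r \<le> 1 / (S * \<rho>)"
  proof (rule divide_left_mono)
    show "S * \<rho> \<le> real r" using \<rho>r S by (simp add: field_simps)
  qed (use S \<rho>0 r in auto)
  define x where "x = cyl_point h \<phi>"
  define y where "y = ring_cell h w r l p"
  have x: "x$1 = \<rho> * cos \<phi>" "x$2 = \<rho> * sin \<phi>" "x$3 = h"
    unfolding x_def cyl_point_def \<rho> by simp_all
  have y: "y$1 = \<rho>' * cos (\<phi> + \<delta>)" "y$2 = \<rho>' * sin (\<phi> + \<delta>)" "y$3 = k"
    unfolding y_def ring_cell_def cyl_point_def p' \<rho>'_def k_def \<delta>_def \<phi>_def by simp_all
  have \<rho>'\<delta>: "\<rho>' * \<bar>\<delta>\<bar> \<le> 4 / S"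
  proof -
    have "\<rho>' * \<bar>\<delta>\<bar> \<le> (real r / S) * (4 / real r)"
      using \<rho>'r \<delta> S by (intro mult_mono) auto
    then show ?thesis using r by simp
  qed
  have first: "\<bar>\<rho>' * c' - \<rho> * c\<bar> \<le> 20 / S" if "\<bar>c' - c\<bar> \<le> \<bar>\<delta>\<bar>" "\<bar>c\<bar> \<le> 1" for c c'
  proof -
    have "\<rho>' * c' - \<rho> * c = \<rho>' * (c' - c) + (\<rho>' - \<rho>) * c" by (simp add: algebra_simps)
    moreover have "\<bar>\<rho>' * (c' - c)\<bar> \<le> \<rho>' * \<bar>\<delta>\<bar>"
      unfolding abs_mult using that \<rho>'0 by (simp add: mult_left_mono)
    moreover have "\<bar>(\<rho>' - \<rho>) * c\<bar> \<le> 16 / S * 1"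
      unfolding abs_mult using dr that S by (intro mult_mono) auto
    ultimately have "\<bar>\<rho>' * c' - \<rho> * c\<bar> \<le> 4 / S + 16 / S" using \<rho>'\<delta> by linarith
    then show ?thesis by (simp add: add_divide_distrib[symmetric])
  qed
  have "norm (y - x) \<le> 20 / S + 20 / S + 8 / S"
  proof (rule norm_vec3_le)
    show "\<bar>(y - x)$1\<bar> \<le> 20 / S" "\<bar>(y - x)$2\<bar> \<le> 20 / S"
      by (simp_all add: x y first abs_cos_sin_diff_le)
    show "\<bar>(y - x)$3\<bar> \<le> 8 / S" using ws w8' by (simp add: x y k_def)
  qed
  then show "norm (ring_cell h w r l p - cyl_point h \<phi>) \<le> 48 / sqrt n"
    by (simp add: x_def y_def S_def add_divide_distrib[symmetric])
  define K where "K = 1 / (S * S * \<rho>)"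
  have e1: "\<bar>\<rho>' - \<rho>\<bar> * \<bar>\<delta>\<bar> \<le> 64 * K"
  proof -
    have "\<bar>\<rho>' - \<rho>\<bar> * \<bar>\<delta>\<bar> \<le> (16 / S) * (4 * (1 / real r))" using dr \<delta> S by (intro mult_mono) auto
    also have "\<dots> \<le> (16 / S) * (4 * (1 / (S * \<rho>)))" using ir S by (intro mult_left_mono) auto
    finally show ?thesis by (simp add: K_def mult.assoc)
  qed
  have e2: "\<rho> * \<delta>\<^sup>2 \<le> 16 * K"
  proof -
    have "\<bar>\<delta>\<bar> \<le> 4 * (1 / (S * \<rho>))" using \<delta> ir by simp
    then have "\<bar>\<delta>\<bar>\<^sup>2 \<le> (4 * (1 / (S * \<rho>)))\<^sup>2" by (intro power_mono) auto
    then have "\<rho> * \<delta>\<^sup>2 \<le> \<rho> * (4 * (1 / (S * \<rho>)))\<^sup>2" using \<rho>0 by (simp add: mult_left_mono)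
    also have "\<dots> = 16 * K" using \<rho>0 S by (simp add: K_def power2_eq_square field_simps)
    finally show ?thesis .
  qed
  have e3: "\<bar>\<rho>' - \<rho> + h * w / \<rho> * s\<bar> \<le> 160 * K"
  proof -
    have "(\<rho>' - \<rho>)\<^sup>2 \<le> (16 / S)\<^sup>2" using power_mono[OF dr, of 2] by simp
    moreover have "(w * s)\<^sup>2 \<le> (8 / S)\<^sup>2" using power_mono[of "\<bar>w * s\<bar>" "8 / S" 2] ws w8' by simp
    ultimately have "(w * s)\<^sup>2 + (\<rho>' - \<rho>)\<^sup>2 \<le> 320 / (S * S)"
      using S by (simp add: power2_eq_square field_simps)
    then have "((w * s)\<^sup>2 + (\<rho>' - \<rho>)\<^sup>2) / (2 * \<rho>) \<le> (320 / (S * S)) / (2 * \<rho>)"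
      using \<rho>0 by (intro divide_right_mono) auto
    \<comment> \<open>An exact identity from \<open>\<rho>^2 + h^2 = \<rho>'^2 + k^2\<close>
      replaces a Taylor expansion of the radius, whose derivatives blow up at the pole. With
      \<open>8^2 + 16^2 = 320\<close> it gives the constant 160.\<close>
    moreover have "\<rho>' - \<rho> + h * w / \<rho> * s = - (((w * s)\<^sup>2 + (\<rho>' - \<rho>)\<^sup>2) / (2 * \<rho>))"
    proof -
      have *: "2 * \<rho> * (\<rho>' - \<rho>) + 2 * h * w * s = - ((w * s)\<^sup>2 + (\<rho>' - \<rho>)\<^sup>2)"
        using \<rho>2 \<rho>'2 by (simp add: k_def power2_eq_square algebra_simps)
      have "\<rho>' - \<rho> + h * w / \<rho> * s = (2 * \<rho> * (\<rho>' - \<rho>) + 2 * h * w * s) / (2 * \<rho>)"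
        using \<rho>0 by (simp add: field_simps)
      then show ?thesis unfolding * by (simp only: minus_divide_left)
    qed
    moreover have "0 \<le> ((w * s)\<^sup>2 + (\<rho>' - \<rho>)\<^sup>2) / (2 * \<rho>)" using \<rho>0 by simp
    ultimately have "\<bar>\<rho>' - \<rho> + h * w / \<rho> * s\<bar> \<le> (320 / (S * S)) / (2 * \<rho>)"
      by (simp only: abs_minus_cancel abs_of_nonneg)
    then show ?thesis by (simp add: K_def)
  qed
  have second: "\<bar>\<rho>' * c' - \<rho> * c - s * (- (h * w / \<rho>) * c) - \<rho> * (\<delta> * b)\<bar> \<le> 240 * K"
    if "\<bar>c' - c\<bar> \<le> \<bar>\<delta>\<bar>" "\<bar>c\<bar> \<le> 1" "\<bar>c' - c - \<delta> * b\<bar> \<le> \<delta>\<^sup>2" for c c' b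
  proof -
    have eq: "\<rho>' * c' - \<rho> * c - s * (- (h * w / \<rho>) * c) - \<rho> * (\<delta> * b)
      = (\<rho>' - \<rho>) * (c' - c) + \<rho> * (c' - c - \<delta> * b) + (\<rho>' - \<rho> + h * w / \<rho> * s) * c"
      by (simp add: algebra_simps)
    have "\<bar>(\<rho>' - \<rho>) * (c' - c)\<bar> \<le> \<bar>\<rho>' - \<rho>\<bar> * \<bar>\<delta>\<bar>"
      unfolding abs_mult using that by (simp add: mult_left_mono)
    then have 1: "\<bar>(\<rho>' - \<rho>) * (c' - c)\<bar> \<le> 64 * K" using e1 by (rule order_trans)
    have "\<bar>\<rho> * (c' - c - \<delta> * b)\<bar> \<le> \<rho> * \<delta>\<^sup>2"
      unfolding abs_mult using that \<rho>0 by (simp add: mult_left_mono)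
    then have 2: "\<bar>\<rho> * (c' - c - \<delta> * b)\<bar> \<le> 16 * K" using e2 by (rule order_trans)
    have 3: "\<bar>(\<rho>' - \<rho> + h * w / \<rho> * s) * c\<bar> \<le> 160 * K * 1"
      unfolding abs_mult using e3 that by (intro mult_mono) auto
    have "\<bar>(\<rho>' - \<rho>) * (c' - c) + \<rho> * (c' - c - \<delta> * b) + (\<rho>' - \<rho> + h * w / \<rho> * s) * c\<bar>
        \<le> 64 * K + 16 * K + 160 * K * 1"
      by (intro order_trans[OF abs_triangle_ineq] add_mono 1 2 3)
    then show ?thesis unfolding eq by simp
  qed
  define a where "a = (vector [- (h * w / \<rho>) * cos \<phi>, - (h * w / \<rho>) * sin \<phi>, w] :: real^3)"
  define b where "b = (vector [- (\<rho> * (pi / real r)) * sin \<phi>, \<rho> * (pi / real r) * cos \<phi>, 0] :: real^3)"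
  have "norm (y - x - s *\<^sub>R a - t *\<^sub>R b) \<le> 240 * K + 240 * K + 0"
  proof (rule norm_vec3_le)
    have "(y - x - s *\<^sub>R a - t *\<^sub>R b)$1
       = \<rho>' * cos (\<phi> + \<delta>) - \<rho> * cos \<phi> - s * (- (h * w / \<rho>) * cos \<phi>) - \<rho> * (\<delta> * (- sin \<phi>))"
      by (simp add: x y a_def b_def \<delta>_def)
    then show "\<bar>(y - x - s *\<^sub>R a - t *\<^sub>R b)$1\<bar> \<le> 240 * K"
      using second[of "cos (\<phi> + \<delta>)" "cos \<phi>" "- sin \<phi>"] cos_sin_linear_error(1)[of \<phi> \<delta>] abs_cos_sin_diff_le(1)[of \<phi> \<delta>]
      by simp
    have "(y - x - s *\<^sub>R a - t *\<^sub>R b)$2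
       = \<rho>' * sin (\<phi> + \<delta>) - \<rho> * sin \<phi> - s * (- (h * w / \<rho>) * sin \<phi>) - \<rho> * (\<delta> * cos \<phi>)"
      by (simp add: x y a_def b_def \<delta>_def)
    then show "\<bar>(y - x - s *\<^sub>R a - t *\<^sub>R b)$2\<bar> \<le> 240 * K"
      using second[of "sin (\<phi> + \<delta>)" "sin \<phi>" "cos \<phi>"] cos_sin_linear_error(2)[of \<phi> \<delta>] abs_cos_sin_diff_le(2)[of \<phi> \<delta>]
      by simp
    show "\<bar>(y - x - s *\<^sub>R a - t *\<^sub>R b)$3\<bar> \<le> 0"
      by (simp add: x y a_def b_def k_def)
  qed
  then show "norm (ring_cell h w r l p - cyl_point h \<phi>
       - fst p *\<^sub>R vector [- (h * w / \<rho>) * cos \<phi>, - (h * w / \<rho>) * sin \<phi>, w]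
       - snd p *\<^sub>R vector [- (\<rho> * (pi / real r)) * sin \<phi>, \<rho> * (pi / real r) * cos \<phi>, 0]) \<le> 480 / (n * \<rho>)"
    unfolding a_def[symmetric] b_def[symmetric] x_def[symmetric] y_def[symmetric]
    by (simp add: p' K_def S(2))
qed

lemma square_prob_mean: "(\<integral>p. fst p \<partial>square_prob) = 0" "(\<integral>p. snd p \<partial>square_prob) = 0"
proof -
  have "integral {-1..1} (\<lambda>s::real. s) = 0" by simp
  then show "(\<integral>p. fst p \<partial>square_prob) = 0" "(\<integral>p. snd p \<partial>square_prob) = 0"
    by (simp_all add: integral_square_prob continuous_intros)
qed

text \<open>One factor of the square is bounded by the diameter, the other by the remainder after
  the mean-zero linear part: \<open>23040 = 48 * 480\<close>. Only one factor
  \<open>1 / \<rho>\<close> appears, which the number of points on the ring later cancels.\<close>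

lemma norm_ring_cell_mean_le:
  assumes "n > 0" "r > 0" "w = real r / n" "\<rho> = sqrt (1 - h\<^sup>2)" "{h - w..h + w} \<subseteq> {-1..1}"
    "real r \<le> 8 * sqrt n * \<rho>" "\<And>k. k \<in> {h - w..h + w} \<Longrightarrow> sqrt (1 - k\<^sup>2) \<le> real r / sqrt n"
  shows "(norm ((\<integral>p. ring_cell h w r l p \<partial>square_prob) - cyl_point h (2 * pi * real l / real r)))\<^sup>2
    \<le> 23040 / (n * sqrt n * \<rho>)"
proof -
  define \<phi> where "\<phi> = 2 * pi * real l / real r"
  define x where "x = cyl_point h \<phi>"
  define a where "a = (vector [- (h * w / \<rho>) * cos \<phi>, - (h * w / \<rho>) * sin \<phi>, w] :: real^3)"
  define b where "b = (vector [- (\<rho> * (pi / real r)) * sin \<phi>, \<rho> * (pi / real r) * cos \<phi>, 0] :: real^3)"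
  note est = ring_cell_estimates[OF assms, of _ l, folded \<phi>_def, folded x_def a_def b_def]
  have [measurable]: "ring_cell h w r l \<in> borel_measurable square_prob"
    by (intro continuous_on_square_measurable continuous_on_ring_cell)
  have [measurable]: "fst \<in> borel_measurable square_prob" "snd \<in> borel_measurable square_prob"
    by (auto intro!: continuous_on_square_measurable continuous_intros)
  have i1: "integrable square_prob (\<lambda>p. ring_cell h w r l p - x)"
    by (rule square_prob.bounded_integrable[where B="48 / sqrt n"]) (use est(1) in auto)
  have iy: "integrable square_prob (\<lambda>p. ring_cell h w r l p)"
    using Bochner_Integration.integrable_add[OF i1, of "\<lambda>_. x"] by simp
  have ist: "integrable square_prob fst" "integrable square_prob snd"
    by (rule square_prob.bounded_integrable[where B=1]; auto simp: cbox_Pair_eq abs_le_iff)+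
  have m: "(\<integral>p. ring_cell h w r l p \<partial>square_prob) - x = (\<integral>p. ring_cell h w r l p - x \<partial>square_prob)"
    using iy by (simp add: square_prob.prob_space[unfolded space_square_prob])
  have m2: "(\<integral>p. ring_cell h w r l p - x \<partial>square_prob)
     = (\<integral>p. ring_cell h w r l p - x - fst p *\<^sub>R a - snd p *\<^sub>R b \<partial>square_prob)"
    using i1 ist by (simp add: square_prob_mean)
  have 1: "norm ((\<integral>p. ring_cell h w r l p \<partial>square_prob) - x) \<le> 48 / sqrt n"
    unfolding m by (rule square_prob.norm_expectation_le) (use est(1) in auto)
  have 2: "norm ((\<integral>p. ring_cell h w r l p \<partial>square_prob) - x) \<le> 480 / (n * \<rho>)"
    unfolding m m2 by (rule square_prob.norm_expectation_le) (use est(2) in auto)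
  have "(norm ((\<integral>p. ring_cell h w r l p \<partial>square_prob) - x))\<^sup>2 \<le> (48 / sqrt n) * (480 / (n * \<rho>))"
    unfolding power2_eq_square using 1 2 assms(1) by (intro mult_mono) auto
  then show ?thesis by (simp add: x_def \<phi>_def mult_ac)
qed

subsection \<open>Rings of the Diamond ensemble\<close>

text \<open>The geometric hypotheses of \<open>ring_cell_estimates\<close> for \<open>r\<close>
  points at height \<open>h\<close>: the ring is neither too crowded for its own radius nor too
  sparse for any parallel of its band.\<close>

definition balanced_ring :: "real \<Rightarrow> real \<Rightarrow> real \<Rightarrow> bool" where
  "balanced_ring n h r \<longleftrightarrow> {h - r / n..h + r / n} \<subseteq> {-1..1} \<and> r \<le> 8 * sqrt n * sqrt (1 - h\<^sup>2) \<and>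
    (\<forall>k \<in> {h - r / n..h + r / n}. sqrt (1 - k\<^sup>2) \<le> r / sqrt n)"

lemma balanced_ring_uminus:
  assumes "balanced_ring n h r" shows "balanced_ring n (- h) r"
proof -
  have *: "- k \<in> {h - r / n..h + r / n}" if "k \<in> {- h - r / n..- h + r / n}" for k
    using that by auto
  have 1: "{- h - r / n..- h + r / n} \<subseteq> {-1..1}"
  proof
    fix k assume "k \<in> {- h - r / n..- h + r / n}"
    then have "- k \<in> {-1..1}" using * assms unfolding balanced_ring_def by blast
    then show "k \<in> {-1..1}" by auto
  qed
  have "sqrt (1 - k\<^sup>2) \<le> r / sqrt n" if "k \<in> {- h - r / n..- h + r / n}" for k
  proof -
    have "sqrt (1 - (- k)\<^sup>2) \<le> r / sqrt n"
      using *[OF that] assms unfolding balanced_ring_def by blast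
    then show ?thesis by simp
  qed
  then show ?thesis using 1 assms unfolding balanced_ring_def by auto
qed

text \<open>\<open>i < m\<close> gives \<open>4 * (i + 1)^2 \<le> n\<close>, which keeps the band in
  the upper hemisphere, where \<open>1 - h^2\<close> is comparable to \<open>1 - h\<close>. There
  \<open>1 - h = 4 * i^2 / n\<close>, so the radius is of order \<open>i / sqrt n\<close>. For
  \<open>i = 1\<close> the band ends exactly at the pole.\<close>

lemma balanced_ring_polar:
  fixes i m :: nat and n :: real
  assumes i: "1 \<le> i" "i < m" and m: "4 * (real m)\<^sup>2 \<le> n"
  shows "balanced_ring n (1 - 4 * (real i)\<^sup>2 / n) (4 * real i)"
proof -
  define x where "x = real i"
  have x: "1 \<le> x" "x + 1 \<le> real m" using i by (auto simp: x_def)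
  have "4 * ((x + 1) * (x + 1)) \<le> 4 * (real m * real m)" using x by (intro mult_left_mono mult_mono) auto
  also have "\<dots> \<le> n" using m by (simp add: power2_eq_square)
  finally have xn: "4 * (x + 1) * (x + 1) \<le> n" by (simp only: mult.assoc)
  have "0 < 4 * (x + 1) * (x + 1)" using x by simp
  then have n: "n > 0" using xn by linarith
  have x2: "4 * x * (x + 1) \<le> n" "4 * x * x \<le> n"
    using xn x by (simp_all add: algebra_simps)
  have xx: "x \<le> x * x" using x by simp
  have band: "{1 - 4 * x\<^sup>2 / n - 4 * x / n..1 - 4 * x\<^sup>2 / n + 4 * x / n} \<subseteq> {-1..1}"
  proof -
    have "4 * x / n \<le> 4 * x\<^sup>2 / n" using n xx by (intro divide_right_mono) (auto simp: power2_eq_square)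
    moreover have "4 * x\<^sup>2 / n + 4 * x / n \<le> 1"
      using n x2 by (simp add: add_divide_distrib[symmetric] power2_eq_square algebra_simps)
    ultimately show ?thesis by auto
  qed
  have up: "4 * x \<le> 8 * sqrt n * sqrt (1 - (1 - 4 * x\<^sup>2 / n)\<^sup>2)"
  proof -
    define t where "t = 4 * x\<^sup>2 / n"
    have t: "0 \<le> t" "t \<le> 1" using n x2 by (auto simp: t_def power2_eq_square)
    have "t * t \<le> 1 * t" using t by (intro mult_right_mono) auto
    then have "t \<le> 1 - (1 - t)\<^sup>2" by (simp add: power2_eq_square algebra_simps)
    then have "sqrt n * sqrt t \<le> sqrt n * sqrt (1 - (1 - t)\<^sup>2)"
      using n by (intro mult_left_mono real_sqrt_le_mono) auto
    moreover have "sqrt n * sqrt t = 2 * x"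
      using n x by (simp add: real_sqrt_mult[symmetric] t_def del: real_sqrt_mult) (simp add: real_sqrt_mult)
    ultimately show ?thesis using x unfolding t_def by (simp add: mult.assoc)
  qed
  have lo: "sqrt (1 - k\<^sup>2) \<le> 4 * x / sqrt n" if k: "k \<in> {1 - 4 * x\<^sup>2 / n - 4 * x / n..1 - 4 * x\<^sup>2 / n + 4 * x / n}" for k
  proof -
    have k1: "-1 \<le> k" "k \<le> 1" using k band by auto
    have "(1 - k) * (1 + k) \<le> (1 - k) * 2" using k1 by (intro mult_left_mono) auto
    also have "1 - k \<le> 4 * x\<^sup>2 / n + 4 * x / n" using k by simp
    also have "\<dots> \<le> 8 * x\<^sup>2 / n"
      using n xx by (simp add: add_divide_distrib[symmetric] power2_eq_square divide_right_mono)
    finally have "1 - k\<^sup>2 \<le> (8 * x\<^sup>2 / n) * 2" by (simp add: power2_eq_square algebra_simps)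
    also have "\<dots> = (4 * x / sqrt n)\<^sup>2" using n by (simp add: power_divide power_mult_distrib)
    finally show ?thesis using x n by (intro real_le_lsqrt) auto
  qed
  show ?thesis unfolding balanced_ring_def x_def[symmetric] using band up lo by blast
qed

lemma sum_four_times: "(\<Sum>k=1..<m. 4 * real k) = 2 * real m * (real m - 1)"
proof (induction m)
  case (Suc m)
  then show ?case by (cases m) (simp_all add: algebra_simps)
qed simp

context
  fixes N :: nat
  assumes N: "N \<ge> 4"
begin

lemma diamond_M_ge_1: "diamond_M N \<ge> 1"
proof -
  have "1 \<le> sqrt (real N / 4)" using N by simp
  then have "1 \<le> \<lfloor>sqrt (real N / 4)\<rfloor>" by (simp add: le_floor_iff)
  then show ?thesis unfolding diamond_M_def by linarith
qed

lemma diamond_M_upper: "real N < 4 * (real (diamond_M N) + 1)\<^sup>2"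
proof -
  have "sqrt (real N / 4) < real_of_int (\<lfloor>sqrt (real N / 4)\<rfloor>) + 1" by linarith
  also have "\<dots> = real (diamond_M N) + 1" unfolding diamond_M_def by simp
  finally have "(sqrt (real N / 4))\<^sup>2 < (real (diamond_M N) + 1)\<^sup>2"
    by (intro power_strict_mono) auto
  then show ?thesis by simp
qed

lemma diamond_M_lower: "4 * (real (diamond_M N))\<^sup>2 \<le> real N"
  using diamond_M_square[of N] by (metis of_nat_le_iff of_nat_mult of_nat_numeral of_nat_power)

lemma real_diamond_r_middle: "real (diamond_r N (diamond_M N)) = real N - 4 * real (diamond_M N) * (real (diamond_M N) - 1)"
proof -
  have "real (diamond_r N (diamond_M N)) = real N - real (2 * (\<Sum>k=1..<diamond_M N. 4 * k))"
    unfolding diamond_r_def Let_def using sum_diamond_r(1)[OF N] by (simp add: of_nat_diff)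
  also have "real (2 * (\<Sum>k=1..<diamond_M N. 4 * k)) = 2 * (\<Sum>k=1..<diamond_M N. 4 * real k)" by simp
  finally show ?thesis unfolding sum_four_times by simp
qed

lemma diamond_h_lower: 
  assumes "1 \<le> j" "j < diamond_M N"
  shows "diamond_h N j = 1 - 4 * (real j)\<^sup>2 / real N"
proof -
  have s: "(\<Sum>k=1..<j. real (diamond_r N k)) = (\<Sum>k=1..<j. 4 * real k)"
    using assms by (intro sum.cong) (auto simp: diamond_r_def)
  have "diamond_r N j = 4 * j" using assms by (simp add: diamond_r_def)
  then show ?thesis
    using N unfolding diamond_h_def s sum_four_times by (simp add: field_simps power2_eq_square)
qed

lemma diamond_h_middle: "diamond_h N (diamond_M N) = 0"
proof -
  have s: "(\<Sum>k=1..<diamond_M N. real (diamond_r N k)) = (\<Sum>k=1..<diamond_M N. 4 * real k)"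
    by (intro sum.cong) (auto simp: diamond_r_def)
  show ?thesis
    using N unfolding diamond_h_def s sum_four_times real_diamond_r_middle by (simp add: field_simps)
qed

text \<open>Heights are defined by counting points from the north pole. To see the reflection, the
  count above ring \<open>j\<close> is written as \<open>N\<close> minus the tail, and the tail is
  again a sum of \<open>4 * k\<close>, now counted from the south pole.\<close>

lemma diamond_h_upper:
  assumes "diamond_M N < j" "j \<le> 2 * diamond_M N - 1"
  shows "diamond_h N j = - (1 - 4 * (real (2 * diamond_M N - j))\<^sup>2 / real N)"
proof -
  define M where "M = diamond_M N"
  define i where "i = 2 * M - j"
  have j: "M < j" "j \<le> 2 * M - 1" using assms by (auto simp: M_def)
  have "{1..2 * M - 1} = {1..<j} \<union> {j..2 * M - 1}" using j by auto
  moreover have "(\<Sum>k\<in>{1..<j} \<union> {j..2 * M - 1}. real (diamond_r N k))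
      = (\<Sum>k=1..<j. real (diamond_r N k)) + (\<Sum>k=j..2 * M - 1. real (diamond_r N k))"
    by (rule sum.union_disjoint) auto
  ultimately have "real (\<Sum>k=1..2 * M - 1. diamond_r N k)
      = (\<Sum>k=1..<j. real (diamond_r N k)) + (\<Sum>k=j..2 * M - 1. real (diamond_r N k))"
    by (simp only: of_nat_sum)
  moreover have "(\<Sum>k=j..2 * M - 1. real (diamond_r N k)) = (\<Sum>k=1..<Suc i. 4 * real k)"
    by (rule sum.reindex_bij_witness[where i="\<lambda>k. 2 * M - k" and j="\<lambda>k. 2 * M - k"])
      (use j in \<open>auto simp: i_def diamond_r_def Let_def M_def[symmetric]\<close>)
  ultimately have s: "(\<Sum>k=1..<j. real (diamond_r N k)) = real N - 2 * real (Suc i) * (real (Suc i) - 1)"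
    using sum_diamond_r(2)[OF N, folded M_def] unfolding sum_four_times by linarith
  have "diamond_r N j = 4 * i" using j by (simp add: diamond_r_def Let_def M_def[symmetric] i_def)
  then show ?thesis
    using N unfolding diamond_h_def s M_def[symmetric] i_def[symmetric] by (simp add: field_simps power2_eq_square)
qed

lemma balanced_diamond_ring:
  assumes j: "1 \<le> j" "j \<le> 2 * diamond_M N - 1"
  shows "balanced_ring (real N) (diamond_h N j) (real (diamond_r N j))"
proof -
  define M where "M = diamond_M N"
  have M1: "real M \<ge> 1" using diamond_M_ge_1 by (simp add: M_def)
  consider "j < M" | "j = M" | "j > M" by linarith
  then show ?thesis
  proof cases
    case 1
    then show ?thesis
      using balanced_ring_polar[of j M "real N"] diamond_M_lower j(1) diamond_h_lower[of j]
      by (simp add: M_def diamond_r_def)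
  next
    case 3
    have rj: "real (diamond_r N j) = 4 * real (2 * M - j)" using 3 by (simp add: diamond_r_def Let_def M_def)
    have hj: "diamond_h N j = - (1 - 4 * (real (2 * M - j))\<^sup>2 / real N)"
      unfolding M_def using 3 j by (intro diamond_h_upper) (auto simp: M_def)
    show ?thesis
      unfolding rj hj using 3 j diamond_M_lower
      by (intro balanced_ring_uminus balanced_ring_polar[of _ M]) (auto simp: M_def)
  next
    case 2
    \<comment> \<open>The middle ring absorbs what rounding in \<open>M\<close> leaves over. Its
      size lies between \<open>4 * M\<close> and \<open>16 * M\<close>, and \<open>sqrt N\<close>
      between \<open>2 * M\<close> and \<open>2 * (M + 1) \<le> 4 * M\<close>; so it has at least
      \<open>sqrt N\<close> and at most \<open>8 * sqrt N\<close> points.\<close>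
    define r where "r = real (diamond_r N j)"
    have r: "r = real N - 4 * real M * (real M - 1)"
      using real_diamond_r_middle by (simp add: r_def 2 M_def)
    have rN: "r \<le> real N" using M1 by (simp add: r)
    have "(2 * real M)\<^sup>2 \<le> real N" using diamond_M_lower by (simp add: M_def power_mult_distrib)
    then have sM: "2 * real M \<le> sqrt (real N)" by (rule real_le_rsqrt)
    have up: "real N < 4 * (real M + 1)\<^sup>2" using diamond_M_upper by (simp add: M_def)
    have "r \<le> 16 * real M"
      using up M1 unfolding r by (simp add: power2_eq_square algebra_simps)
    then have r8: "r \<le> 8 * sqrt (real N)" using sM by linarith
    have "sqrt (real N) \<le> 2 * (real M + 1)"
    proof (rule real_le_lsqrt)
      show "real N \<le> (2 * (real M + 1))\<^sup>2" using up unfolding power_mult_distrib by simp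
    qed (use M1 in auto)
    moreover have "4 * real M \<le> r"
      using diamond_M_lower unfolding r M_def by (simp add: power2_eq_square algebra_simps)
    moreover have "2 * (real M + 1) \<le> 4 * real M" using M1 by simp
    ultimately have rs: "sqrt (real N) \<le> r" by (meson order_trans)
    have "diamond_h N j = 0" using diamond_h_middle 2 by (simp add: M_def)
    moreover have "balanced_ring (real N) 0 r"
      unfolding balanced_ring_def
    proof (intro conjI ballI)
      have "r / real N \<le> 1" using rN N by simp
      then show "{0 - r / real N..0 + r / real N} \<subseteq> {-1..1}" by auto
      show "r \<le> 8 * sqrt (real N) * sqrt (1 - 0\<^sup>2)" using r8 by simp
      fix k :: real
      have "sqrt (1 - k\<^sup>2) \<le> 1" by simp
      also have "1 \<le> r / sqrt (real N)" using rs N by simp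
      finally show "sqrt (1 - k\<^sup>2) \<le> r / sqrt (real N)" .
    qed
    ultimately show ?thesis by (simp add: r_def)
  qed
qed

text \<open>The heights \<open>b j\<close> cut off caps whose measure is the share of points on the
  first \<open>j\<close> rings, and \<open>diamond_h N j\<close> is the midpoint between
  \<open>b (j - 1)\<close> and \<open>b j\<close>. Rings are numbered downwards, so the index is
  reversed to obtain increasing endpoints.\<close>

lemma sum_diamond_bands:
  fixes g :: "real \<Rightarrow> real"
  assumes g: "continuous_on {-1..1} g"
  shows "(\<Sum>j=1..2 * diamond_M N - 1.
      integral {diamond_h N j - real (diamond_r N j) / real N..diamond_h N j + real (diamond_r N j) / real N} g)
    = integral {-1..1} g"
proof -
  define K where "K = 2 * diamond_M N - 1"
  define b where "b j = 1 - 2 / real N * (\<Sum>k=1..<Suc j. real (diamond_r N k))" for j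
  have b0: "b 0 = 1" by (simp add: b_def)
  have "(\<Sum>k=1..<Suc K. real (diamond_r N k)) = real N"
    using sum_diamond_r(2)[OF N] unfolding K_def atLeastLessThanSuc_atLeastAtMost of_nat_sum[symmetric] by simp
  then have bK: "b K = -1" using N by (simp add: b_def)
  have band: "diamond_h N (Suc j) - real (diamond_r N (Suc j)) / real N = b (Suc j)"
    "diamond_h N (Suc j) + real (diamond_r N (Suc j)) / real N = b j" for j
    using N by (simp_all add: diamond_h_def b_def field_simps)
  have "(\<Sum>j=1..K. integral {diamond_h N j - real (diamond_r N j) / real N..diamond_h N j + real (diamond_r N j) / real N} g)
     = (\<Sum>i<K. integral {b (K - i)..b (K - Suc i)} g)"
  proof (rule sum.reindex_bij_witness[where i="\<lambda>i. K - i" and j="\<lambda>j. K - j"])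
    fix j assume j: "j \<in> {1..K}"
    then obtain i where i: "j = Suc i" by (cases j) auto
    have "K - (K - j) = Suc i" "K - Suc (K - j) = i" using j i by auto
    then show "integral {b (K - (K - j))..b (K - Suc (K - j))} g
      = integral {diamond_h N j - real (diamond_r N j) / real N..diamond_h N j + real (diamond_r N j) / real N} g"
      by (simp only: i band)
  qed auto
  also have "\<dots> = integral {b (K - 0)..b (K - K)} g"
  proof (rule integral_sum_adjacent)
    fix i assume "i < K"
    then have "K - i = Suc (K - Suc i)" by simp
    moreover have "b (Suc q) \<le> b q" for q
      unfolding b_def by (intro diff_left_mono mult_left_mono sum_mono2) auto
    ultimately show "b (K - i) \<le> b (K - Suc i)" by simp
  qed (use g b0 bK in simp)
  finally show ?thesis unfolding K_def[symmetric] by (simp add: b0 bK)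
qed

lemma L2_cap_discrepancy_diamond_upper:
  "(L2_cap_discrepancy (diamond_points N))\<^sup>2 \<le> 14000000000 * real N powr (-3/2)"
proof -
  define n where "n = real N"
  have n: "n > 0" using N by (simp add: n_def)
  define J where "J = {1..2 * diamond_M N - 1}"
  define I where "I = (SIGMA j:J. {..<diamond_r N j})"
  define x where "x = (\<lambda>(j, l). diamond_point N j l)"
  define y where "y = (\<lambda>(j, l). ring_cell (diamond_h N j) (real (diamond_r N j) / n) (diamond_r N j) l)"
  have fI: "finite I" by (simp add: I_def J_def)
  have cI: "card I = N" using sum_diamond_r(2)[OF N] by (simp add: I_def J_def)
  have I0: "I \<noteq> {}" using cI N by auto
  have X: "diamond_points N = x ` I"
    unfolding diamond_points_def x_def I_def J_def by force
  \<comment> \<open>Equal cardinalities show that distinct indices give distinct points, so the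
    indexed sums of \<open>energy_upper\<close> are sums over the set.\<close>
  have inj: "inj_on x I"
    using card_diamond_points[OF N] fI by (intro eq_card_imp_inj_on) (simp_all add: X cI)
  have xc: "diamond_point N j l = cyl_point (diamond_h N j) (2 * pi * real l / real (diamond_r N j))" for j l
    by (simp add: diamond_point_def cyl_point_def diamond_\<rho>_def)
  have ring: "{diamond_h N j - real (diamond_r N j) / n..diamond_h N j + real (diamond_r N j) / n} \<subseteq> {-1..1}"
    "real (diamond_r N j) \<le> 8 * sqrt n * diamond_\<rho> N j"
    "\<And>k. k \<in> {diamond_h N j - real (diamond_r N j) / n..diamond_h N j + real (diamond_r N j) / n}
      \<Longrightarrow> sqrt (1 - k\<^sup>2) \<le> real (diamond_r N j) / sqrt n"
    "diamond_r N j > 0" if "j \<in> J" for j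
    using balanced_diamond_ring[of j] diamond_r_pos[OF N, of j] that
    unfolding balanced_ring_def diamond_\<rho>_def n_def J_def by auto
  have "4/3 - (\<Sum>i\<in>I. \<Sum>j\<in>I. dist (x i) (x j)) / (real (card I))\<^sup>2
    \<le> 440000 * (48 / sqrt n) ^ 3 + 24 * (\<Sum>i\<in>I. (norm ((\<integral>p. y i p \<partial>square_prob) - x i))\<^sup>2) / card I"
  proof (rule energy_upper)
    fix i assume i: "i \<in> I"
    obtain j l where jl: "i = (j, l)" "j \<in> J" "l < diamond_r N j" using i by (auto simp: I_def)
    show "x i \<in> sphere 0 1"
      using diamond_points_sphere[OF N] i by (auto simp: X)
    show "y i \<in> borel_measurable square_prob"
      by (simp add: y_def jl continuous_on_square_measurable continuous_on_ring_cell)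
    fix p assume p: "p \<in> space square_prob"
    show "norm (y i p - x i) \<le> 48 / sqrt n"
      unfolding y_def x_def jl prod.case xc
      by (rule ring_cell_estimates(1)[OF n ring(4) refl refl ring(1) _ ring(3)])
        (use jl ring(2) p in \<open>auto simp: diamond_\<rho>_def\<close>)
    define w where "w = real (diamond_r N j) / n"
    have w: "w > 0" using ring(4)[OF jl(2)] n by (simp add: w_def)
    have "w * fst p \<le> w * 1" "w * (-1) \<le> w * fst p"
      using p w by (intro mult_left_mono; auto simp: cbox_Pair_eq)+
    then have "diamond_h N j + w * fst p \<in> {diamond_h N j - w..diamond_h N j + w}" by auto
    then have "diamond_h N j + w * fst p \<in> {-1..1}" using ring(1)[OF jl(2)] unfolding w_def by blast
    then show "y i p \<in> sphere 0 1"
      unfolding y_def jl prod.case ring_cell_def w_def by (rule cyl_point_in_sphere)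
  next
    fix F :: "real^3 \<Rightarrow> real" assume F: "continuous_on (sphere 0 1) F"
    define g where "g h = integral {0..2*pi} (\<lambda>\<phi>. F (cyl_point h \<phi>))" for h
    have "(\<Sum>i\<in>I. \<integral>p. F (y i p) \<partial>square_prob)
      = (\<Sum>j\<in>J. \<Sum>l<diamond_r N j. \<integral>p. F (ring_cell (diamond_h N j) (real (diamond_r N j) / n) (diamond_r N j) l p) \<partial>square_prob)"
      unfolding I_def y_def by (subst sum.Sigma) (auto simp: J_def case_prod_unfold)
    also have "\<dots> = (\<Sum>j\<in>J. n / (4 * pi) *
      integral {diamond_h N j - real (diamond_r N j) / n..diamond_h N j + real (diamond_r N j) / n} g)"
    proof (rule sum.cong[OF refl])
      fix j assume j: "j \<in> J"
      have "(\<Sum>l<diamond_r N j. \<integral>p. F (ring_cell (diamond_h N j) (real (diamond_r N j) / n) (diamond_r N j) l p) \<partial>square_prob)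
        = real (diamond_r N j) / (4 * pi * (real (diamond_r N j) / n)) *
          integral {diamond_h N j - real (diamond_r N j) / n..diamond_h N j + real (diamond_r N j) / n} g"
        unfolding g_def[abs_def] using ring(4)[OF j] n ring(1)[OF j] by (intro sum_ring_cell_integral F) auto
      then show "(\<Sum>l<diamond_r N j. \<integral>p. F (ring_cell (diamond_h N j) (real (diamond_r N j) / n) (diamond_r N j) l p) \<partial>square_prob)
        = n / (4 * pi) * integral {diamond_h N j - real (diamond_r N j) / n..diamond_h N j + real (diamond_r N j) / n} g"
        using ring(4)[OF j] n by simp
    qed
    also have "\<dots> = n / (4 * pi) * integral {-1..1} g"
      unfolding sum_distrib_left[symmetric] J_def n_def
      by (subst sum_diamond_bands) (use integral_sphere_prob_cyl(1)[OF F] in \<open>simp_all add: g_def[abs_def]\<close>)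
    also have "\<dots> = n * (\<integral>z. F z \<partial>sphere_prob)"
      unfolding integral_sphere_prob_cyl(2)[OF F] g_def[abs_def] by simp
    finally show "(\<integral>z. F z \<partial>sphere_prob) = (\<Sum>i\<in>I. \<integral>p. F (y i p) \<partial>square_prob) / card I"
      using n by (simp add: cI n_def)
  qed (use fI I0 n in \<open>auto intro: square_prob.prob_space_axioms\<close>)
  also have "(\<Sum>i\<in>I. (norm ((\<integral>p. y i p \<partial>square_prob) - x i))\<^sup>2) \<le> 184320 / sqrt n"
  proof -
    have "(\<Sum>i\<in>I. (norm ((\<integral>p. y i p \<partial>square_prob) - x i))\<^sup>2)
      \<le> (\<Sum>i\<in>I. 23040 / (n * sqrt n * diamond_\<rho> N (fst i)))"
    proof (rule sum_mono)
      fix i assume "i \<in> I"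
      then obtain j l where jl: "i = (j, l)" "j \<in> J" "l < diamond_r N j" by (auto simp: I_def)
      show "(norm ((\<integral>p. y i p \<partial>square_prob) - x i))\<^sup>2 \<le> 23040 / (n * sqrt n * diamond_\<rho> N (fst i))"
        unfolding y_def x_def jl prod.case xc fst_conv
        by (rule norm_ring_cell_mean_le[OF n ring(4) refl _ ring(1) ring(2) ring(3)])
          (use jl in \<open>auto simp: diamond_\<rho>_def\<close>)
    qed
    also have "\<dots> = (\<Sum>j\<in>J. \<Sum>l<diamond_r N j. 23040 / (n * sqrt n * diamond_\<rho> N j))"
      unfolding I_def by (subst sum.Sigma) (auto simp: J_def case_prod_unfold)
    also have "\<dots> \<le> (\<Sum>j\<in>J. 184320 / n)"
    proof (rule sum_mono)
      fix j assume j: "j \<in> J"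
      have "sqrt n * diamond_\<rho> N j > 0" using ring(2,4)[OF j] by (simp add: mult.assoc)
      then have \<rho>: "diamond_\<rho> N j > 0" using n by (simp add: zero_less_mult_iff)
      have "(\<Sum>l<diamond_r N j. 23040 / (n * sqrt n * diamond_\<rho> N j)) = real (diamond_r N j) * (23040 / (n * sqrt n * diamond_\<rho> N j))"
        by simp
      \<comment> \<open>The small radius near the poles is compensated by the small number of
        points; all rings get the same bound, with \<open>184320 = 8 * 23040\<close>.\<close>
      also have "\<dots> \<le> (8 * sqrt n * diamond_\<rho> N j) * (23040 / (n * sqrt n * diamond_\<rho> N j))"
        using ring(2)[OF j] \<rho> n by (intro mult_right_mono) auto
      also have "\<dots> = 184320 / n" using \<rho> n by simp
      finally show "(\<Sum>l<diamond_r N j. 23040 / (n * sqrt n * diamond_\<rho> N j)) \<le> 184320 / n" .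
    qed
    also have "\<dots> = real (2 * diamond_M N - 1) * (184320 / n)" by (simp add: J_def)
    also have "\<dots> \<le> sqrt n * (184320 / n)"
    proof (rule mult_right_mono)
      have "(2 * real (diamond_M N))\<^sup>2 \<le> n" using diamond_M_lower by (simp add: n_def power_mult_distrib)
      then have "2 * real (diamond_M N) \<le> sqrt n" by (rule real_le_rsqrt)
      then show "real (2 * diamond_M N - 1) \<le> sqrt n" by linarith
    qed (use n in simp)
    also have "\<dots> = 184320 / sqrt n" using n real_sqrt_mult_self[of n] by (simp add: field_simps)
    finally show ?thesis .
  qed
  finally have "4/3 - (\<Sum>i\<in>I. \<Sum>j\<in>I. dist (x i) (x j)) / n\<^sup>2
    \<le> 440000 * (48 / sqrt n) ^ 3 + 24 * (184320 / sqrt n) / n"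
    using n by (simp add: cI n_def divide_right_mono)
  \<comment> \<open>Here \<open>110592 = 48 ^ 3\<close>, from the cell diameter
    \<open>48 / sqrt n\<close>; a quarter of the bracket is 12166225920.\<close>
  also have "\<dots> = (440000 * 110592 + 24 * 184320) * (1 / (n * sqrt n))"
    using n by (simp add: power_divide power3_eq_cube add_divide_distrib field_simps)
  also have "1 / (n * sqrt n) = n powr (-3/2)"
  proof -
    have "n powr (-3/2) = n powr ((-1) + (- (1/2)))" by simp
    also have "\<dots> = n powr (-1) * n powr (- (1/2))" by (rule powr_add)
    also have "\<dots> = 1 / (n * sqrt n)"
      using n by (simp add: powr_minus_divide powr_half_sqrt)
    finally show ?thesis by simp
  qed
  also have "(\<Sum>i\<in>I. \<Sum>j\<in>I. dist (x i) (x j)) = (\<Sum>a\<in>diamond_points N. \<Sum>b\<in>diamond_points N. dist a b)"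
    unfolding X by (simp add: sum.reindex[OF inj])
  finally have "4 * (L2_cap_discrepancy (diamond_points N))\<^sup>2 \<le> (440000 * 110592 + 24 * 184320) * n powr (-3/2)"
    using stolarsky_invariance[of "diamond_points N"] fI I0 diamond_points_sphere[OF N] card_diamond_points[OF N]
    by (simp add: X n_def)
  then have "(L2_cap_discrepancy (diamond_points N))\<^sup>2 \<le> 12166225920 * n powr (-3/2)" by simp
  also have "\<dots> \<le> 14000000000 * n powr (-3/2)" by (intro mult_right_mono) auto
  finally show ?thesis unfolding n_def .
qed

end

theorem corollary1:
  shows "\<exists>C c :: real. C > 0 \<and> c > 0 \<and>
    (\<forall>N::nat. N \<ge> 4 \<longrightarrow>
      c * real N powr (-3/4) \<le> L2_cap_discrepancy (diamond_points N) \<and>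
      L2_cap_discrepancy (diamond_points N) \<le> C * real N powr (-3/4))"
proof (intro exI conjI allI impI)
  fix N :: nat assume N: "N \<ge> 4"
  define D where "D = L2_cap_discrepancy (diamond_points N)"
  have fin: "finite (diamond_points N)"
    using card_diamond_points[OF N] N by (intro card_ge_0_finite) simp
  have ne: "diamond_points N \<noteq> {}"
    using card_diamond_points[OF N] N by auto
  have sq: "(k * real N powr (-3/4))\<^sup>2 = k\<^sup>2 * real N powr (-3/2)" for k
    by (simp add: power_mult_distrib power2_eq_square powr_add[symmetric])
  have low: "1/10 * real N powr (-3/2) \<le> D\<^sup>2"
    using L2_cap_discrepancy_lower[OF fin ne diamond_points_sphere[OF N]]
    by (simp only: card_diamond_points[OF N] D_def)
  have upp: "D\<^sup>2 \<le> 14000000000 * real N powr (-3/2)"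
    unfolding D_def by (rule L2_cap_discrepancy_diamond_upper[OF N])
  have D0: "0 \<le> D"
    unfolding D_def L2_cap_discrepancy_def set_lebesgue_integral_def
    by (intro real_sqrt_ge_zero integral_nonneg_AE AE_I2) (auto intro!: mult_nonneg_nonneg integral_nonneg_AE AE_I2)
  \<comment> \<open>The constants only have to survive squaring:
    \<open>(3/10)^2 = 9/100 \<le> 1/10\<close>, and below \<open>120000^2 = 14400000000\<close>
    exceeds 14000000000.\<close>
  have "(3/10 * real N powr (-3/4))\<^sup>2 \<le> D\<^sup>2"
    unfolding sq
    by (intro order_trans[OF _ low] mult_right_mono) (auto simp: power2_eq_square)
  then show "3/10 * real N powr (-3/4) \<le> L2_cap_discrepancy (diamond_points N)"
    unfolding D_def[symmetric] using D0 by (rule power2_le_imp_le)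
  have "D\<^sup>2 \<le> (120000 * real N powr (-3/4))\<^sup>2"
    unfolding sq by (intro order_trans[OF upp] mult_right_mono) (auto simp: power2_eq_square)
  then show "L2_cap_discrepancy (diamond_points N) \<le> 120000 * real N powr (-3/4)"
    unfolding D_def[symmetric] by (rule power2_le_imp_le) simp
qed auto

end
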